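(* Let $K$ be an algebraically closed field of characteristic $0$, and let $\nu_3(G_{3,9})\subset\mathbb{P}^{83}$ be the Plücker-embedded Grassmannian of $3$-dimensional subspaces of $K^9$. Then its fourth secant variety $[\nu_3(G_{3,9})]^4$ has dimension $73$, instead of the expected dimension $75$; in particular it is defective.
   Context: $G_{k,n+1}$ is the Grassmannian of $k$-dimensional linear subspaces of $K^{n+1}$, and $\nu_k:G_{k,n+1}\to \mathbb{P}(\wedge^kK^{n+1})\simeq\mathbb{P}^{\binom{n+1}{k}-1}$ is the Plücker embedding $\langle v_1,\dots,v_k\rangle\mapsto [v_1\wedge\cdots\wedge v_k]$. For a closed irreducible projective variety $X\subseteq\mathbb{P}^N$, the $s$-th (higher) secant variety $X^s$ is the closure of the union of all linear spaces spanned by $s$ points of $X$. Its expected dimension is $\min\{N,\ s\dim X+s-1\}$; $X^s$ is called defective if $\dim X^s$ is strictly smaller than this. *)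

theory Defs
  imports
    "HOL-Analysis.Abstract_Topology"
    "HOL-Computational_Algebra.Polynomial"
    "HOL-Library.Extended_Nat"
    "HOL-Library.Function_Algebras"
    "HOL-Library.Poly_Mapping"
    "Jordan_Normal_Form.Determinant"
begin

section \<open>Coordinate spaces and projective spaces\<close>

text \<open>
  For a finite index set \<open>I\<close>, the space \<open>K\<^sup>I\<close> is realised as the functions vanishing
  outside \<open>I\<close>. This covers both \<open>K\<^sup>m\<close> (with \<open>I = {..<m}\<close>) and exterior powers in coordinates.
\<close>

interpretation fvec: vector_space "\<lambda>(c::'a::field) (f::'i \<Rightarrow> 'a). (\<lambda>i. c * f i)"
  by unfold_locales (simp_all add: fun_eq_iff distrib_left distrib_right mult.assoc)

definition coord_space :: "'i set \<Rightarrow> ('i \<Rightarrow> 'a::field) set" where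
  "coord_space I = {x. \<forall>i. i \<notin> I \<longrightarrow> x i = 0}"

text \<open>A point of \<open>\<bbbP>(K\<^sup>I)\<close> is a one-dimensional subspace of \<open>K\<^sup>I\<close>; the dimension of
  \<open>\<bbbP>(K\<^sup>I)\<close> is \<open>card I - 1\<close>.\<close>

definition proj_point :: "('i \<Rightarrow> 'a::field) \<Rightarrow> ('i \<Rightarrow> 'a) set" where
  "proj_point x = fvec.span {x}"

definition proj_space :: "'i set \<Rightarrow> ('i \<Rightarrow> 'a::field) set set" where
  "proj_space I = {proj_point x | x. x \<in> coord_space I \<and> x \<noteq> 0}"

definition proj_span :: "'i set \<Rightarrow> ('i \<Rightarrow> 'a::field) set set \<Rightarrow> ('i \<Rightarrow> 'a) set set" where
  "proj_span I A = {L \<in> proj_space I. L \<subseteq> fvec.span (\<Union>A)}"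

section \<open>The Zariski topology on projective space\<close>

text \<open>Polynomials in variables indexed by \<open>'i\<close> are finitely supported maps from monomials
  (exponent vectors) to coefficients.\<close>

definition monom_eval :: "('i \<Rightarrow>\<^sub>0 nat) \<Rightarrow> ('i \<Rightarrow> 'a::field) \<Rightarrow> 'a" where
  "monom_eval m x = (\<Prod>i\<in>Poly_Mapping.keys m. x i ^ Poly_Mapping.lookup m i)"

definition mpoly_eval :: "(('i \<Rightarrow>\<^sub>0 nat) \<Rightarrow>\<^sub>0 'a::field) \<Rightarrow> ('i \<Rightarrow> 'a) \<Rightarrow> 'a" where
  "mpoly_eval f x = (\<Sum>m\<in>Poly_Mapping.keys f. Poly_Mapping.lookup f m * monom_eval m x)"

definition hom_polys :: "'i set \<Rightarrow> nat \<Rightarrow> (('i \<Rightarrow>\<^sub>0 nat) \<Rightarrow>\<^sub>0 'a::field) set" where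
  "hom_polys I d = {f. \<forall>m\<in>Poly_Mapping.keys f. Poly_Mapping.keys m \<subseteq> I \<and>
     (\<Sum>i\<in>Poly_Mapping.keys m. Poly_Mapping.lookup m i) = d}"

definition proj_zeros ::
    "'i set \<Rightarrow> (('i \<Rightarrow>\<^sub>0 nat) \<Rightarrow>\<^sub>0 'a::field) set \<Rightarrow> ('i \<Rightarrow> 'a) set set" where
  "proj_zeros I F = {L \<in> proj_space I. \<forall>f\<in>F. \<forall>x\<in>L. mpoly_eval f x = 0}"

definition zariski_closed :: "'i set \<Rightarrow> ('i \<Rightarrow> 'a::field) set set \<Rightarrow> bool" where
  "zariski_closed I Z \<longleftrightarrow> (\<exists>F \<subseteq> (\<Union>d. hom_polys I d). Z = proj_zeros I F)"

definition zariski :: "'i set \<Rightarrow> ('i \<Rightarrow> 'a::field) set topology" where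
  "zariski I = topology (\<lambda>U. U \<subseteq> proj_space I \<and> zariski_closed I (proj_space I - U))"

lemma mpoly_eval_superset:
  assumes "finite A" "Poly_Mapping.keys f \<subseteq> A"
  shows "mpoly_eval f x = (\<Sum>m\<in>A. Poly_Mapping.lookup f m * monom_eval m x)"
  unfolding mpoly_eval_def
  by (rule sum.mono_neutral_left) (use assms in \<open>auto simp: in_keys_iff\<close>)

lemma mpoly_eval_zero [simp]: "mpoly_eval 0 x = 0"
  by (simp add: mpoly_eval_def)

lemma mpoly_eval_add: "mpoly_eval (f + g) x = mpoly_eval f x + mpoly_eval g x"
proof -
  let ?A = "Poly_Mapping.keys f \<union> Poly_Mapping.keys g"
  have "Poly_Mapping.keys (f + g) \<subseteq> ?A" by (rule Poly_Mapping.keys_add)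
  then show ?thesis
    by (simp add: mpoly_eval_superset[of ?A] lookup_add distrib_right sum.distrib)
qed

lemma monom_eval_superset:
  assumes "finite A" "Poly_Mapping.keys m \<subseteq> A"
  shows "monom_eval m x = (\<Prod>i\<in>A. x i ^ Poly_Mapping.lookup m i)"
  unfolding monom_eval_def
  by (rule prod.mono_neutral_left) (use assms in \<open>auto simp: in_keys_iff\<close>)

lemma monom_eval_add: "monom_eval (m + m') x = monom_eval m x * monom_eval m' x"
proof -
  let ?A = "Poly_Mapping.keys m \<union> Poly_Mapping.keys m'"
  have "Poly_Mapping.keys (m + m') \<subseteq> ?A" by (rule Poly_Mapping.keys_add)
  then show ?thesis
    by (simp add: monom_eval_superset[of ?A] lookup_add power_add prod.distrib)
qed

lemma mpoly_eval_single: "mpoly_eval (Poly_Mapping.single m c) x = c * monom_eval m x"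
  by (simp add: mpoly_eval_def)

lemma mpoly_induct [case_names zero add_single]:
  assumes "P 0" "\<And>m c f. P f \<Longrightarrow> P (Poly_Mapping.single m c + f)"
  shows "P (f :: 'm \<Rightarrow>\<^sub>0 'a::ring_1)"
proof (induction "card (Poly_Mapping.keys f)" arbitrary: f)
  case 0
  then show ?case using assms(1) by simp
next
  case (Suc n)
  then obtain m where m: "m \<in> Poly_Mapping.keys f"
    by (metis card.empty equals0I nat.distinct(1))
  let ?s = "Poly_Mapping.single m (Poly_Mapping.lookup f m)"
  have "Poly_Mapping.keys (f - ?s) = Poly_Mapping.keys f - {m}"
    by (auto simp: in_keys_iff lookup_minus lookup_single when_def split: if_splits)
  then have "P (f - ?s)" using Suc m by (metis card_Suc_Diff1 finite_keys nat.inject)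
  from assms(2)[OF this, of m "Poly_Mapping.lookup f m"] show ?case by simp
qed

lemma mpoly_eval_mult: "mpoly_eval (f * g) x = mpoly_eval f x * mpoly_eval g x"
proof (induction f rule: mpoly_induct)
  case (add_single m c f)
  have "mpoly_eval (Poly_Mapping.single m c * g) x = c * monom_eval m x * mpoly_eval g x"
  proof (induction g rule: mpoly_induct)
    case (add_single m' c' g)
    then show ?case
      by (simp add: distrib_left mpoly_eval_add mult_single mpoly_eval_single monom_eval_add)
  qed simp
  with add_single show ?case by (simp add: distrib_right mpoly_eval_add mpoly_eval_single)
qed simp

lemma degree_add_monom:
  "(\<Sum>i\<in>Poly_Mapping.keys (m + m'). Poly_Mapping.lookup (m + m') i) =
   (\<Sum>i\<in>Poly_Mapping.keys m. Poly_Mapping.lookup m i) +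
   (\<Sum>i\<in>Poly_Mapping.keys m'. Poly_Mapping.lookup m' (i::'i) :: nat)"
proof -
  let ?A = "Poly_Mapping.keys m \<union> Poly_Mapping.keys m'"
  have *: "(\<Sum>i\<in>Poly_Mapping.keys l. Poly_Mapping.lookup l i) =
      (\<Sum>i\<in>?A. Poly_Mapping.lookup l i)" if "Poly_Mapping.keys l \<subseteq> ?A" for l
    by (rule sum.mono_neutral_left) (use that in \<open>auto simp: in_keys_iff\<close>)
  show ?thesis
    using *[of "m + m'"] *[of m] *[of m'] Poly_Mapping.keys_add[of m m']
    by (simp add: lookup_add sum.distrib)
qed

lemma hom_polys_mult:
  assumes "f \<in> hom_polys I d" "g \<in> hom_polys I e"
  shows "f * g \<in> hom_polys I (d + e)"
proof -
  have "Poly_Mapping.keys k \<subseteq> I \<and> (\<Sum>i\<in>Poly_Mapping.keys k. Poly_Mapping.lookup k i) = d + e"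
    if k: "k \<in> Poly_Mapping.keys (f * g)" for k
  proof -
    obtain m m' where "k = m + m'" "m \<in> Poly_Mapping.keys f" "m' \<in> Poly_Mapping.keys g"
      using k Poly_Mapping.keys_mult[of f g] by blast
    then show ?thesis
      using assms subset_trans[OF Poly_Mapping.keys_add[of m m'], of I]
      by (simp add: hom_polys_def degree_add_monom)
  qed
  then show ?thesis by (simp add: hom_polys_def)
qed

lemma mpoly_eval_scale:
  assumes "f \<in> hom_polys I d"
  shows "mpoly_eval f (\<lambda>i. c * x i) = c ^ d * mpoly_eval f x"
proof -
  have "monom_eval m (\<lambda>i. c * x i) = c ^ d * monom_eval m x" if "m \<in> Poly_Mapping.keys f" for m
    using assms that
    by (auto simp: hom_polys_def monom_eval_def power_mult_distrib prod.distrib power_sum)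
  then show ?thesis
    by (simp add: mpoly_eval_def sum_distrib_left mult.left_commute)
qed

lemma proj_point_eq: "proj_point x = range (\<lambda>c i. c * x i)"
  by (simp add: proj_point_def fvec.span_singleton)

lemma vanishes_on_proj_point_iff:
  assumes "f \<in> hom_polys I d"
  shows "(\<forall>y\<in>proj_point x. mpoly_eval f y = 0) \<longleftrightarrow> mpoly_eval f x = 0"
proof
  assume "\<forall>y\<in>proj_point x. mpoly_eval f y = 0"
  moreover have "x \<in> proj_point x" by (simp add: proj_point_def fvec.span_base)
  ultimately show "mpoly_eval f x = 0" by blast
qed (auto simp: proj_point_eq mpoly_eval_scale[OF assms])

lemma proj_point_in_zeros_iff:
  assumes "F \<subseteq> (\<Union>d. hom_polys I d)" "x \<in> coord_space I" "x \<noteq> 0"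
  shows "proj_point x \<in> proj_zeros I F \<longleftrightarrow> (\<forall>f\<in>F. mpoly_eval f x = 0)"
proof -
  have "proj_point x \<in> proj_space I" using assms(2,3) by (auto simp: proj_space_def)
  moreover have "(\<forall>y\<in>proj_point x. mpoly_eval f y = 0) \<longleftrightarrow> mpoly_eval f x = 0" if "f \<in> F" for f
    using assms(1) that vanishes_on_proj_point_iff by blast
  ultimately show ?thesis by (simp add: proj_zeros_def)
qed

lemma zariski_closed_Un:
  assumes "zariski_closed I Y" "zariski_closed I Z"
  shows "zariski_closed I (Y \<union> Z)"
proof -
  obtain F G where F: "F \<subseteq> (\<Union>d. hom_polys I d)" "Y = proj_zeros I F"
    and G: "G \<subseteq> (\<Union>d. hom_polys I d)" "Z = proj_zeros I G"
    using assms by (auto simp: zariski_closed_def)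
  let ?H = "(\<lambda>(f, g). f * g) ` (F \<times> G)"
  have H: "?H \<subseteq> (\<Union>d. hom_polys I d)"
    using F(1) G(1) by (auto dest!: subsetD intro: hom_polys_mult)
  have "L \<in> Y \<union> Z \<longleftrightarrow> L \<in> proj_zeros I ?H" if L: "L \<in> proj_space I" for L
  proof -
    obtain x where x: "L = proj_point x" "x \<in> coord_space I" "x \<noteq> 0"
      using L by (auto simp: proj_space_def)
    show ?thesis
      using proj_point_in_zeros_iff[OF F(1) x(2,3)] proj_point_in_zeros_iff[OF G(1) x(2,3)]
        proj_point_in_zeros_iff[OF H x(2,3)]
      by (auto simp: F(2) G(2) x(1) mpoly_eval_mult)
  qed
  moreover have "Y \<union> Z \<subseteq> proj_space I" "proj_zeros I ?H \<subseteq> proj_space I"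
    by (auto simp: F(2) G(2) proj_zeros_def)
  ultimately have "Y \<union> Z = proj_zeros I ?H" by blast
  then show ?thesis using H unfolding zariski_closed_def by blast
qed

lemma zariski_closed_Inter:
  assumes "\<And>Z. Z \<in> \<Z> \<Longrightarrow> zariski_closed I Z"
  shows "zariski_closed I (proj_space I \<inter> \<Inter>\<Z>)"
proof -
  obtain F where F: "\<And>Z. Z \<in> \<Z> \<Longrightarrow> F Z \<subseteq> (\<Union>d. hom_polys I d) \<and> Z = proj_zeros I (F Z)"
    using assms unfolding zariski_closed_def by metis
  have "proj_space I \<inter> \<Inter>\<Z> = proj_zeros I (\<Union>(F ` \<Z>))"
  proof (intro equalityI subsetI)
    fix L assume L: "L \<in> proj_space I \<inter> \<Inter>\<Z>"
    then have "L \<in> proj_zeros I (F Z)" if "Z \<in> \<Z>" for Z using F[OF that] that by blast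
    then show "L \<in> proj_zeros I (\<Union>(F ` \<Z>))" using L by (auto simp: proj_zeros_def)
  next
    fix L assume L: "L \<in> proj_zeros I (\<Union>(F ` \<Z>))"
    then have "L \<in> proj_zeros I (F Z)" if "Z \<in> \<Z>" for Z
      using that by (auto simp: proj_zeros_def)
    then have "L \<in> Z" if "Z \<in> \<Z>" for Z using F[OF that] that by blast
    then show "L \<in> proj_space I \<inter> \<Inter>\<Z>" using L by (auto simp: proj_zeros_def)
  qed
  moreover have "\<Union>(F ` \<Z>) \<subseteq> (\<Union>d. hom_polys I d)" using F by blast
  ultimately show ?thesis unfolding zariski_closed_def by blast
qed

lemma openin_zariski:
  fixes I :: "'i set" and U :: "('i \<Rightarrow> 'a::field) set set"
  shows "openin (zariski I) U \<longleftrightarrow> U \<subseteq> proj_space I \<and> zariski_closed I (proj_space I - U)"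
proof -
  let ?L = "\<lambda>U :: ('i \<Rightarrow> 'a) set set. U \<subseteq> proj_space I \<and> zariski_closed I (proj_space I - U)"
  have 1: "?L (S \<inter> T)" if "?L S" "?L T" for S T
  proof
    show "S \<inter> T \<subseteq> proj_space I" using that by blast
    show "zariski_closed I (proj_space I - S \<inter> T)"
      unfolding Diff_Int by (rule zariski_closed_Un) (use that in blast)+
  qed
  have 2: "?L (\<Union>\<K>)" if K: "\<forall>U\<in>\<K>. ?L U" for \<K>
  proof -
    have "proj_space I - \<Union>\<K> = proj_space I \<inter> \<Inter>((\<lambda>U. proj_space I - U) ` \<K>)" by blast
    moreover have "zariski_closed I (proj_space I \<inter> \<Inter>((\<lambda>U. proj_space I - U) ` \<K>))"
      by (rule zariski_closed_Inter) (use K in blast)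
    ultimately have "zariski_closed I (proj_space I - \<Union>\<K>)" by (simp only:)
    with K show ?thesis by blast
  qed
  have "istopology ?L"
    unfolding istopology_def by (rule conjI; (intro allI impI)?) (rule 1 2; assumption)+
  then show ?thesis by (simp add: zariski_def topology_inverse')
qed

lemma zariski_closed_empty: "zariski_closed I ({} :: ('i \<Rightarrow> 'a::field) set set)"
proof -
  let ?one = "1 :: ('i \<Rightarrow>\<^sub>0 nat) \<Rightarrow>\<^sub>0 'a"
  have one: "mpoly_eval ?one x = 1" for x
    using mpoly_eval_single[of 0 1 x] by (simp add: monom_eval_def)
  have hom: "?one \<in> hom_polys I 0"
    by (simp add: hom_polys_def)
  have "L \<notin> proj_zeros I {?one}" for L
  proof
    assume L: "L \<in> proj_zeros I {?one}"
    then obtain x where "L = proj_point x" by (auto simp: proj_zeros_def proj_space_def)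
    then have "x \<in> L" by (simp add: proj_point_def fvec.span_base)
    then show False using L by (simp add: proj_zeros_def one)
  qed
  then have "proj_zeros I {?one} = {}" by blast
  moreover have "{?one} \<subseteq> (\<Union>d. hom_polys I d)" using hom by blast
  ultimately show ?thesis unfolding zariski_closed_def by (intro exI[of _ "{?one}"]) simp
qed

lemma topspace_zariski: "topspace (zariski I) = (proj_space I :: ('i \<Rightarrow> 'a::field) set set)"
proof (rule subset_antisym)
  show "topspace (zariski I) \<subseteq> (proj_space I :: ('i \<Rightarrow> 'a) set set)"
    using openin_zariski[of I "topspace (zariski I)"] openin_topspace by blast
  show "(proj_space I :: ('i \<Rightarrow> 'a) set set) \<subseteq> topspace (zariski I)"
    by (rule openin_subset) (simp add: openin_zariski zariski_closed_empty)
qed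

lemma closedin_zariski: "closedin (zariski I) Z \<longleftrightarrow> zariski_closed I Z"
proof -
  have "zariski_closed I Z \<Longrightarrow> Z \<subseteq> proj_space I"
    by (auto simp: zariski_closed_def proj_zeros_def)
  then show ?thesis
    by (auto simp: closedin_def topspace_zariski openin_zariski double_diff)
qed

section \<open>Dimension\<close>

definition irreducible_in :: "'p topology \<Rightarrow> 'p set \<Rightarrow> bool" where
  "irreducible_in T Z \<longleftrightarrow> Z \<noteq> {} \<and> Z \<subseteq> topspace T \<and>
     (\<forall>A B. closedin T A \<and> closedin T B \<and> Z \<subseteq> A \<union> B \<longrightarrow> Z \<subseteq> A \<or> Z \<subseteq> B)"

text \<open>Krull dimension of a topological space; the empty space gets dimension \<open>0\<close>.\<close>

definition krull_dim :: "'p topology \<Rightarrow> enat" where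
  "krull_dim T = Sup {enat n | n. \<exists>Z :: nat \<Rightarrow> 'p set.
     (\<forall>i\<le>n. closedin T (Z i) \<and> irreducible_in T (Z i)) \<and> (\<forall>i<n. Z i \<subset> Z (Suc i))}"

definition proj_dim :: "'i set \<Rightarrow> ('i \<Rightarrow> 'a::field) set set \<Rightarrow> enat" where
  "proj_dim I X = krull_dim (subtopology (zariski I) X)"

section \<open>Secant varieties\<close>

text \<open>The \<open>s\<close> points are allowed to coincide.\<close>

definition secant_variety ::
    "'i set \<Rightarrow> nat \<Rightarrow> ('i \<Rightarrow> 'a::field) set set \<Rightarrow> ('i \<Rightarrow> 'a) set set" where
  "secant_variety I s X =
     zariski I closure_of (\<Union>p\<in>{p :: nat \<Rightarrow> _. \<forall>j<s. p j \<in> X}. proj_span I (p ` {..<s}))"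

definition expected_secant_dim :: "'i set \<Rightarrow> nat \<Rightarrow> ('i \<Rightarrow> 'a::field) set set \<Rightarrow> enat" where
  "expected_secant_dim I s X = min (enat (card I - 1)) (enat s * proj_dim I X + enat s - 1)"

definition secant_defective :: "'i set \<Rightarrow> nat \<Rightarrow> ('i \<Rightarrow> 'a::field) set set \<Rightarrow> bool" where
  "secant_defective I s X \<longleftrightarrow> proj_dim I (secant_variety I s X) < expected_secant_dim I s X"

section \<open>Grassmannians and the Pluecker embedding\<close>

definition grassmannian :: "nat \<Rightarrow> nat \<Rightarrow> (nat \<Rightarrow> 'a::field) set set" where
  "grassmannian k m = {W. fvec.subspace W \<and> W \<subseteq> coord_space {..<m} \<and> fvec.dim W = k}"

text \<open>The basis of the \<open>k\<close>-th exterior power of \<open>K\<^sup>m\<close> given by the vectors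
  \<open>e\<^bsub>i\<^sub>1\<^esub> \<and> \<dots> \<and> e\<^bsub>i\<^sub>k\<^esub>\<close> with \<open>i\<^sub>1 < \<dots> < i\<^sub>k\<close> is indexed by the \<open>k\<close>-subsets of \<open>{..<m}\<close>; in this
  basis the coordinates of \<open>v\<^sub>1 \<and> \<dots> \<and> v\<^sub>k\<close> are the maximal minors of the matrix with rows
  \<open>v\<^sub>1, \<dots>, v\<^sub>k\<close>.\<close>

definition ksubsets :: "nat \<Rightarrow> nat \<Rightarrow> nat set set" where
  "ksubsets k m = {S. S \<subseteq> {..<m} \<and> card S = k}"

lemma card_ksubsets: "card (ksubsets k m) = m choose k"
  using n_subsets[of "{..<m}" k] by (simp add: ksubsets_def)

definition wedge :: "nat \<Rightarrow> nat \<Rightarrow> (nat \<Rightarrow> nat \<Rightarrow> 'a::field) \<Rightarrow> nat set \<Rightarrow> 'a" where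
  "wedge k m v = (\<lambda>S. if S \<in> ksubsets k m
     then det (mat k k (\<lambda>(i, j). v i (sorted_list_of_set S ! j))) else 0)"

definition pluecker :: "nat \<Rightarrow> nat \<Rightarrow> (nat \<Rightarrow> 'a::field) set \<Rightarrow> (nat set \<Rightarrow> 'a) set" where
  "pluecker k m W =
     (THE L. \<exists>v. W = fvec.span (v ` {..<k}) \<and> L = proj_point (wedge k m v))"

lemma wedge_change_of_basis:
  assumes "\<And>i. i < k \<Longrightarrow> w i \<in> fvec.span (v ` {..<k})"
  shows "\<exists>c. wedge k m w = (\<lambda>S. c * wedge k m v S)"
proof -
  have "\<exists>a. x = (\<lambda>l. \<Sum>j<k. a j * v j l)" if "x \<in> fvec.span (v ` {..<k})" for x
    using that
  proof (induction rule: fvec.span_induct_alt)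
    case base
    show ?case by (rule exI[of _ "\<lambda>_. 0"]) (simp add: fun_eq_iff)
  next
    case (step c x y)
    then obtain j a where "j < k" "x = v j" and a: "y = (\<lambda>l. \<Sum>j<k. a j * v j l)" by auto
    then show ?case
      by (intro exI[of _ "\<lambda>i. (if i = j then c else 0) + a i"])
        (simp add: fun_eq_iff distrib_right sum.distrib if_distrib[of "\<lambda>t. t * _"] cong: if_cong)
  qed
  with assms have "\<forall>i. \<exists>a. i < k \<longrightarrow> w i = (\<lambda>l. \<Sum>j<k. a j * v j l)" by blast
  from choice[OF this]
  obtain a where a: "\<And>i. i < k \<Longrightarrow> w i = (\<lambda>l. \<Sum>j<k. a i j * v j l)"
    by blast
  let ?A = "mat k k (\<lambda>(i, j). a i j)"
  have "wedge k m w S = det ?A * wedge k m v S" for S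
  proof (cases "S \<in> ksubsets k m")
    case True
    let ?M = "\<lambda>u. mat k k (\<lambda>(i, j). u i (sorted_list_of_set S ! j))"
    have "?M w = ?A * ?M v"
      by (rule eq_matI) (auto simp: a scalar_prod_def atLeast0LessThan)
    then have "det (?M w) = det ?A * det (?M v)"
      using det_mult[of ?A k "?M v"] by simp
    then show ?thesis using True by (simp add: wedge_def)
  qed (simp add: wedge_def)
  then show ?thesis by (intro exI[of _ "det ?A"]) (simp add: fun_eq_iff)
qed

lemma proj_point_wedge_subset:
  assumes "fvec.span (w ` {..<k}) = fvec.span (v ` {..<k})"
  shows "proj_point (wedge k m w) \<subseteq> proj_point (wedge k m v)"
proof -
  have "w i \<in> fvec.span (v ` {..<k})" if "i < k" for i
    unfolding assms[symmetric] by (rule fvec.span_base) (use that in blast)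
  from wedge_change_of_basis[where w = w and v = v, OF this]
  obtain c where "wedge k m w = (\<lambda>S. c * wedge k m v S)" by blast
  then show ?thesis
    unfolding proj_point_eq by (auto simp flip: mult.assoc)
qed

lemma pluecker_span: "pluecker k m (fvec.span (v ` {..<k})) = proj_point (wedge k m v)"
  unfolding pluecker_def
proof (rule the_equality)
  fix L assume "\<exists>w. fvec.span (v ` {..<k}) = fvec.span (w ` {..<k}) \<and> L = proj_point (wedge k m w)"
  then show "L = proj_point (wedge k m v)"
    using proj_point_wedge_subset by (metis subset_antisym)
qed blast

end

(* The affine cone over X is handled through Hilbert functions. Along a strict chain of irreducible closed
   sets the Hilbert function grows by one degree per step, while a variety dominated by an m-parameter
   polynomial map has a Hilbert function of degree at most m: this bounds Krull dimensions from above.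
   From below, m directions that are linearly independent, modulo the point itself, at one point of a
   parametrisation give a chain of length m, namely the closures of the images of coordinate subspaces.

   Upper bound 73: three general 3-spaces of K^9 split it as A \<otimes> K^3 in such a way that a fourth one is
   the diagonal copy of A. A sum of four decomposable vectors is then det_A \<otimes> F with F a ternary cubic. The
   group GL(A) x GL_3 has dimension 18 and its subgroup of pairs of scalars (t, 1/t) acts trivially on
   A \<otimes> K^3, so tensors of this kind depend on 81 - 17 + 10 = 74 parameters. The naive count gives 76
   because the decomposition of F into four cubes is not unique but moves in a 2-dimensional family. *)

theory Submission
  imports Defs
begin

section \<open>Polynomial functions\<close>

text \<open>Dominance is never proved. For the upper bound it is enough that every form vanishing on
  the parametrised tensors vanishes on all sums of four wedges (\<open>form_dense\<close>). Open
  conditions such as invertibility can then be dropped: the given data are joined by a line to data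
  that satisfy them, and a polynomial function of one variable over an infinite field that vanishes
  wherever another, nonzero one does not must vanish everywhere. The two bounds use different
  parametrisations. The upper one must have exactly 73 parameters, so the group is used up by a
  normal form that fixes 17 of the 81 entries, and the projective scaling by setting one coefficient
  of the cubic to 1: 64 + 9 = 73. Reaching the normal form takes an eigenvector of a pencil of
  matrices, the only use of algebraic closedness. The lower one must stay inside the secant variety,
  so it consists of sums of four wedges around a special point; of the 4 * 19 obvious tangent
  directions of the cone there, two are redundant and one is traded for the point itself.\<close>

definition polyfun1 :: "('a::field_char_0 \<Rightarrow> 'a) \<Rightarrow> bool" where
  "polyfun1 h \<longleftrightarrow> (\<exists>q. \<forall>t. h t = poly q t)"

named_theorems polyfun1_intros

lemma polyfun1_const [polyfun1_intros]: "polyfun1 (\<lambda>t. c)"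
  unfolding polyfun1_def by (rule exI[of _ "[:c:]"]) simp

lemma polyfun1_id [polyfun1_intros]: "polyfun1 (\<lambda>t. t)"
  unfolding polyfun1_def by (rule exI[of _ "[:0, 1:]"]) simp

lemma polyfun1_add [polyfun1_intros]:
  "polyfun1 f \<Longrightarrow> polyfun1 g \<Longrightarrow> polyfun1 (\<lambda>t. f t + g t)"
  unfolding polyfun1_def by (metis poly_add)

lemma polyfun1_diff [polyfun1_intros]:
  "polyfun1 f \<Longrightarrow> polyfun1 g \<Longrightarrow> polyfun1 (\<lambda>t. f t - g t)"
  unfolding polyfun1_def by (metis poly_diff)

lemma polyfun1_mult [polyfun1_intros]:
  "polyfun1 f \<Longrightarrow> polyfun1 g \<Longrightarrow> polyfun1 (\<lambda>t. f t * g t)"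
  unfolding polyfun1_def by (metis poly_mult)

lemma polyfun1_power [polyfun1_intros]: "polyfun1 f \<Longrightarrow> polyfun1 (\<lambda>t. f t ^ n)"
  unfolding polyfun1_def by (metis poly_power)

lemma polyfun1_sum [polyfun1_intros]:
  "(\<And>i. i \<in> A \<Longrightarrow> polyfun1 (f i)) \<Longrightarrow> polyfun1 (\<lambda>t. \<Sum>i\<in>A. f i t)"
  by (induction A rule: infinite_finite_induct) (auto intro: polyfun1_intros)

lemma polyfun1_prod [polyfun1_intros]:
  "(\<And>i. i \<in> A \<Longrightarrow> polyfun1 (f i)) \<Longrightarrow> polyfun1 (\<lambda>t. \<Prod>i\<in>A. f i t)"
  by (induction A rule: infinite_finite_induct) (auto intro: polyfun1_intros)

lemma polyfun1_mpoly_eval [polyfun1_intros]: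
  assumes "\<And>i. polyfun1 (\<lambda>t. y t i)"
  shows "polyfun1 (\<lambda>t. mpoly_eval f (y t))"
  unfolding mpoly_eval_def monom_eval_def by (intro polyfun1_intros assms)

lemma polyfun1_det [polyfun1_intros]:
  assumes "\<And>i j. polyfun1 (\<lambda>t. A t i j)"
  shows "polyfun1 (\<lambda>t. det (mat n n (\<lambda>(i, j). A t i j)))"
proof -
  have *: "det (mat n n (\<lambda>(i, j). A t i j)) =
      (\<Sum>p | p permutes {0..<n}. signof p * (\<Prod>i = 0..<n. A t i (p i)))" for t
    by (subst det_def'[of _ n]) (auto intro!: sum.cong prod.cong dest: permutes_in_image[of _ "{0..<n}"])
  show ?thesis
    unfolding * by (intro polyfun1_intros assms)
qed

lemma polyfun1_wedge [polyfun1_intros]: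
  assumes "\<And>a j. polyfun1 (\<lambda>t. v t a j)"
  shows "polyfun1 (\<lambda>t. wedge k m (v t) S)"
  by (cases "S \<in> ksubsets k m") (auto simp: wedge_def intro!: polyfun1_intros assms)

text \<open>In characteristic 0 the field is infinite, so polynomial functions of one variable
  correspond to polynomials and have no zero divisors.\<close>

lemma polyfun1_integral_domain:
  assumes "polyfun1 h" "polyfun1 g" "\<And>t. h t * g t = 0" "g b \<noteq> 0"
  shows "h a = 0"
proof -
  obtain p q where p: "\<And>t. h t = poly p t" and q: "\<And>t. g t = poly q t"
    using assms(1,2) unfolding polyfun1_def by blast
  have "\<forall>t. poly (p * q) t = 0" using assms(3) by (simp add: p q)
  then have "p * q = 0" by (simp only: poly_all_0_iff_0)
  moreover have "q \<noteq> 0" using assms(4) by (auto simp: q)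
  ultimately show ?thesis by (simp add: p)
qed

text \<open>The device that removes every genericity assumption: \<open>g b \<noteq> 0\<close>
  exhibits one good point on a line, and the special point \<open>a\<close> of the line inherits the
  vanishing.\<close>

lemma polyfun1_extend_zero:
  assumes "polyfun1 h" "polyfun1 g" "g b \<noteq> 0" "\<And>t. g t \<noteq> 0 \<Longrightarrow> h t = 0"
  shows "h a = 0"
  by (rule polyfun1_integral_domain[OF assms(1,2) _ assms(3)]) (use assms(4) in auto)

section \<open>Polynomial functions of finitely many variables\<close>

definition monofun :: "'p set \<Rightarrow> ('p \<Rightarrow> nat) \<Rightarrow> ('p \<Rightarrow> 'a::field) \<Rightarrow> 'a" where
  "monofun V \<alpha> s = (\<Prod>p\<in>V. s p ^ \<alpha> p)"

text \<open>Exponent vectors are extensional outside \<open>V\<close>, so that each monomial in the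
  variables \<open>V\<close> is listed exactly once.\<close>

definition box :: "'p set \<Rightarrow> nat \<Rightarrow> ('p \<Rightarrow> nat) set" where
  "box V d = PiE V (\<lambda>_. {..d})"

lemma finite_box: "finite V \<Longrightarrow> finite (box V d)"
  by (simp add: box_def finite_PiE)

lemma card_box: "finite V \<Longrightarrow> card (box V d) = (d + 1) ^ card V"
  by (simp add: box_def card_PiE)

text \<open>The bound \<open>d\<close> applies to the degree in each single variable.\<close>

definition polyfun :: "'p set \<Rightarrow> nat \<Rightarrow> (('p \<Rightarrow> 'a::field) \<Rightarrow> 'a) set" where
  "polyfun V d = fvec.span (monofun V ` box V d)"

lemma polyfun_zero: "(\<lambda>s. 0) \<in> polyfun V d"
  using fvec.span_zero unfolding polyfun_def zero_fun_def by blast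

lemma polyfun_add: "f \<in> polyfun V d \<Longrightarrow> g \<in> polyfun V d \<Longrightarrow> (\<lambda>s. f s + g s) \<in> polyfun V d"
  using fvec.span_add unfolding polyfun_def plus_fun_def by blast

lemma polyfun_scale: "f \<in> polyfun V d \<Longrightarrow> (\<lambda>s. c * f s) \<in> polyfun V d"
  unfolding polyfun_def by (rule fvec.span_scale)

lemma polyfun_sum: "(\<And>i. i \<in> A \<Longrightarrow> f i \<in> polyfun V d) \<Longrightarrow> (\<lambda>s. \<Sum>i\<in>A. f i s) \<in> polyfun V d"
  by (induction A rule: infinite_finite_induct) (auto intro: polyfun_zero polyfun_add)

lemma polyfun_mono:
  assumes "d \<le> e"
  shows "polyfun V d \<subseteq> polyfun V e"
proof -
  have "box V d \<subseteq> box V e" unfolding box_def by (rule PiE_mono) (use assms in auto)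
  then show ?thesis unfolding polyfun_def by (intro fvec.span_mono image_mono)
qed

lemma polyfun_const: "(\<lambda>s :: 'p \<Rightarrow> 'a::field. c) \<in> polyfun V d"
proof -
  have "monofun V (\<lambda>p\<in>V. 0) = (\<lambda>s::_\<Rightarrow>'a. 1)" by (simp add: monofun_def fun_eq_iff)
  moreover have "(\<lambda>p\<in>V. 0) \<in> box V d" by (simp add: box_def)
  ultimately have "(\<lambda>s::_\<Rightarrow>'a. 1) \<in> polyfun V d"
    unfolding polyfun_def by (metis fvec.span_base imageI)
  from polyfun_scale[OF this, of c] show ?thesis by simp
qed

lemma polyfun_var:
  assumes "finite V" "p \<in> V"
  shows "(\<lambda>s :: 'p \<Rightarrow> 'a::field. s p) \<in> polyfun V 1"
proof -
  let ?a = "\<lambda>q\<in>V. if q = p then 1 else 0::nat"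
  have "monofun V ?a s = s p" for s :: "_ \<Rightarrow> 'a"
  proof -
    have "monofun V ?a s = (\<Prod>q\<in>V. if q = p then s q else 1)"
      unfolding monofun_def by (rule prod.cong) auto
    then show ?thesis using assms by simp
  qed
  then have "monofun V ?a = (\<lambda>s::_\<Rightarrow>'a. s p)" by (simp add: fun_eq_iff)
  moreover have "?a \<in> box V 1" by (auto simp: box_def)
  ultimately show ?thesis unfolding polyfun_def by (metis fvec.span_base imageI)
qed

lemma polyfun_mult:
  fixes f g :: "('p \<Rightarrow> 'a::field) \<Rightarrow> 'a"
  assumes "f \<in> polyfun V d" "g \<in> polyfun V e"
  shows "(\<lambda>s. f s * g s) \<in> polyfun V (d + e)"
proof -
  have mono: "(\<lambda>s. monofun V \<alpha> s * g s) \<in> polyfun V (d + e)" if \<alpha>: "\<alpha> \<in> box V d" for \<alpha>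
    using assms(2) unfolding polyfun_def[of V e]
  proof (induction rule: fvec.span_induct_alt)
    case base
    show ?case by (simp add: polyfun_zero)
  next
    case (step c x y)
    then obtain \<beta> where \<beta>: "\<beta> \<in> box V e" "x = monofun V \<beta>" by blast
    let ?c = "\<lambda>p\<in>V. \<alpha> p + \<beta> p"
    have "monofun V ?c = (\<lambda>s::_\<Rightarrow>'a. monofun V \<alpha> s * monofun V \<beta> s)"
      by (auto simp: fun_eq_iff monofun_def power_add prod.distrib)
    moreover have "?c \<in> box V (d + e)"
      using \<alpha> \<beta>(1) by (auto simp: box_def PiE_iff intro!: add_mono)
    ultimately have "(\<lambda>s::_\<Rightarrow>'a. monofun V \<alpha> s * monofun V \<beta> s) \<in> polyfun V (d + e)"
      unfolding polyfun_def by (metis fvec.span_base imageI)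
    from polyfun_add[OF polyfun_scale[OF this, of c] step.IH]
    show ?case by (simp add: \<beta>(2) algebra_simps)
  qed
  show ?thesis
    using assms(1) unfolding polyfun_def[of V d]
  proof (induction rule: fvec.span_induct_alt)
    case base
    show ?case by (simp add: polyfun_zero)
  next
    case (step c x y)
    then obtain \<alpha> where "\<alpha> \<in> box V d" "x = monofun V \<alpha>" by blast
    from polyfun_add[OF polyfun_scale[OF mono[OF this(1)], of c] step.IH] this(2)
    show ?case by (simp add: algebra_simps)
  qed
qed

lemma polyfun_power:
  assumes "f \<in> polyfun V d"
  shows "(\<lambda>s. f s ^ n) \<in> polyfun V (d * n)"
proof (induction n)
  case 0
  show ?case by (simp add: polyfun_const)
next
  case (Suc n)
  from polyfun_mult[OF assms this] show ?case by (simp add: algebra_simps)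
qed

lemma polyfun_prod:
  assumes "finite A" "\<And>i. i \<in> A \<Longrightarrow> f i \<in> polyfun V (d i)"
  shows "(\<lambda>s. \<Prod>i\<in>A. f i s) \<in> polyfun V (\<Sum>i\<in>A. d i)"
  using assms by (induction A rule: finite_induct) (auto intro: polyfun_const polyfun_mult)

text \<open>The bound grows linearly in \<open>t\<close>; this makes the later counts grow like
  \<open>t ^ card V\<close>.\<close>

lemma polyfun_mpoly_eval:
  assumes "f \<in> hom_polys I t" "\<And>i. i \<in> I \<Longrightarrow> (\<lambda>s. \<phi> s i) \<in> polyfun V D"
  shows "(\<lambda>s. mpoly_eval f (\<phi> s)) \<in> polyfun V (D * t)"
  unfolding mpoly_eval_def
proof (intro polyfun_sum polyfun_scale)
  fix m assume m: "m \<in> Poly_Mapping.keys f"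
  then have "(\<Sum>i\<in>Poly_Mapping.keys m. D * Poly_Mapping.lookup m i) = D * t"
    and "Poly_Mapping.keys m \<subseteq> I"
    using assms(1) by (auto simp: hom_polys_def simp flip: sum_distrib_left)
  moreover from this have "(\<lambda>s. \<Prod>i\<in>Poly_Mapping.keys m. \<phi> s i ^ Poly_Mapping.lookup m i)
      \<in> polyfun V (\<Sum>i\<in>Poly_Mapping.keys m. D * Poly_Mapping.lookup m i)"
    by (intro polyfun_prod polyfun_power assms(2)) auto
  ultimately show "(\<lambda>s. monom_eval m (\<phi> s)) \<in> polyfun V (D * t)"
    by (simp add: monom_eval_def)
qed

lemma polyfun1_polyfun:
  assumes "f \<in> polyfun V d" "\<And>p. polyfun1 (\<lambda>t. y t p)"
  shows "polyfun1 (\<lambda>t. f (y t))"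
  using assms(1) unfolding polyfun_def
  by (induction rule: fvec.span_induct_alt)
    (auto simp: monofun_def intro!: polyfun1_intros assms(2))

text \<open>Independence is stated for coefficients indexed by \<open>A\<close>, so it also rules
  out repetitions: equal members would satisfy a relation with coefficients 1 and -1.\<close>

lemma polyfun_family_card:
  fixes F :: "'k \<Rightarrow> ('p \<Rightarrow> 'a::field) \<Rightarrow> 'a"
  assumes "finite A" "finite V" "\<And>a. a \<in> A \<Longrightarrow> F a \<in> polyfun V d"
    and indep: "\<And>c. (\<forall>s. (\<Sum>a\<in>A. c a * F a s) = 0) \<Longrightarrow> \<forall>a\<in>A. c a = 0"
  shows "card A \<le> (d + 1) ^ card V"
proof -
  have inj: "inj_on F A"
  proof (rule inj_onI, rule ccontr)
    fix a b assume ab: "a \<in> A" "b \<in> A" "F a = F b" "a \<noteq> b"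
    let ?c = "\<lambda>x. if x = a then 1 else if x = b then -1 else (0::'a)"
    have "(\<Sum>x\<in>A. ?c x * F x s) = 0" for s
    proof -
      have "(\<Sum>x\<in>A. ?c x * F x s) = (\<Sum>x\<in>A. (if x = a then F a s else 0) - (if x = b then F b s else 0))"
        by (rule sum.cong) (use ab in auto)
      then show ?thesis using ab assms(1) by (simp add: sum_subtractf)
    qed
    with indep[of ?c] ab show False by auto
  qed
  have "fvec.independent (F ` A)"
  proof (rule ccontr)
    assume "\<not> fvec.independent (F ` A)"
    then obtain u where u: "\<exists>v\<in>F ` A. u v \<noteq> 0" "(\<Sum>v\<in>F ` A. (\<lambda>i. u v * v i)) = 0"
      using assms(1) by (auto simp: fvec.dependent_finite)
    have "(\<Sum>a\<in>A. u (F a) * F a s) = 0" for s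
    proof -
      have "(\<Sum>a\<in>A. u (F a) * F a s) = (\<Sum>v\<in>F ` A. (\<lambda>i. u v * v i)) s"
        unfolding sum.reindex[OF inj] using assms(1) by (induction A rule: finite_induct) simp_all
      then show ?thesis using u(2) by simp
    qed
    with indep[of "\<lambda>a. u (F a)"] u(1) show False by blast
  qed
  moreover have "F ` A \<subseteq> fvec.span (monofun V ` box V d)"
    using assms(3) by (auto simp: polyfun_def)
  ultimately have "card (F ` A) \<le> card ((monofun V :: _ \<Rightarrow> ('p \<Rightarrow> 'a) \<Rightarrow> 'a) ` box V d)"
    using fvec.independent_span_bound finite_box[OF assms(2)] by blast
  also have "\<dots> \<le> card (box V d)" by (rule card_image_le[OF finite_box[OF assms(2)]])
  finally show ?thesis by (simp add: card_image[OF inj] card_box[OF assms(2)])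
qed

lemma box_insert_sum:
  assumes "p \<notin> V"
  shows "(\<Sum>\<alpha>\<in>box (insert p V) d. g \<alpha>) = (\<Sum>j\<le>d. \<Sum>\<alpha>\<in>box V d. g (\<alpha>(p := j)))"
proof -
  have "box (insert p V) d = (\<lambda>(j, \<alpha>). \<alpha>(p := j)) ` ({..d} \<times> box V d)"
    unfolding box_def by (rule PiE_insert_eq)
  moreover have "inj_on (\<lambda>(j, \<alpha>). \<alpha>(p := j)) ({..d} \<times> box V d)"
    unfolding box_def using assms by (rule inj_combinator)
  ultimately show ?thesis
    by (simp add: sum.reindex sum.cartesian_product case_prod_unfold)
qed

text \<open>Induction over the variables: for fixed values of the others, the sum is a polynomial in
  the value of \<open>p\<close> that vanishes everywhere, so each of its coefficients
  vanishes.\<close>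

lemma monofun_coeffs_zero:
  fixes c :: "('p \<Rightarrow> nat) \<Rightarrow> 'a::field_char_0"
  assumes "finite V" "\<And>s. (\<Sum>\<alpha>\<in>box V d. c \<alpha> * monofun V \<alpha> s) = 0"
  shows "\<forall>\<alpha>\<in>box V d. c \<alpha> = 0"
  using assms
proof (induction V arbitrary: c rule: finite_induct)
  case empty
  then show ?case by (simp add: box_def monofun_def)
next
  case (insert p V)
  have "\<forall>\<alpha>\<in>box V d. c (\<alpha>(p := j)) = 0" if j: "j \<le> d" for j
  proof (rule insert.IH)
    fix s :: "'p \<Rightarrow> 'a"
    let ?e = "\<lambda>j. \<Sum>\<alpha>\<in>box V d. c (\<alpha>(p := j)) * monofun V \<alpha> s"
    have "(\<Sum>j\<le>d. ?e j * t ^ j) = 0" for t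
    proof -
      have "0 = (\<Sum>\<alpha>\<in>box (insert p V) d. c \<alpha> * monofun (insert p V) \<alpha> (s(p := t)))"
        using insert.prems by simp
      also have "\<dots> = (\<Sum>j\<le>d. ?e j * t ^ j)"
      proof -
        have "monofun (insert p V) (\<alpha>(p := j)) (s(p := t)) = t ^ j * monofun V \<alpha> s" for \<alpha> j
        proof -
          have "(\<Prod>q\<in>V. (if q = p then t else s q) ^ (if q = p then j else \<alpha> q)) = (\<Prod>q\<in>V. s q ^ \<alpha> q)"
            by (rule prod.cong) (use insert.hyps in auto)
          then show ?thesis using insert.hyps by (simp add: monofun_def fun_upd_def)
        qed
        then show ?thesis
          unfolding box_insert_sum[OF insert.hyps(2)] sum_distrib_right
          by (simp add: algebra_simps)
      qed
      finally show ?thesis by simp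
    qed
    then have "\<forall>t. poly (\<Sum>j\<le>d. monom (?e j) j) t = 0"
      by (simp add: poly_sum poly_monom)
    then have "(\<Sum>j\<le>d. monom (?e j) j) = 0" by (simp only: poly_all_0_iff_0)
    then have "coeff (\<Sum>j\<le>d. monom (?e j) j) j = 0" by simp
    then show "?e j = 0" using j by (simp add: coeff_sum)
  qed
  moreover have "\<exists>j\<le>d. \<exists>\<beta>\<in>box V d. \<alpha> = \<beta>(p := j)" if "\<alpha> \<in> box (insert p V) d" for \<alpha>
    using that unfolding box_def PiE_insert_eq by auto
  ultimately show ?case by blast
qed

section \<open>Dimension bounds from parametrisations\<close>

lemma hom_polys_zero: "0 \<in> hom_polys I d"
  by (simp add: hom_polys_def)

lemma hom_polys_add:
  assumes "f \<in> hom_polys I d" "g \<in> hom_polys I d"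
  shows "f + g \<in> hom_polys I d"
proof -
  have "Poly_Mapping.keys (f + g) \<subseteq> Poly_Mapping.keys f \<union> Poly_Mapping.keys g"
    by (rule Poly_Mapping.keys_add)
  then show ?thesis using assms unfolding hom_polys_def by blast
qed

lemma hom_polys_one: "1 \<in> hom_polys I 0"
  by (simp add: hom_polys_def)

lemma mpoly_eval_one: "mpoly_eval 1 x = 1"
  using mpoly_eval_single[of 0 1 x] by (simp add: monom_eval_def)

lemma hom_polys_const: "Poly_Mapping.single 0 c \<in> hom_polys I 0"
  by (auto simp: hom_polys_def split: if_splits)

lemma mpoly_eval_const: "mpoly_eval (Poly_Mapping.single 0 c) x = c"
  by (simp add: mpoly_eval_single monom_eval_def)

lemma hom_polys_smult:
  "f \<in> hom_polys I d \<Longrightarrow> Poly_Mapping.single 0 c * f \<in> hom_polys I d"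
  using hom_polys_mult[OF hom_polys_const] by fastforce

lemma mpoly_eval_smult: "mpoly_eval (Poly_Mapping.single 0 c * f) x = c * mpoly_eval f x"
  by (simp add: mpoly_eval_mult mpoly_eval_const)

lemma hom_polys_power:
  assumes "f \<in> hom_polys I d"
  shows "f ^ n \<in> hom_polys I (d * n)"
proof (induction n)
  case (Suc n)
  from hom_polys_mult[OF assms this] show ?case by simp
qed (simp add: hom_polys_one)

lemma mpoly_eval_power: "mpoly_eval (f ^ n) x = mpoly_eval f x ^ n"
  by (induction n) (simp_all add: mpoly_eval_one mpoly_eval_mult)

lemma mpoly_eval_sum: "mpoly_eval (\<Sum>a\<in>A. f a) x = (\<Sum>a\<in>A. mpoly_eval (f a) x)"
  by (induction A rule: infinite_finite_induct) (simp_all add: mpoly_eval_add)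

lemma hom_polys_sum: "(\<And>a. a \<in> A \<Longrightarrow> f a \<in> hom_polys I d) \<Longrightarrow> (\<Sum>a\<in>A. f a) \<in> hom_polys I d"
  by (induction A rule: infinite_finite_induct) (auto intro: hom_polys_zero hom_polys_add)

lemma mpoly_eval_prod: "mpoly_eval (\<Prod>a\<in>A. f a) x = (\<Prod>a\<in>A. mpoly_eval (f a) x)"
  by (induction A rule: infinite_finite_induct) (simp_all add: mpoly_eval_mult mpoly_eval_one)

lemma hom_polys_prod:
  "finite A \<Longrightarrow> (\<And>a. a \<in> A \<Longrightarrow> f a \<in> hom_polys I (d a)) \<Longrightarrow>
    (\<Prod>a\<in>A. f a) \<in> hom_polys I (\<Sum>a\<in>A. d a)"
  by (induction A rule: finite_induct) (auto intro: hom_polys_one hom_polys_mult)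

definition coord_poly :: "'i \<Rightarrow> ('i \<Rightarrow>\<^sub>0 nat) \<Rightarrow>\<^sub>0 'a::field" where
  "coord_poly i = Poly_Mapping.single (Poly_Mapping.single i 1) 1"

lemma hom_polys_coord: "i \<in> I \<Longrightarrow> coord_poly i \<in> hom_polys I 1"
  by (auto simp: hom_polys_def coord_poly_def split: if_splits)

lemma mpoly_eval_coord: "mpoly_eval (coord_poly i) x = x i"
  by (simp add: coord_poly_def mpoly_eval_single monom_eval_def)

text \<open>Scaling by 0 with \<open>0 ^ 0 = 1\<close>: both values equal the value at the
  origin.\<close>

lemma hom_polys_degree_0:
  assumes "f \<in> hom_polys I 0"
  shows "mpoly_eval f x = mpoly_eval f y"
  using mpoly_eval_scale[OF assms, of 0 x] mpoly_eval_scale[OF assms, of 0 y] by simp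

section \<open>Hilbert functions along chains: the upper bound\<close>

definition indep_on :: "'x set \<Rightarrow> 'k set \<Rightarrow> ('k \<Rightarrow> 'x \<Rightarrow> 'a::field) \<Rightarrow> bool" where
  "indep_on C A F \<longleftrightarrow> (\<forall>c. (\<forall>x\<in>C. (\<Sum>a\<in>A. c a * F a x) = 0) \<longrightarrow> (\<forall>a\<in>A. c a = 0))"

text \<open>A lower bound \<open>N\<close> for the value at \<open>t\<close> of the Hilbert function of the cone \<open>C\<close>.\<close>

definition hilbert_ge :: "'i set \<Rightarrow> ('i \<Rightarrow> 'a::field) set \<Rightarrow> nat \<Rightarrow> nat \<Rightarrow> bool" where
  "hilbert_ge I C t N \<longleftrightarrow>
     (\<exists>F. (\<forall>j<N. F j \<in> hom_polys I t) \<and> indep_on C {..<N} (\<lambda>j. mpoly_eval (F j)))"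

lemma hilbert_ge_mono:
  assumes "hilbert_ge I C t N" "M \<le> N"
  shows "hilbert_ge I C t M"
proof -
  obtain F where F: "\<And>j. j < N \<Longrightarrow> F j \<in> hom_polys I t"
    and ind: "indep_on C {..<N} (\<lambda>j. mpoly_eval (F j))"
    using assms(1) by (auto simp: hilbert_ge_def)
  have "indep_on C {..<M} (\<lambda>j. mpoly_eval (F j))"
    unfolding indep_on_def
  proof (intro allI impI)
    fix c assume c: "\<forall>x\<in>C. (\<Sum>j<M. c j * mpoly_eval (F j) x) = 0"
    have "(\<Sum>j<N. (if j < M then c j else 0) * mpoly_eval (F j) x) = (\<Sum>j<M. c j * mpoly_eval (F j) x)" for x
      by (rule sum.mono_neutral_cong_right) (use assms(2) in auto)
    with c ind have "\<forall>j\<in>{..<N}. (if j < M then c j else 0) = 0"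
      unfolding indep_on_def by presburger
    with assms(2) show "\<forall>j\<in>{..<M}. c j = 0" by (auto split: if_splits)
  qed
  with F assms(2) show ?thesis unfolding hilbert_ge_def by (intro exI[of _ F]) auto
qed

text \<open>Restriction to \<open>C\<close> kills the multiples of \<open>G\<close> and so isolates
  the coefficients of the first block; \<open>dom\<close> then cancels \<open>G\<close> on
  \<open>C'\<close> and leaves a relation within the second block.\<close>

lemma hilbert_ge_add:
  assumes C: "hilbert_ge I C (e + t) N" and C': "hilbert_ge I C' t M" and "C \<subseteq> C'"
    and G: "G \<in> hom_polys I e" "\<And>x. x \<in> C \<Longrightarrow> mpoly_eval G x = 0"
    and dom: "\<And>h. h \<in> hom_polys I t \<Longrightarrow> (\<And>x. x \<in> C' \<Longrightarrow> mpoly_eval G x * mpoly_eval h x = 0) \<Longrightarrow>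
      \<forall>x\<in>C'. mpoly_eval h x = 0"
  shows "hilbert_ge I C' (e + t) (N + M)"
proof -
  obtain F where F: "\<And>j. j < N \<Longrightarrow> F j \<in> hom_polys I (e + t)"
    and indF: "indep_on C {..<N} (\<lambda>j. mpoly_eval (F j))"
    using C by (auto simp: hilbert_ge_def)
  obtain H where H: "\<And>j. j < M \<Longrightarrow> H j \<in> hom_polys I t"
    and indH: "indep_on C' {..<M} (\<lambda>j. mpoly_eval (H j))"
    using C' by (auto simp: hilbert_ge_def)
  let ?F = "\<lambda>j. if j < N then F j else G * H (j - N)"
  have split: "(\<Sum>j<N + M. c j * mpoly_eval (?F j) x) =
      (\<Sum>j<N. c j * mpoly_eval (F j) x) + mpoly_eval G x * (\<Sum>j<M. c (N + j) * mpoly_eval (H j) x)" for c x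
  proof -
    have "{..<N + M} = {..<N} \<union> (\<lambda>j. N + j) ` {..<M}"
      using ivl_disj_un_one(2)[of N "N + M"] image_add_atLeastLessThan[of N 0 M]
      by (simp add: atLeast0LessThan add.commute)
    then have "(\<Sum>j<N + M. c j * mpoly_eval (?F j) x) =
        (\<Sum>j<N. c j * mpoly_eval (?F j) x) + (\<Sum>j\<in>(\<lambda>j. N + j) ` {..<M}. c j * mpoly_eval (?F j) x)"
      by (subst sum.union_disjoint[symmetric]) auto
    then show ?thesis
      by (simp add: sum.reindex mpoly_eval_mult sum_distrib_left algebra_simps)
  qed
  have "indep_on C' {..<N + M} (\<lambda>j. mpoly_eval (?F j))"
    unfolding indep_on_def
  proof (intro allI impI)
    fix c assume c: "\<forall>x\<in>C'. (\<Sum>j<N + M. c j * mpoly_eval (?F j) x) = 0"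
    have "\<forall>x\<in>C. (\<Sum>j<N. c j * mpoly_eval (F j) x) = 0"
      using c \<open>C \<subseteq> C'\<close> G(2) unfolding split by fastforce
    with indF have N: "\<forall>j<N. c j = 0" by (auto simp: indep_on_def)
    let ?h = "\<Sum>j<M. Poly_Mapping.single 0 (c (N + j)) * H j"
    have h: "mpoly_eval ?h x = (\<Sum>j<M. c (N + j) * mpoly_eval (H j) x)" for x
      by (simp add: mpoly_eval_sum mpoly_eval_smult)
    have "\<forall>x\<in>C'. mpoly_eval ?h x = 0"
    proof (rule dom)
      show "?h \<in> hom_polys I t" by (intro hom_polys_sum hom_polys_smult H) auto
      show "mpoly_eval G x * mpoly_eval ?h x = 0" if "x \<in> C'" for x
        using c that N unfolding split h by simp
    qed
    with indH have M: "\<forall>j<M. c (N + j) = 0" by (auto simp: indep_on_def h)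
    show "\<forall>j\<in>{..<N + M}. c j = 0"
    proof
      fix j assume j: "j \<in> {..<N + M}"
      show "c j = 0"
      proof (cases "j < N")
        case False
        then show ?thesis using M[rule_format, of "j - N"] j by auto
      qed (use N in simp)
    qed
  qed
  moreover have "\<forall>j<N + M. ?F j \<in> hom_polys I (e + t)"
    using F H hom_polys_mult[OF G(1)] by auto
  ultimately show ?thesis unfolding hilbert_ge_def by (intro exI[of _ ?F] conjI)
qed

lemma closedin_proj_zeros:
  "f \<in> hom_polys I d \<Longrightarrow> closedin (zariski I) (proj_zeros I {f})"
  by (auto simp: closedin_zariski zariski_closed_def intro!: exI[of _ "{f}"])

text \<open>The zero loci of \<open>f\<close> and \<open>h\<close> are closed and cover
  \<open>Z\<close>, so irreducibility puts \<open>Z\<close> into one of them.\<close>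

lemma irreducible_in_zariski_domain:
  assumes Z: "irreducible_in (subtopology (zariski I) X) Z"
    and f: "f \<in> hom_polys I d" and h: "h \<in> hom_polys I e"
    and prod: "\<And>x. x \<in> \<Union>Z \<Longrightarrow> mpoly_eval f x * mpoly_eval h x = 0"
    and y: "y \<in> \<Union>Z" "mpoly_eval f y \<noteq> 0"
  shows "\<forall>x\<in>\<Union>Z. mpoly_eval h x = 0"
proof -
  let ?A = "\<lambda>g. proj_zeros I {g} \<inter> X"
  have ZX: "Z \<subseteq> proj_space I" "Z \<subseteq> X"
    using Z by (auto simp: irreducible_in_def topspace_zariski)
  have "Z \<subseteq> ?A f \<union> ?A h"
  proof
    fix L assume L: "L \<in> Z"
    with ZX(1) obtain x where x: "L = proj_point x" "x \<in> coord_space I" "x \<noteq> 0"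
      by (auto simp: proj_space_def)
    have "x \<in> \<Union>Z" using L x(1) by (auto simp: proj_point_def fvec.span_base intro!: bexI[of _ L])
    then have "mpoly_eval f x = 0 \<or> mpoly_eval h x = 0" using prod by simp
    then show "L \<in> ?A f \<union> ?A h"
      using proj_point_in_zeros_iff[of "{f}" I x] proj_point_in_zeros_iff[of "{h}" I x] x f h L ZX(2)
      by auto
  qed
  moreover have "closedin (subtopology (zariski I) X) (?A f)" "closedin (subtopology (zariski I) X) (?A h)"
    using closedin_proj_zeros[OF f] closedin_proj_zeros[OF h] by (auto simp: closedin_subtopology)
  ultimately have "Z \<subseteq> ?A f \<or> Z \<subseteq> ?A h"
    using Z unfolding irreducible_in_def by blast
  with y show ?thesis by (auto simp: proj_zeros_def)
qed

lemma closed_separating_form: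
  assumes Z: "closedin (subtopology (zariski I) X) Z" and L: "L \<in> X" "L \<in> proj_space I" "L \<notin> Z"
  shows "\<exists>f d y. f \<in> hom_polys I d \<and> (\<forall>x\<in>\<Union>Z. mpoly_eval f x = 0) \<and> y \<in> L \<and> mpoly_eval f y \<noteq> 0"
proof -
  obtain C where C: "closedin (zariski I) C" "Z = C \<inter> X"
    using Z by (auto simp: closedin_subtopology)
  then obtain F where F: "F \<subseteq> (\<Union>d. hom_polys I d)" "C = proj_zeros I F"
    by (auto simp: closedin_zariski zariski_closed_def)
  from L C F obtain f y where fy: "f \<in> F" "y \<in> L" "mpoly_eval f y \<noteq> 0"
    by (auto simp: proj_zeros_def)
  with F(1) obtain d where "f \<in> hom_polys I d" by blast
  moreover have "mpoly_eval f x = 0" if "x \<in> \<Union>Z" for x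
    using that fy(1) C F by (auto simp: proj_zeros_def)
  ultimately show ?thesis using fy by blast
qed

lemma hilbert_ge_zero_dim:
  assumes "L \<in> proj_space I" "L \<subseteq> C"
  shows "hilbert_ge I C k 1"
proof -
  obtain x where x: "L = proj_point x" "x \<in> coord_space I" "x \<noteq> 0"
    using assms(1) by (auto simp: proj_space_def)
  then obtain i where i: "x i \<noteq> 0" "i \<in> I" by (auto simp: coord_space_def fun_eq_iff)
  have "x \<in> C" using x(1) assms(2) by (auto simp: proj_point_def fvec.span_base)
  then have "indep_on C {..<1::nat} (\<lambda>j. mpoly_eval (coord_poly i ^ k))"
    using i(1) by (auto simp: indep_on_def mpoly_eval_power mpoly_eval_coord)
  moreover have "coord_poly i ^ k \<in> hom_polys I k"
    using hom_polys_power[OF hom_polys_coord[OF i(2)], of k] by simp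
  ultimately show ?thesis
    unfolding hilbert_ge_def by (intro exI[of _ "\<lambda>_. coord_poly i ^ k"]) simp
qed

text \<open>Multiplication by a form that vanishes on one
  member but not on the next is injective on the coordinate ring of the latter.\<close>

lemma hilbert_ge_chain:
  assumes Z: "\<And>i. i \<le> n \<Longrightarrow> closedin (subtopology (zariski I) X) (Z i)"
      "\<And>i. i \<le> n \<Longrightarrow> irreducible_in (subtopology (zariski I) X) (Z i)"
      "\<And>i. i < n \<Longrightarrow> Z i \<subset> Z (Suc i)"
    and "i \<le> n"
  shows "\<exists>g>0. \<forall>k. hilbert_ge I (\<Union>(Z i)) (g * k) ((k + i) choose i)"
  using \<open>i \<le> n\<close>
proof (induction i)
  case 0
  have "Z 0 \<noteq> {}" "Z 0 \<subseteq> proj_space I"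
    using Z(2)[of 0] by (auto simp: irreducible_in_def topspace_zariski)
  then obtain L where "L \<in> Z 0" "L \<in> proj_space I" by blast
  then have "hilbert_ge I (\<Union>(Z 0)) (1 * k) 1" for k
    by (intro hilbert_ge_zero_dim) auto
  then show ?case by (intro exI[of _ 1]) simp
next
  case (Suc i)
  then obtain g where g: "g > 0" "\<And>k. hilbert_ge I (\<Union>(Z i)) (g * k) ((k + i) choose i)" by auto
  have irr: "irreducible_in (subtopology (zariski I) X) (Z i)"
      "irreducible_in (subtopology (zariski I) X) (Z (Suc i))"
    and cl: "closedin (subtopology (zariski I) X) (Z i)" and sub: "Z i \<subset> Z (Suc i)"
    using Z Suc.prems by auto
  from sub obtain L where L: "L \<in> Z (Suc i)" "L \<notin> Z i" by auto
  have LX: "L \<in> X" "L \<in> proj_space I"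
    using L(1) irr(2) by (auto simp: irreducible_in_def topspace_zariski)
  obtain f e y where f: "f \<in> hom_polys I e" "\<And>x. x \<in> \<Union>(Z i) \<Longrightarrow> mpoly_eval f x = 0"
    and y: "y \<in> L" "mpoly_eval f y \<noteq> 0"
    using closed_separating_form[OF cl LX L(2)] by blast
  \<comment> \<open>A form of degree 0 is constant and cannot vanish on the nonempty
    \<open>Z i\<close> without vanishing at \<open>y\<close>.\<close>
  have "e > 0"
  proof (rule ccontr)
    assume "\<not> e > 0"
    then have "mpoly_eval f x = mpoly_eval f y" for x
      using hom_polys_degree_0 f(1) by (metis not_gr_zero)
    moreover have "\<Union>(Z i) \<noteq> {}"
    proof -
      have "Z i \<noteq> {}" "Z i \<subseteq> proj_space I"
        using irr(1) by (auto simp: irreducible_in_def topspace_zariski)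
      then obtain L' where "L' \<in> Z i" "L' \<noteq> {}" by (auto simp: proj_space_def proj_point_eq)
      then show ?thesis by blast
    qed
    ultimately show False using f(2) y(2) by (metis ex_in_conv)
  qed
  \<comment> \<open>The bound for \<open>Z i\<close> is known only in degrees divisible by
    \<open>g\<close>. The power \<open>g\<close> gives a multiplier of degree \<open>e * g\<close>,
    and \<open>e * g\<close> becomes the period for \<open>Z (Suc i)\<close>.\<close>
  let ?G = "f ^ g"
  have G: "?G \<in> hom_polys I (e * g)" "\<And>x. x \<in> \<Union>(Z i) \<Longrightarrow> mpoly_eval ?G x = 0" "mpoly_eval ?G y \<noteq> 0"
    using hom_polys_power[OF f(1), of g] f(2) y(2) g(1) by (auto simp: mpoly_eval_power)
  have "hilbert_ge I (\<Union>(Z (Suc i))) (e * g * k) ((k + Suc i) choose Suc i)" for k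
  proof (induction k)
    case 0
    show ?case
      using hilbert_ge_zero_dim[of L I "\<Union>(Z (Suc i))" 0] L(1) LX(2) by auto
  next
    case (Suc k)
    \<comment> \<open>The bound for \<open>Z i\<close> in degree \<open>e * g * Suc k\<close> is
      weakened so that the two binomials add up by Pascal's rule.\<close>
    have "(Suc k + i) choose i \<le> (e * Suc k + i) choose i"
      by (rule binomial_right_mono) (use mult_le_mono1[of 1 e "Suc k"] \<open>e > 0\<close> in simp)
    from hilbert_ge_mono[OF g(2) this]
    have "hilbert_ge I (\<Union>(Z i)) (e * g + e * g * k) ((Suc k + i) choose i)"
      by (simp add: algebra_simps)
    then have "hilbert_ge I (\<Union>(Z (Suc i))) (e * g + e * g * k)
        (((Suc k + i) choose i) + ((k + Suc i) choose Suc i))"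
    proof (rule hilbert_ge_add[OF _ Suc.IH])
      show "\<Union>(Z i) \<subseteq> \<Union>(Z (Suc i))" using sub by blast
      show "\<forall>x\<in>\<Union>(Z (Suc i)). mpoly_eval h x = 0"
        if "h \<in> hom_polys I (e * g * k)"
          "\<And>x. x \<in> \<Union>(Z (Suc i)) \<Longrightarrow> mpoly_eval ?G x * mpoly_eval h x = 0" for h
        by (rule irreducible_in_zariski_domain[OF irr(2) G(1) that(1) that(2) _ G(3)]) (use y(1) L(1) in auto)
    qed (use G in auto)
    then show ?case by (simp add: algebra_simps)
  qed
  then show ?case using \<open>e > 0\<close> g(1) by (metis mult_pos_pos)
qed

text \<open>Already \<open>k = B\<close> contradicts a larger exponent.\<close>

lemma power_growth_le:
  fixes n m B :: nat
  assumes "\<And>k. (k + 1) ^ n \<le> B * (k + 1) ^ m"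
  shows "n \<le> m"
proof (rule ccontr)
  assume "\<not> n \<le> m"
  then obtain r where r: "n = m + Suc r" by (metis add_Suc_right less_imp_Suc_add not_le)
  have "(B + 1) ^ m * ((B + 1) * 1) \<le> (B + 1) ^ m * ((B + 1) * (B + 1) ^ r)"
    by (intro mult_le_mono2) simp
  also have "\<dots> = (B + 1) ^ n" by (simp add: r power_add algebra_simps)
  also have "\<dots> \<le> (B + 1) ^ m * B" using assms[of B] by (simp only: mult.commute)
  finally show False by simp
qed

lemma power_le_fact_binomial: "(k + 1) ^ n \<le> fact n * ((k + n) choose n)"
proof -
  have "fact n * ((k + n) choose n) = (\<Prod>i = 1..n. k + i)"
  proof (induction n)
    case (Suc n)
    have "fact (Suc n) * ((k + Suc n) choose Suc n) = fact n * (Suc n * (Suc (k + n) choose Suc n))"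
      by (simp add: algebra_simps)
    also have "\<dots> = fact n * (Suc (k + n) * ((k + n) choose n))"
      by (simp only: Suc_times_binomial)
    also have "\<dots> = (\<Prod>i = 1..n. k + i) * (k + Suc n)"
      using Suc.IH by (simp add: algebra_simps)
    finally show ?case by simp
  qed simp
  moreover have "(\<Prod>i = 1..n. k + 1) \<le> (\<Prod>i = 1..n. k + i)"
    by (rule prod_mono) auto
  ultimately show ?thesis by simp
qed

text \<open>Zariski density of the image on the level of cones, tested by forms only; it passes to
  subsets of \<open>C\<close>.\<close>

definition form_dense :: "'i set \<Rightarrow> (('p \<Rightarrow> 'a::field) \<Rightarrow> 'i \<Rightarrow> 'a) \<Rightarrow> ('i \<Rightarrow> 'a) set \<Rightarrow> bool" where
  "form_dense I \<phi> C \<longleftrightarrow> (\<forall>t. \<forall>f\<in>hom_polys I t. (\<forall>s. mpoly_eval f (\<phi> s) = 0) \<longrightarrow> (\<forall>x\<in>C. mpoly_eval f x = 0))"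

text \<open>Pulling back along \<open>\<phi>\<close> keeps independence, because by density a
  relation between the pullbacks holds on \<open>C\<close>.\<close>

lemma indep_on_param_card:
  assumes "finite A" "finite V" "\<And>i. i \<in> I \<Longrightarrow> (\<lambda>s. \<phi> s i) \<in> polyfun V D"
    and dense: "form_dense I \<phi> C"
    and F: "\<And>a. a \<in> A \<Longrightarrow> F a \<in> hom_polys I t" "indep_on C A (\<lambda>a. mpoly_eval (F a))"
  shows "card A \<le> (D * t + 1) ^ card V"
proof (rule polyfun_family_card[OF assms(1,2)])
  show "(\<lambda>s. mpoly_eval (F a) (\<phi> s)) \<in> polyfun V (D * t)" if "a \<in> A" for a
    using polyfun_mpoly_eval[OF F(1)[OF that] assms(3)] .
next
  fix c assume c: "\<forall>s. (\<Sum>a\<in>A. c a * mpoly_eval (F a) (\<phi> s)) = 0"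
  let ?h = "\<Sum>a\<in>A. Poly_Mapping.single 0 (c a) * F a"
  have h: "mpoly_eval ?h x = (\<Sum>a\<in>A. c a * mpoly_eval (F a) x)" for x
    by (simp add: mpoly_eval_sum mpoly_eval_smult)
  have "?h \<in> hom_polys I t" by (intro hom_polys_sum hom_polys_smult F)
  with dense c have "\<forall>x\<in>C. mpoly_eval ?h x = 0" unfolding form_dense_def h[symmetric] by blast
  then show "\<forall>a\<in>A. c a = 0"
    using F(2)[unfolded indep_on_def, THEN spec[of _ c]] unfolding h by blast
qed

text \<open>For a chain of length \<open>n\<close>, the number of independent forms of degree
  \<open>g * k\<close> is at least of order \<open>k ^ n\<close> and at most
  \<open>(D * (g * k) + 1) ^ card V\<close>; letting \<open>k\<close> grow forces
  \<open>n \<le> card V\<close>.\<close>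

theorem proj_dim_le_param:
  assumes "finite V" "\<And>i. i \<in> I \<Longrightarrow> (\<lambda>s. \<phi> s i) \<in> polyfun V D"
    and dense: "form_dense I \<phi> (\<Union>X)"
  shows "proj_dim I X \<le> enat (card V)"
  unfolding proj_dim_def krull_dim_def
proof (rule Sup_least, clarify)
  fix n and Z :: "nat \<Rightarrow> ('b \<Rightarrow> 'c) set set"
  assume Z: "\<forall>i\<le>n. closedin (subtopology (zariski I) X) (Z i) \<and> irreducible_in (subtopology (zariski I) X) (Z i)"
    "\<forall>i<n. Z i \<subset> Z (Suc i)"
  obtain g where g: "\<And>k. hilbert_ge I (\<Union>(Z n)) (g * k) ((k + n) choose n)"
    using hilbert_ge_chain[of n I X Z n] Z by auto
  have "Z n \<subseteq> X" using Z(1) by (auto simp: irreducible_in_def topspace_zariski)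
  with dense have dense': "form_dense I \<phi> (\<Union>(Z n))" unfolding form_dense_def by blast
  have "(k + 1) ^ n \<le> (fact n * (D * g + 1) ^ card V) * (k + 1) ^ card V" for k
  proof -
    obtain F where "\<forall>j<(k + n) choose n. F j \<in> hom_polys I (g * k)"
      "indep_on (\<Union>(Z n)) {..<(k + n) choose n} (\<lambda>j. mpoly_eval (F j))"
      using g[of k] by (auto simp: hilbert_ge_def)
    then have "(k + n) choose n \<le> (D * (g * k) + 1) ^ card V"
      using indep_on_param_card[OF _ assms(1,2) dense', of "{..<(k + n) choose n}" F "g * k"] by simp
    also have "\<dots> \<le> ((D * g + 1) * (k + 1)) ^ card V"
      by (rule power_mono) (simp_all add: algebra_simps)
    finally have "fact n * ((k + n) choose n) \<le> fact n * ((D * g + 1) ^ card V * (k + 1) ^ card V)"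
      unfolding power_mult_distrib by (rule mult_le_mono2)
    with power_le_fact_binomial[of k n] show ?thesis by (simp only: mult.assoc)
  qed
  then show "enat n \<le> enat (card V)" using power_growth_le by (simp only: enat_ord_simps) blast
qed

section \<open>Chains from parametrisations: the lower bound\<close>

definition truncate_to :: "'p set \<Rightarrow> ('p \<Rightarrow> 'a::zero) \<Rightarrow> 'p \<Rightarrow> 'a" where
  "truncate_to V s = (\<lambda>p. if p \<in> V then s p else 0)"

lemma truncate_to_coord_space: "truncate_to V s \<in> coord_space V"
  by (simp add: truncate_to_def coord_space_def)

lemma truncate_to_id: "s \<in> coord_space V \<Longrightarrow> truncate_to V s = s"
  by (auto simp: truncate_to_def coord_space_def fun_eq_iff)

lemma polyfun_truncate:
  fixes f :: "('p \<Rightarrow> 'a::field) \<Rightarrow> 'a"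
  assumes "finite V" "finite W" "f \<in> polyfun V d"
  shows "(\<lambda>s. f (truncate_to W s)) \<in> polyfun W (card V * d)"
  using assms(3) unfolding polyfun_def[of V d]
proof (induction rule: fvec.span_induct_alt)
  case base
  show ?case by (simp add: polyfun_zero)
next
  case (step c x y)
  then obtain \<alpha> where \<alpha>: "\<alpha> \<in> box V d" "x = monofun V \<alpha>" by blast
  have "(\<lambda>s :: 'p \<Rightarrow> 'a. truncate_to W s p) \<in> polyfun W 1" for p
    using polyfun_var[OF assms(2), of p] polyfun_const[of 0]
    by (cases "p \<in> W") (simp_all add: truncate_to_def)
  then have pw: "(\<lambda>s :: 'p \<Rightarrow> 'a. truncate_to W s p ^ \<alpha> p) \<in> polyfun W (\<alpha> p)" for p
    using polyfun_power by fastforce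
  have "(\<lambda>s :: 'p \<Rightarrow> 'a. \<Prod>p\<in>V. truncate_to W s p ^ \<alpha> p) \<in> polyfun W (\<Sum>p\<in>V. \<alpha> p)"
    using assms(1) pw by (rule polyfun_prod)
  moreover have "(\<Sum>p\<in>V. \<alpha> p) \<le> card V * d"
    using sum_bounded_above[of V \<alpha> d] \<alpha>(1) by (auto simp: box_def)
  ultimately have "(\<lambda>s. x (truncate_to W s)) \<in> polyfun W (card V * d)"
    using polyfun_mono by (auto simp: \<alpha>(2) monofun_def)
  from polyfun_add[OF polyfun_scale[OF this] step.IH] show ?case by simp
qed

lemma vanish_on_closure:
  assumes f: "f \<in> hom_polys I d" and A: "A \<subseteq> proj_space I"
    and "\<And>x. x \<in> \<Union>A \<Longrightarrow> mpoly_eval f x = 0"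
  shows "\<forall>x\<in>\<Union>(subtopology (zariski I) X closure_of A). mpoly_eval f x = 0"
proof -
  let ?T = "subtopology (zariski I) X"
  have "closedin ?T (proj_zeros I {f} \<inter> X)"
    using closedin_proj_zeros[OF f] by (auto simp: closedin_subtopology)
  moreover have "topspace ?T \<inter> A \<subseteq> proj_zeros I {f} \<inter> X"
    using A assms(3) by (auto simp: proj_zeros_def)
  ultimately have "?T closure_of A \<subseteq> proj_zeros I {f} \<inter> X"
    unfolding closure_of_restrict[of ?T A] by (rule closure_of_minimal[rotated])
  then show ?thesis by (auto simp: proj_zeros_def)
qed

definition proj_image :: "('p \<Rightarrow> 'i \<Rightarrow> 'a::field) \<Rightarrow> 'p set \<Rightarrow> ('i \<Rightarrow> 'a) set set" where
  "proj_image \<phi> S = {proj_point (\<phi> s) | s. s \<in> S \<and> \<phi> s \<noteq> 0}"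

lemma proj_image_subset: "(\<And>s. \<phi> s \<in> coord_space I) \<Longrightarrow> proj_image \<phi> S \<subseteq> proj_space I"
  by (auto simp: proj_image_def proj_space_def)

lemma proj_point_self: "x \<in> proj_point x"
  by (simp add: proj_point_def fvec.span_base)

text \<open>If two closed sets cover the closure and neither contains it, there are parameters
  \<open>s\<close> and \<open>s'\<close> at which a form vanishing on the first, respectively
  second, set is nonzero. On the line joining them the product of the two forms is identically zero,
  although neither factor is.\<close>

lemma irreducible_proj_image_closure:
  fixes \<phi> :: "('p \<Rightarrow> 'a::field_char_0) \<Rightarrow> 'i \<Rightarrow> 'a"
  assumes poly: "\<And>s s' i. polyfun1 (\<lambda>t. \<phi> (\<lambda>p. s p + t * (s' p - s p)) i)"
    and coord: "\<And>s. \<phi> s \<in> coord_space I"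
    and sub: "proj_image \<phi> (coord_space W) \<subseteq> X" and s0: "s0 \<in> coord_space W" "\<phi> s0 \<noteq> 0"
  shows "irreducible_in (subtopology (zariski I) X)
     (subtopology (zariski I) X closure_of proj_image \<phi> (coord_space W))"
    (is "irreducible_in ?T (?T closure_of ?A)")
proof -
  have sub': "?A \<subseteq> proj_space I" by (rule proj_image_subset[OF coord])
  then have sub'': "?A \<subseteq> ?T closure_of ?A"
    using sub by (intro closure_of_subset) (auto simp: topspace_zariski)
  have "?A \<noteq> {}" using s0 by (auto simp: proj_image_def)
  have one: "\<exists>f d s. f \<in> hom_polys I d \<and> (\<forall>L\<in>B. \<forall>x\<in>L. mpoly_eval f x = 0) \<and>
      s \<in> coord_space W \<and> \<phi> s \<noteq> 0 \<and> mpoly_eval f (\<phi> s) \<noteq> 0"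
    if B: "closedin ?T B" and nsub: "\<not> ?T closure_of ?A \<subseteq> B" for B
  proof -
    have "\<not> ?A \<subseteq> B" using closure_of_minimal[OF _ B] nsub by blast
    then obtain s where s: "s \<in> coord_space W" "\<phi> s \<noteq> 0" "proj_point (\<phi> s) \<notin> B"
      by (auto simp: proj_image_def)
    then have "proj_point (\<phi> s) \<in> ?A" by (auto simp: proj_image_def)
    with sub sub' s(3) obtain f d y where f: "f \<in> hom_polys I d" "\<forall>x\<in>\<Union>B. mpoly_eval f x = 0"
      "y \<in> proj_point (\<phi> s)" "mpoly_eval f y \<noteq> 0"
      using closed_separating_form[OF B] by (meson subsetD)
    then have "mpoly_eval f (\<phi> s) \<noteq> 0" using vanishes_on_proj_point_iff[OF f(1), of "\<phi> s"] by blast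
    with s f show ?thesis by blast
  qed
  have "?T closure_of ?A \<subseteq> B \<or> ?T closure_of ?A \<subseteq> C"
    if B: "closedin ?T B" and C: "closedin ?T C" and BC: "?T closure_of ?A \<subseteq> B \<union> C" for B C
  proof (rule ccontr)
    assume "\<not> ?thesis"
    then obtain f d s g e s' where
      f: "f \<in> hom_polys I d" "\<And>L x. L \<in> B \<Longrightarrow> x \<in> L \<Longrightarrow> mpoly_eval f x = 0"
        "s \<in> coord_space W" "\<phi> s \<noteq> 0" "mpoly_eval f (\<phi> s) \<noteq> 0" and
      g: "g \<in> hom_polys I e" "\<And>L x. L \<in> C \<Longrightarrow> x \<in> L \<Longrightarrow> mpoly_eval g x = 0"
        "s' \<in> coord_space W" "mpoly_eval g (\<phi> s') \<noteq> 0"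
      using one[OF B] one[OF C] by metis
    let ?l = "\<lambda>t p. s p + t * (s' p - s p)"
    have l: "?l t \<in> coord_space W" for t using f(3) g(3) by (simp add: coord_space_def)
    obtain i where i: "\<phi> s i \<noteq> 0" using f(4) by (auto simp: fun_eq_iff)
    let ?F = "\<lambda>t. mpoly_eval f (\<phi> (?l t))" and ?G = "\<lambda>t. mpoly_eval g (\<phi> (?l t))"
    have "?G 1 = 0"
    \<comment> \<open>The factor \<open>\<phi> (?l t) i\<close> takes care of the parameters at
      which \<open>\<phi>\<close> vanishes and which define no projective point; it is nonzero at
      \<open>t = 0\<close>.\<close>
    proof (rule polyfun1_integral_domain[where h = ?G and g = "\<lambda>t. ?F t * \<phi> (?l t) i" and b = 0])
      show "polyfun1 ?G" "polyfun1 (\<lambda>t. ?F t * \<phi> (?l t) i)" by (intro polyfun1_intros poly)+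
      show "?F 0 * \<phi> (?l 0) i \<noteq> 0" using f(5) i by simp
      show "?G t * (?F t * \<phi> (?l t) i) = 0" for t
      proof (cases "\<phi> (?l t) = 0")
        case False
        then have "proj_point (\<phi> (?l t)) \<in> ?A" using l by (auto simp: proj_image_def)
        then have "proj_point (\<phi> (?l t)) \<in> B \<or> proj_point (\<phi> (?l t)) \<in> C" using sub'' BC by blast
        then show ?thesis using f(2) g(2) proj_point_self by fastforce
      qed simp
    qed
    then show False using g(4) by simp
  qed
  moreover have "?T closure_of ?A \<noteq> {}" using sub'' \<open>?A \<noteq> {}\<close> by blast
  moreover have "?T closure_of ?A \<subseteq> topspace ?T" by (rule closure_of_subset_topspace)
  ultimately show ?thesis unfolding irreducible_in_def by blast
qed

definition linear_form :: "'i set \<Rightarrow> ('i \<Rightarrow> 'a::field) \<Rightarrow> ('i \<Rightarrow>\<^sub>0 nat) \<Rightarrow>\<^sub>0 'a" where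
  "linear_form I u = (\<Sum>i\<in>I. Poly_Mapping.single 0 (u i) * coord_poly i)"

lemma hom_polys_linear_form: "linear_form I u \<in> hom_polys I 1"
  unfolding linear_form_def by (intro hom_polys_sum hom_polys_smult hom_polys_coord)

lemma mpoly_eval_linear_form: "mpoly_eval (linear_form I u) x = (\<Sum>i\<in>I. u i * x i)"
  by (simp add: linear_form_def mpoly_eval_sum mpoly_eval_smult mpoly_eval_coord)

lemma sum_fun_apply: "(\<Sum>i\<in>A. F i) j = (\<Sum>i\<in>A. F i j)"
  by (induction A rule: infinite_finite_induct) auto

text \<open>By injectivity a linear left inverse recovers \<open>z\<close> and \<open>w\<close> from
  \<open>z \<psi> + d\<phi> w\<close>; the forms \<open>u\<close> are its coordinates.
  \<open>None\<close> stands for the direction of the base point, \<open>Some p\<close> for the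
  parameter \<open>p\<close>.\<close>

lemma dual_linear_forms:
  fixes \<psi> :: "'i \<Rightarrow> 'a::field" and d\<phi> :: "('p \<Rightarrow> 'a) \<Rightarrow> 'i \<Rightarrow> 'a"
  assumes "finite I"
    and add: "\<And>w w' i. d\<phi> (\<lambda>p. w p + w' p) i = d\<phi> w i + d\<phi> w' i"
    and scale: "\<And>c w i. d\<phi> (\<lambda>p. c * w p) i = c * d\<phi> w i"
    and inj: "\<And>z w. w \<in> coord_space V \<Longrightarrow> (\<And>i. i \<in> I \<Longrightarrow> z * \<psi> i + d\<phi> w i = 0) \<Longrightarrow> z = 0 \<and> w = 0"
  shows "\<exists>u. \<forall>z. \<forall>w\<in>coord_space V. (\<Sum>i\<in>I. u None i * (z * \<psi> i + d\<phi> w i)) = z \<and>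
    (\<forall>p. (\<Sum>i\<in>I. u (Some p) i * (z * \<psi> i + d\<phi> w i)) = w p)"
proof -
  interpret vp: vector_space_pair "\<lambda>(c::'a) (f::'p option \<Rightarrow> 'a). (\<lambda>i. c * f i)"
    "\<lambda>(c::'a) (f::'i \<Rightarrow> 'a). (\<lambda>i. c * f i)" ..
  define E where "E = (\<lambda>(x :: 'p option \<Rightarrow> 'a) i. if i \<in> I then x None * \<psi> i + d\<phi> (\<lambda>p. x (Some p)) i else 0)"
  define S where "S = {x :: 'p option \<Rightarrow> 'a. (\<lambda>p. x (Some p)) \<in> coord_space V}"
  have E: "Vector_Spaces.linear (\<lambda>c f i. c * f i) (\<lambda>c f i. c * f i) E"
    by unfold_locales (simp_all add: E_def fun_eq_iff add scale algebra_simps)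
  have S: "fvec.subspace S"
    by (simp add: fvec.subspace_def S_def coord_space_def)
  have d0: "d\<phi> (\<lambda>p. 0) i = 0" for i using scale[of 0] by simp
  have injE: "inj_on E S"
  proof (rule inj_onI)
    fix x y assume xy: "x \<in> S" "y \<in> S" "E x = E y"
    let ?w = "\<lambda>p. x (Some p) + (-1) * y (Some p)"
    have "(x None - y None) * \<psi> i + d\<phi> ?w i = 0" if "i \<in> I" for i
      using fun_cong[OF xy(3), of i] that unfolding add scale by (simp add: E_def algebra_simps)
    moreover have "?w \<in> coord_space V" using xy(1,2) by (simp add: S_def coord_space_def)
    ultimately have *: "x None - y None = 0 \<and> ?w = 0" by (intro inj)
    then have "x None = y None" "\<And>p. x (Some p) = y (Some p)" by (auto simp: fun_eq_iff)
    then show "x = y" by (intro ext) (metis option.exhaust)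
  qed
  obtain g where g: "Vector_Spaces.linear (\<lambda>c f i. c * f i) (\<lambda>c f i. c * f i) g" "\<And>x. x \<in> S \<Longrightarrow> g (E x) = x"
    using vp.linear_exists_left_inverse_on[OF E S injE] by blast
  interpret g: Vector_Spaces.linear "\<lambda>c f i. c * f i" "\<lambda>c f i. c * f i" g by (fact g(1))
  define e :: "'i \<Rightarrow> 'i \<Rightarrow> 'a" where "e = (\<lambda>i j. if j = i then 1 else 0)"
  have gE: "g (E x) b = (\<Sum>i\<in>I. g (e i) b * E x i)" for x b
  proof -
    have "E x = (\<Sum>i\<in>I. (\<lambda>j. E x i * e i j))"
      using assms(1) by (auto simp: fun_eq_iff sum_fun_apply e_def E_def if_distrib[of "\<lambda>t. _ * t"] cong: if_cong)
    then have "g (E x) b = g (\<Sum>i\<in>I. (\<lambda>j. E x i * e i j)) b" by simp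
    also have "\<dots> = (\<Sum>i\<in>I. E x i * g (e i) b)"
      by (simp add: g.sum g.scale sum_fun_apply)
    finally show ?thesis by (simp add: mult.commute)
  qed
  have *: "(\<Sum>i\<in>I. g (e i) b * E x i) = x b" if "x \<in> S" for x b
    unfolding gE[symmetric] g(2)[OF that] ..
  show ?thesis
  proof (intro exI[of _ "\<lambda>b i. g (e i) b"] allI ballI)
    fix z and w :: "'p \<Rightarrow> 'a" assume w: "w \<in> coord_space V"
    let ?x = "\<lambda>b. case b of None \<Rightarrow> z | Some p \<Rightarrow> w p"
    have x: "?x \<in> S" using w by (simp add: S_def)
    have "(\<Sum>i\<in>I. g (e i) b * E ?x i) = (\<Sum>i\<in>I. g (e i) b * (z * \<psi> i + d\<phi> w i))" for b
      by (rule sum.cong) (simp_all add: E_def)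
    with *[OF x] show "(\<Sum>i\<in>I. g (e i) None * (z * \<psi> i + d\<phi> w i)) = z \<and>
        (\<forall>p. (\<Sum>i\<in>I. g (e i) (Some p) * (z * \<psi> i + d\<phi> w i)) = w p)"
      by (simp only: option.case) simp
  qed
qed

text \<open>Along the ray \<open>t * w\<close> the form \<open>u None\<close> has value
  \<open>1 + O(t)\<close> and \<open>u (Some p)\<close> has value \<open>w p * t + O(t^2)\<close>.
  The product with exponents \<open>\<alpha>\<close> thus starts with
  \<open>t ^ N \<alpha> * monofun V \<alpha> w\<close>, whatever the power of \<open>u None\<close>,
  and the terms of least \<open>N \<alpha>\<close> in a relation give a polynomial in
  \<open>w\<close> that vanishes identically.\<close>

lemma dual_monomials_independent:
  fixes \<phi> :: "('p \<Rightarrow> 'a::field_char_0) \<Rightarrow> 'i \<Rightarrow> 'a"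
  assumes "finite V"
    and jet: "\<And>w i. w \<in> coord_space V \<Longrightarrow> i \<in> I \<Longrightarrow>
      \<exists>q. (\<forall>t. \<phi> (\<lambda>p. t * w p) i = poly q t) \<and> coeff q 0 = \<psi> i \<and> coeff q 1 = d\<phi> w i"
    and u: "\<And>z w. w \<in> coord_space V \<Longrightarrow> (\<Sum>i\<in>I. u None i * (z * \<psi> i + d\<phi> w i)) = z"
      "\<And>z w p. w \<in> coord_space V \<Longrightarrow> (\<Sum>i\<in>I. u (Some p) i * (z * \<psi> i + d\<phi> w i)) = w p"
    and "\<And>i. d\<phi> 0 i = 0"
    and c: "\<And>s. s \<in> coord_space V \<Longrightarrow> (\<Sum>\<alpha>\<in>box V k. c \<alpha> *
        ((\<Sum>i\<in>I. u None i * \<phi> s i) ^ e \<alpha> * (\<Prod>p\<in>V. (\<Sum>i\<in>I. u (Some p) i * \<phi> s i) ^ \<alpha> p))) = 0"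
  shows "\<forall>\<alpha>\<in>box V k. c \<alpha> = 0"
proof (rule ccontr)
  define N where "N = (\<lambda>\<alpha> :: 'p \<Rightarrow> nat. \<Sum>p\<in>V. \<alpha> p)"
  assume "\<not> (\<forall>\<alpha>\<in>box V k. c \<alpha> = 0)"
  then have ex: "\<exists>m. \<exists>\<alpha>\<in>box V k. c \<alpha> \<noteq> 0 \<and> N \<alpha> = m" by blast
  define m where "m = (LEAST m. \<exists>\<alpha>\<in>box V k. c \<alpha> \<noteq> 0 \<and> N \<alpha> = m)"
  obtain \<beta> where \<beta>: "\<beta> \<in> box V k" "c \<beta> \<noteq> 0" "N \<beta> = m"
    using LeastI_ex[OF ex] unfolding m_def by blast
  have min: "m \<le> N \<alpha>" if "\<alpha> \<in> box V k" "c \<alpha> \<noteq> 0" for \<alpha>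
    unfolding m_def by (rule Least_le) (use that in blast)
  \<comment> \<open>The factor \<open>0 ^ (N \<alpha> - m)\<close> selects
    \<open>N \<alpha> = m\<close>. Truncated subtraction makes it 1 for
    \<open>N \<alpha> < m\<close> as well, but there \<open>c \<alpha> = 0\<close> by
    minimality.\<close>
  have "(\<Sum>\<alpha>\<in>box V k. (c \<alpha> * 0 ^ (N \<alpha> - m)) * monofun V \<alpha> w) = 0" for w
  proof -
    let ?w = "truncate_to V w"
    have w: "?w \<in> coord_space V" by (rule truncate_to_coord_space)
    obtain q where q: "\<And>i t. i \<in> I \<Longrightarrow> \<phi> (\<lambda>p. t * ?w p) i = poly (q i) t"
      "\<And>i. i \<in> I \<Longrightarrow> coeff (q i) 0 = \<psi> i" "\<And>i. i \<in> I \<Longrightarrow> coeff (q i) 1 = d\<phi> ?w i"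
      using jet[OF w] by metis
    define P where "P = (\<lambda>b. \<Sum>i\<in>I. smult (u b i) (q i))"
    have P: "(\<Sum>i\<in>I. u b i * \<phi> (\<lambda>p. t * ?w p) i) = poly (P b) t" for b t
      by (simp add: P_def poly_sum q(1))
    have P0: "coeff (P b) 0 = (\<Sum>i\<in>I. u b i * \<psi> i)" for b
      by (simp add: P_def coeff_sum q(2))
    have P1: "coeff (P b) 1 = (\<Sum>i\<in>I. u b i * d\<phi> ?w i)" for b
      using q(3) by (simp add: P_def coeff_sum)
    have zero: "0 \<in> coord_space V" by (simp add: coord_space_def)
    have None0: "coeff (P None) 0 = 1"
      using u(1)[OF zero, of 1] assms(5) by (simp add: P0)
    have Some0: "coeff (P (Some p)) 0 = 0" for p
      using u(2)[OF zero, of p 1] assms(5) by (simp add: P0)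
    have Some1: "coeff (P (Some p)) 1 = ?w p" for p
      using u(2)[OF w, of p 0] by (simp only: P1) simp
    have "\<exists>R. P (Some p) = pCons 0 R \<and> coeff R 0 = ?w p" for p
      using Some0[of p] Some1[of p] by (cases "P (Some p)") auto
    then obtain R where R: "\<And>p. P (Some p) = pCons 0 (R p)" "\<And>p. coeff (R p) 0 = ?w p" by metis
    \<comment> \<open>The relation along the ray divided by \<open>t ^ m\<close>; its value at
      \<open>t = 0\<close> is the part of lowest degree.\<close>
    define K where "K = (\<lambda>t. \<Sum>\<alpha>\<in>box V k. c \<alpha> * (poly (P None) t ^ e \<alpha> *
        (t ^ (N \<alpha> - m) * (\<Prod>p\<in>V. poly (R p) t ^ \<alpha> p))))"
    have "K 0 = 0"
    proof (rule polyfun1_integral_domain[where h = K and a = 0 and g = "\<lambda>t. t ^ m" and b = 1])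
      have "polyfun1 (\<lambda>t. poly r t)" for r :: "'a poly" unfolding polyfun1_def by blast
      then show "polyfun1 K" unfolding K_def by (intro polyfun1_intros)
      show "polyfun1 (\<lambda>t::'a. t ^ m)" by (intro polyfun1_intros)
      show "K t * t ^ m = 0" for t
      proof -
        have "(\<lambda>p. t * ?w p) \<in> coord_space V" using w by (simp add: coord_space_def)
        from c[OF this]
        have "0 = (\<Sum>\<alpha>\<in>box V k. c \<alpha> * (poly (P None) t ^ e \<alpha> * (\<Prod>p\<in>V. (t * poly (R p) t) ^ \<alpha> p)))"
          unfolding P by (simp add: R(1))
        also have "\<dots> = (\<Sum>\<alpha>\<in>box V k. c \<alpha> * (poly (P None) t ^ e \<alpha> *
            (t ^ (N \<alpha> - m) * (\<Prod>p\<in>V. poly (R p) t ^ \<alpha> p))) * t ^ m)"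
        proof (rule sum.cong)
          fix \<alpha> assume \<alpha>: "\<alpha> \<in> box V k"
          have "(\<Prod>p\<in>V. (t * poly (R p) t) ^ \<alpha> p) = t ^ N \<alpha> * (\<Prod>p\<in>V. poly (R p) t ^ \<alpha> p)"
            by (simp add: power_mult_distrib prod.distrib power_sum N_def)
          moreover have "t ^ N \<alpha> = t ^ (N \<alpha> - m) * t ^ m" if "c \<alpha> \<noteq> 0"
            using min[OF \<alpha> that] by (simp flip: power_add)
          ultimately show "c \<alpha> * (poly (P None) t ^ e \<alpha> * (\<Prod>p\<in>V. (t * poly (R p) t) ^ \<alpha> p)) =
              c \<alpha> * (poly (P None) t ^ e \<alpha> *
                (t ^ (N \<alpha> - m) * (\<Prod>p\<in>V. poly (R p) t ^ \<alpha> p))) * t ^ m"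
            by (cases "c \<alpha> = 0") (simp_all add: mult_ac)
        qed simp
        finally show ?thesis by (simp add: K_def sum_distrib_right)
      qed
    qed simp
    moreover have "K 0 = (\<Sum>\<alpha>\<in>box V k. (c \<alpha> * 0 ^ (N \<alpha> - m)) * monofun V \<alpha> w)"
      unfolding K_def
    proof (rule sum.cong)
      fix \<alpha>
      have "(\<Prod>p\<in>V. poly (R p) 0 ^ \<alpha> p) = monofun V \<alpha> w"
        unfolding monofun_def by (rule prod.cong) (simp_all add: poly_0_coeff_0 R(2) truncate_to_def)
      then show "c \<alpha> * (poly (P None) 0 ^ e \<alpha> * (0 ^ (N \<alpha> - m) * (\<Prod>p\<in>V. poly (R p) 0 ^ \<alpha> p))) =
          c \<alpha> * 0 ^ (N \<alpha> - m) * monofun V \<alpha> w"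
        using None0 by (simp add: poly_0_coeff_0)
    qed simp
    ultimately show ?thesis by simp
  qed
  from monofun_coeffs_zero[OF assms(1) this] \<beta> show False by auto
qed

text \<open>If the closures for \<open>i\<close> and \<open>Suc i\<close> parameters agreed, the
  \<open>(k + 1) ^ Suc i\<close> monomials in the dual forms, homogenised by \<open>u None\<close>,
  would be independent on a set parametrised by \<open>i\<close> variables, where the number of
  independent forms grows only like \<open>k ^ i\<close>.\<close>

theorem proj_dim_ge_param:
  fixes \<phi> :: "('p \<Rightarrow> 'a::field_char_0) \<Rightarrow> 'i \<Rightarrow> 'a"
  assumes "finite I" "finite V"
    and poly: "\<And>i. (\<lambda>s. \<phi> s i) \<in> polyfun V D"
    and coord: "\<And>s. \<phi> s \<in> coord_space I"
    and X: "\<And>s. \<phi> s \<noteq> 0 \<Longrightarrow> proj_point (\<phi> s) \<in> X"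
    and jet: "\<And>w i. w \<in> coord_space V \<Longrightarrow> i \<in> I \<Longrightarrow>
      \<exists>q. (\<forall>t. \<phi> (\<lambda>p. t * w p) i = poly q t) \<and> coeff q 0 = \<psi> i \<and> coeff q 1 = d\<phi> w i"
    and add: "\<And>w w' i. d\<phi> (\<lambda>p. w p + w' p) i = d\<phi> w i + d\<phi> w' i"
    and scale: "\<And>c w i. d\<phi> (\<lambda>p. c * w p) i = c * d\<phi> w i"
    and inj: "\<And>z w. w \<in> coord_space V \<Longrightarrow> (\<And>i. i \<in> I \<Longrightarrow> z * \<psi> i + d\<phi> w i = 0) \<Longrightarrow> z = 0 \<and> w = 0"
  shows "enat (card V) \<le> proj_dim I X"
proof -
  let ?T = "subtopology (zariski I) X"
  obtain u where u0: "\<forall>z. \<forall>w\<in>coord_space V. (\<Sum>i\<in>I. u None i * (z * \<psi> i + d\<phi> w i)) = z \<and>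
      (\<forall>p. (\<Sum>i\<in>I. u (Some p) i * (z * \<psi> i + d\<phi> w i)) = w p)"
    using dual_linear_forms[where d\<phi> = d\<phi> and \<psi> = \<psi> and V = V, OF assms(1) add scale inj] by (rule exE)
  have u: "(\<Sum>i\<in>I. u None i * (z * \<psi> i + d\<phi> w i)) = z"
      "(\<Sum>i\<in>I. u (Some p) i * (z * \<psi> i + d\<phi> w i)) = w p" if "w \<in> coord_space V" for z w p
    using u0[rule_format, OF that] by simp_all
  have d0: "d\<phi> 0 i = 0" for i using scale[of 0 0] by (simp add: zero_fun_def)
  obtain e where e: "bij_betw e {..<card V} V"
    using ex_bij_betw_nat_finite[OF assms(2)] by (auto simp: atLeast0LessThan)
  define W where "W = (\<lambda>i. e ` {..<i})"
  have W: "finite (W i)" "card (W i) = i" "W i \<subseteq> V" if "i \<le> card V" for i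
    using that e unfolding W_def bij_betw_def
    by (auto intro!: card_image[THEN trans] intro: inj_on_subset)
  have sub_mono: "coord_space (W i) \<subseteq> (coord_space V :: ('p \<Rightarrow> 'a) set)" if "i \<le> card V" for i
    using W(3)[OF that] by (auto simp: coord_space_def)
  define A where "A = (\<lambda>i. proj_image \<phi> (coord_space (W i)))"
  define Z where "Z = (\<lambda>i. ?T closure_of A i)"
  have zero_mem: "(0 :: 'p \<Rightarrow> 'a) \<in> coord_space S" for S :: "'p set" by (simp add: coord_space_def)
  have "\<phi> 0 \<noteq> 0"
  proof
    assume "\<phi> 0 = 0"
    have "\<psi> i = 0" if i: "i \<in> I" for i
    proof -
      obtain q where "\<And>t. \<phi> (\<lambda>p. t * 0) i = poly q t" "coeff q 0 = \<psi> i"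
        using jet[OF zero_mem i] by auto
      from this(1)[of 0] this(2) \<open>\<phi> 0 = 0\<close> show ?thesis by (simp add: poly_0_coeff_0 zero_fun_def)
    qed
    then show False using inj[of 0 1] zero_mem d0 by simp
  qed
  have polyl: "polyfun1 (\<lambda>t. \<phi> (\<lambda>p. s p + t * (s' p - s p)) i)" for s s' i
    by (rule polyfun1_polyfun[OF poly]) (intro polyfun1_intros)
  have AX: "A i \<subseteq> X" for i using X by (auto simp: A_def proj_image_def)
  have AP: "A i \<subseteq> proj_space I" for i unfolding A_def by (rule proj_image_subset[OF coord])
  have AZ: "A i \<subseteq> Z i" for i
    unfolding Z_def using AX AP by (intro closure_of_subset) (simp add: topspace_zariski)
  have irr: "irreducible_in ?T (Z i)" for i
    unfolding Z_def A_def
    by (rule irreducible_proj_image_closure[where \<phi> = \<phi> and ?s0.0 = 0])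
      (fact polyl coord zero_mem \<open>\<phi> 0 \<noteq> 0\<close> AX[unfolded A_def])+
  have strict: "Z i \<subset> Z (Suc i)" if i: "i < card V" for i
  proof
    have "coord_space (W i) \<subseteq> (coord_space (W (Suc i)) :: ('p \<Rightarrow> 'a) set)"
    proof -
      have "W i \<subseteq> W (Suc i)" by (auto simp: W_def)
      then show ?thesis by (auto simp: coord_space_def)
    qed
    then show "Z i \<subseteq> Z (Suc i)" unfolding Z_def A_def
      by (intro closure_of_mono) (auto simp: proj_image_def)
    show "Z i \<noteq> Z (Suc i)"
    proof
      assume eq: "Z i = Z (Suc i)"
      define E where "E = card V * D"
      \<comment> \<open>Exponents at most \<open>k\<close> give total degree at most
        \<open>Suc i * k\<close>; the power of \<open>u None\<close> fills it up to exactly this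
        degree.\<close>
      define F where "F = (\<lambda>k \<alpha>. linear_form I (u None) ^ (Suc i * k - (\<Sum>p\<in>W (Suc i). \<alpha> p)) *
          (\<Prod>p\<in>W (Suc i). linear_form I (u (Some p)) ^ \<alpha> p))"
      have bound: "(k + 1) ^ Suc i \<le> (E * Suc i + 1) ^ i * (k + 1) ^ i" for k
      \<comment> \<open>For \<open>k = 0\<close> the inequality is trivial; for \<open>k > 0\<close>
        the forms have positive degree and vanish wherever \<open>\<phi> s = 0\<close>.\<close>
      proof (cases "k = 0")
        case False
        let ?B = "box (W (Suc i)) k" and ?t = "Suc i * k"
        have FB: "F k \<alpha> \<in> hom_polys I ?t" if \<alpha>: "\<alpha> \<in> ?B" for \<alpha>
        proof -
          have le: "(\<Sum>p\<in>W (Suc i). \<alpha> p) \<le> ?t"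
            using sum_bounded_above[of "W (Suc i)" \<alpha> k] \<alpha> W(2)[of "Suc i"] i by (auto simp: box_def)
          have pw: "linear_form I v ^ n \<in> hom_polys I n" for v :: "'i \<Rightarrow> 'a" and n
            using hom_polys_power[OF hom_polys_linear_form, of I v n] by simp
          have "F k \<alpha> \<in> hom_polys I ((?t - (\<Sum>p\<in>W (Suc i). \<alpha> p)) + (\<Sum>p\<in>W (Suc i). \<alpha> p))"
            unfolding F_def using W(1)[of "Suc i"] i
            by (intro hom_polys_mult hom_polys_prod pw) auto
          with le show ?thesis by simp
        qed
        have "indep_on (\<Union>(Z i)) ?B (\<lambda>\<alpha>. mpoly_eval (F k \<alpha>))"
          unfolding indep_on_def
        proof (intro allI impI)
          fix c assume c: "\<forall>x\<in>\<Union>(Z i). (\<Sum>\<alpha>\<in>?B. c \<alpha> * mpoly_eval (F k \<alpha>) x) = 0"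
          have c': "(\<Sum>\<alpha>\<in>?B. c \<alpha> * mpoly_eval (F k \<alpha>) (\<phi> s)) = 0" if s: "s \<in> coord_space (W (Suc i))" for s
          proof (cases "\<phi> s = 0")
            case True
            have "mpoly_eval (F k \<alpha>) (\<phi> s) = 0" if "\<alpha> \<in> ?B" for \<alpha>
              using mpoly_eval_scale[OF FB[OF that], of 0 "\<phi> s"] True False
              by (simp add: zero_fun_def power_0_left)
            then show ?thesis by simp
          next
            case False
            then have "proj_point (\<phi> s) \<in> Z i" using s AZ[of "Suc i"] eq by (auto simp: A_def proj_image_def)
            then show ?thesis using c proj_point_self by blast
          qed
          show "\<forall>\<alpha>\<in>?B. c \<alpha> = 0"
          proof (rule dual_monomials_independent[where \<phi> = \<phi> and I = I and \<psi> = \<psi> and d\<phi> = d\<phi> and u = u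
                and e = "\<lambda>\<alpha>. ?t - (\<Sum>p\<in>W (Suc i). \<alpha> p)"])
            show "finite (W (Suc i))" using W(1) i by simp
            fix w :: "'p \<Rightarrow> 'a" assume "w \<in> coord_space (W (Suc i))"
            then have w: "w \<in> coord_space V" using sub_mono[of "Suc i"] i by auto
            show "\<exists>q. (\<forall>t. \<phi> (\<lambda>p. t * w p) j = poly q t) \<and> coeff q 0 = \<psi> j \<and> coeff q 1 = d\<phi> w j"
              if "j \<in> I" for j by (rule jet[OF w that])
            show "(\<Sum>j\<in>I. u None j * (z * \<psi> j + d\<phi> w j)) = z" for z by (rule u(1)[OF w])
            show "(\<Sum>j\<in>I. u (Some p) j * (z * \<psi> j + d\<phi> w j)) = w p" for z p by (rule u(2)[OF w])
          next
            fix s :: "'p \<Rightarrow> 'a" assume "s \<in> coord_space (W (Suc i))"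
            from c'[OF this] show "(\<Sum>\<alpha>\<in>?B. c \<alpha> * ((\<Sum>j\<in>I. u None j * \<phi> s j) ^ (?t - (\<Sum>p\<in>W (Suc i). \<alpha> p)) *
                (\<Prod>p\<in>W (Suc i). (\<Sum>j\<in>I. u (Some p) j * \<phi> s j) ^ \<alpha> p))) = 0"
              by (simp add: F_def mpoly_eval_mult mpoly_eval_power mpoly_eval_prod mpoly_eval_linear_form)
          qed (rule d0)
        qed
        moreover have "form_dense I (\<lambda>s. \<phi> (truncate_to (W i) s)) (\<Union>(Z i))"
          unfolding form_dense_def
        proof (intro allI ballI impI)
          fix d f x assume f: "f \<in> hom_polys I d" "\<forall>s. mpoly_eval f (\<phi> (truncate_to (W i) s)) = 0" "x \<in> \<Union>(Z i)"
          have "mpoly_eval f y = 0" if y: "y \<in> \<Union>(A i)" for y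
          proof -
            obtain s where s: "s \<in> coord_space (W i)" "y \<in> proj_point (\<phi> s)"
              using y by (auto simp: A_def proj_image_def)
            then have "mpoly_eval f (\<phi> s) = 0" using f(2) truncate_to_id by metis
            with s(2) show ?thesis using vanishes_on_proj_point_iff[OF f(1)] by blast
          qed
          with vanish_on_closure[OF f(1) AP, of i X] f(3) show "mpoly_eval f x = 0"
            unfolding Z_def by blast
        qed
        moreover have "(\<lambda>s. \<phi> (truncate_to (W i) s) j) \<in> polyfun (W i) E" for j
          unfolding E_def by (rule polyfun_truncate[OF assms(2) _ poly]) (use W(1) i in simp)
        ultimately have "card ?B \<le> (E * ?t + 1) ^ card (W i)"
          using indep_on_param_card[of ?B "W i" I "\<lambda>s. \<phi> (truncate_to (W i) s)" E "\<Union>(Z i)" "F k" ?t]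
            W(1)[of i] finite_box[OF W(1)[of "Suc i"]] i FB by simp
        then have "(k + 1) ^ Suc i \<le> (E * ?t + 1) ^ i"
          using card_box[of "W (Suc i)" k] W[of "Suc i"] W[of i] i by simp
        also have "\<dots> \<le> ((E * Suc i + 1) * (k + 1)) ^ i"
          by (rule power_mono) (simp_all add: algebra_simps)
        finally show ?thesis by (simp only: power_mult_distrib)
      qed simp
      have "Suc i \<le> i" by (rule power_growth_le[OF bound])
      then show False by simp
    qed
  qed
  have "\<exists>Z. (\<forall>i\<le>card V. closedin ?T (Z i) \<and> irreducible_in ?T (Z i)) \<and> (\<forall>i<card V. Z i \<subset> Z (Suc i))"
    using irr strict by (intro exI[of _ Z]) (simp add: Z_def)
  then show ?thesis unfolding proj_dim_def krull_dim_def by (intro Sup_upper) blast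
qed

section \<open>Decomposable multivectors\<close>

lemma ksubset_nth_less:
  assumes "S \<in> ksubsets k m" "j < k"
  shows "sorted_list_of_set S ! j < m"
proof -
  have S: "finite S" "card S = k" "S \<subseteq> {..<m}"
    using assms(1) finite_subset[of S "{..<m}"] by (auto simp: ksubsets_def)
  then have "sorted_list_of_set S ! j \<in> set (sorted_list_of_set S)"
    using assms(2) by (intro nth_mem) simp
  with S show ?thesis by auto
qed

lemma wedge_cong:
  assumes "\<And>i j. i < k \<Longrightarrow> j < m \<Longrightarrow> v i j = w i j"
  shows "wedge k m v = wedge k m w"
proof
  fix S
  show "wedge k m v S = wedge k m w S"
  proof (cases "S \<in> ksubsets k m")
    case True
    have "mat k k (\<lambda>(i, j). v i (sorted_list_of_set S ! j)) = mat k k (\<lambda>(i, j). w i (sorted_list_of_set S ! j))"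
      by (rule eq_matI) (use ksubset_nth_less[OF True] assms in auto)
    then show ?thesis by (simp add: wedge_def)
  qed (simp add: wedge_def)
qed

lemma wedge_coord_space: "wedge k m v \<in> coord_space (ksubsets k m)"
  by (simp add: coord_space_def wedge_def)

lemma wedge_zero_row:
  assumes "i < k" "v i = 0"
  shows "wedge k m v = 0"
proof
  fix S
  have "det (mat k k (\<lambda>(i, j). v i (sorted_list_of_set S ! j))) = 0"
    unfolding det_def'[OF mat_carrier]
  proof (intro sum.neutral ballI)
    fix p assume "p \<in> {p. p permutes {0..<k}}"
    then have "p i < k" using assms(1) permutes_in_image[of p "{0..<k}" i] by auto
    then have "(\<Prod>i = 0..<k. mat k k (\<lambda>(i, j). v i (sorted_list_of_set S ! j)) $$ (i, p i)) = 0"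
      by (intro prod_zero bexI[of _ i]) (use assms in auto)
    then show "signof p * (\<Prod>i = 0..<k. mat k k (\<lambda>(i, j). v i (sorted_list_of_set S ! j)) $$ (i, p i)) = 0"
      by simp
  qed
  then show "wedge k m v S = 0 S" by (simp add: wedge_def)
qed

lemma polyfun_wedge:
  fixes v :: "('p \<Rightarrow> 'a::field) \<Rightarrow> nat \<Rightarrow> nat \<Rightarrow> 'a"
  assumes "\<And>a j. (\<lambda>s. v s a j) \<in> polyfun V d"
  shows "(\<lambda>s. wedge k m (v s) S) \<in> polyfun V (k * d)"
proof (cases "S \<in> ksubsets k m")
  case True
  let ?l = "sorted_list_of_set S"
  have "det (mat k k (\<lambda>(i, j). v s i (?l ! j))) =
      (\<Sum>p | p permutes {0..<k}. signof p * (\<Prod>i = 0..<k. v s i (?l ! p i)))" for s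
    by (subst det_def'[of _ k])
      (auto intro!: sum.cong prod.cong dest: permutes_in_image[of _ "{0..<k}"])
  moreover have "(\<lambda>s. \<Sum>p | p permutes {0..<k}. signof p * (\<Prod>i = 0..<k. v s i (?l ! p i))) \<in> polyfun V (k * d)"
  proof (intro polyfun_sum polyfun_scale)
    fix p
    have "(\<lambda>s. \<Prod>i = 0..<k. v s i (?l ! p i)) \<in> polyfun V (\<Sum>i = 0..<k. d)"
      by (intro polyfun_prod assms) simp
    then show "(\<lambda>s. \<Prod>i = 0..<k. v s i (?l ! p i)) \<in> polyfun V (k * d)" by simp
  qed
  ultimately show ?thesis using True by (simp add: wedge_def)
qed (simp add: wedge_def polyfun_zero)

text \<open>If the rows spanned a space of dimension less than \<open>k\<close>, they would be
  combinations of a \<open>k\<close>-tuple with a zero row, and the wedge would vanish.\<close>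

lemma wedge_nonzero_pluecker:
  fixes v :: "nat \<Rightarrow> nat \<Rightarrow> 'a::field"
  assumes "wedge k m v \<noteq> 0"
  shows "proj_point (wedge k m v) \<in> pluecker k m ` grassmannian k m"
proof -
  \<comment> \<open>\<open>wedge\<close> ignores entries from \<open>m\<close> on, but the span has
    to lie in \<open>coord_space {..<m}\<close>, so they are cut off.\<close>
  define v' where "v' = (\<lambda>i j. if j < m then v i j else 0)"
  have v': "wedge k m v = wedge k m v'" by (rule wedge_cong) (simp add: v'_def)
  let ?W = "fvec.span (v' ` {..<k})"
  have sub: "?W \<subseteq> coord_space {..<m}"
  proof (rule fvec.span_minimal)
    show "v' ` {..<k} \<subseteq> coord_space {..<m}" by (auto simp: v'_def coord_space_def)
    show "fvec.subspace (coord_space {..<m} :: (nat \<Rightarrow> 'a) set)"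
      by (simp add: fvec.subspace_def coord_space_def)
  qed
  have "fvec.dim ?W \<le> k"
    using fvec.dim_le_card[of ?W "v' ` {..<k}"] card_image_le[of "{..<k}" v'] by auto
  moreover have "\<not> fvec.dim ?W < k"
  proof
    assume less: "fvec.dim ?W < k"
    obtain B where B: "B \<subseteq> ?W" "fvec.independent B" "?W \<subseteq> fvec.span B" "card B = fvec.dim ?W"
      using fvec.basis_exists by blast
    have fin: "finite B"
      using fvec.independent_span_bound[OF _ B(2) B(1)] by simp
    obtain e where e: "bij_betw e {..<card B} B"
      using ex_bij_betw_nat_finite[OF fin] by (auto simp: atLeast0LessThan)
    define w where "w = (\<lambda>i. if i < card B then e i else 0)"
    have "B \<subseteq> w ` {..<k}"
    proof
      fix b assume "b \<in> B"
      then obtain i where "i < card B" "b = e i" using e by (auto simp: bij_betw_def)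
      then show "b \<in> w ` {..<k}" using less B(4) by (intro image_eqI[of _ _ i]) (auto simp: w_def)
    qed
    then have "?W \<subseteq> fvec.span (w ` {..<k})" using B(3) fvec.span_mono by blast
    then have "\<exists>c. wedge k m v' = (\<lambda>S. c * wedge k m w S)"
      by (intro wedge_change_of_basis) (auto intro: fvec.span_base)
    moreover have "wedge k m w = 0"
      by (rule wedge_zero_row[of "card B"]) (use less B(4) in \<open>simp_all add: w_def\<close>)
    ultimately show False using assms v' by (auto simp: fun_eq_iff)
  qed
  ultimately have "?W \<in> grassmannian k m" using sub by (simp add: grassmannian_def)
  then show ?thesis using pluecker_span[of k m v'] v' by (metis imageI)
qed

lemma pluecker_imageE:
  assumes "L \<in> pluecker k m ` grassmannian k m" "k > 0"
  obtains v where "L = proj_point (wedge k m v)"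
proof -
  from assms obtain W where W: "L = pluecker k m W" "fvec.subspace W" "fvec.dim W = k"
    by (auto simp: grassmannian_def)
  obtain B where B: "B \<subseteq> W" "W \<subseteq> fvec.span B" "card B = k"
    using fvec.basis_exists[of W] W(3) by metis
  then have "finite B" using assms(2) by (metis card.infinite less_numeral_extra(3))
  then obtain e where e: "bij_betw e {..<k} B"
    using ex_bij_betw_nat_finite[of B] B(3) by (auto simp: atLeast0LessThan)
  have "W = fvec.span B" using B W(2) by (simp add: fvec.span_minimal subset_antisym)
  then have "W = fvec.span (e ` {..<k})" using e by (simp add: bij_betw_def)
  then show thesis using that W(1) pluecker_span by blast
qed

lemma secant_union_subset:
  fixes L :: "(nat set \<Rightarrow> 'a::field) set" and s :: nat
  assumes "L \<in> (\<Union>p\<in>{p. \<forall>j<s. p j \<in> pluecker k m ` grassmannian k m}. proj_span I (p ` {..<s}))" "k > 0"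
  obtains x c v where "L = proj_point x" "x = (\<lambda>S. \<Sum>j<s. c j * wedge k m (v j) S)"
proof -
  from assms(1) obtain p where p: "\<And>j. j < s \<Longrightarrow> p j \<in> pluecker k m ` grassmannian k m"
    "L \<in> proj_span I (p ` {..<s})" by auto
  have "\<exists>v. j < s \<longrightarrow> p j = proj_point (wedge k m v)" for j
    using pluecker_imageE[OF p(1) assms(2)] by metis
  then obtain v where v: "\<And>j. j < s \<Longrightarrow> p j = proj_point (wedge k m (v j))" by metis
  obtain x where x: "L = proj_point x" "x \<in> fvec.span (\<Union>(p ` {..<s}))"
    using p(2) proj_point_self by (auto simp: proj_span_def proj_space_def)
  from x(2) have "\<exists>c. x = (\<lambda>S. \<Sum>j<s. c j * wedge k m (v j) S)"
  proof (induction rule: fvec.span_induct_alt)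
    case base
    show ?case by (rule exI[of _ "\<lambda>_. 0"]) (simp add: fun_eq_iff)
  next
    case (step a x y)
    then obtain j d c where j: "j < s" "x = (\<lambda>S. d * wedge k m (v j) S)"
      and c: "y = (\<lambda>S. \<Sum>j<s. c j * wedge k m (v j) S)"
      using v by (auto simp: proj_point_eq)
    have "(\<Sum>i<s. ((if i = j then a * d else 0) + c i) * wedge k m (v i) S) = a * x S + y S" for S
    proof -
      have "(\<Sum>i<s. (if i = j then a * d else 0) * wedge k m (v i) S) =
          (\<Sum>i<s. if i = j then a * d * wedge k m (v j) S else 0)"
        by (rule sum.cong) auto
      also have "\<dots> = a * x S" using j(1) by (subst sum.delta) (simp_all add: j(2))
      finally show ?thesis by (simp only: c distrib_right sum.distrib)
    qed
    then show ?case
      by (intro exI[of _ "\<lambda>i. (if i = j then a * d else 0) + c i"]) (simp add: fun_eq_iff)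
  qed
  then show thesis using that x(1) by blast
qed

lemma secant_union_mem:
  fixes v :: "nat \<Rightarrow> nat \<Rightarrow> nat \<Rightarrow> 'a::field" and s :: nat
  assumes x: "x = (\<lambda>S. \<Sum>j<s. c j * wedge k m (v j) S)" "x \<noteq> 0"
  shows "proj_point x \<in> (\<Union>p\<in>{p. \<forall>j<s. p j \<in> pluecker k m ` grassmannian k m}.
    proj_span (ksubsets k m) (p ` {..<s}))"
proof -
  have "\<exists>r<s. wedge k m (v r) \<noteq> 0"
  proof (rule ccontr)
    assume "\<not> ?thesis"
    then have "x = 0" by (simp add: x(1) fun_eq_iff)
    then show False using x(2) by contradiction
  qed
  then obtain r where r: "wedge k m (v r) \<noteq> 0" by blast
  \<comment> \<open>A frame with zero wedge gives no point of the Grassmannian. It contributes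
    nothing to \<open>x\<close> and is replaced by a repetition of \<open>v r\<close>, as the points
    spanning a secant space may coincide.\<close>
  define v' where "v' = (\<lambda>j. if wedge k m (v j) = 0 then v r else v j)"
  let ?p = "\<lambda>j. proj_point (wedge k m (v' j))"
  have p: "?p j \<in> pluecker k m ` grassmannian k m" for j
    by (rule wedge_nonzero_pluecker) (simp add: v'_def r)
  have summand: "(\<lambda>S. c j * wedge k m (v j) S) \<in> fvec.span (\<Union>(?p ` {..<s}))" if "j < s" for j
  proof (cases "wedge k m (v j) = 0")
    case True
    then show ?thesis using fvec.span_zero by (simp add: zero_fun_def)
  next
    case False
    then have "(\<lambda>S. c j * wedge k m (v j) S) \<in> ?p j" by (auto simp: proj_point_eq v'_def)
    then show ?thesis using that by (intro fvec.span_base) auto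
  qed
  have "x = (\<Sum>j<s. (\<lambda>S. c j * wedge k m (v j) S))" by (simp add: x(1) fun_eq_iff sum_fun_apply)
  also have "\<dots> \<in> fvec.span (\<Union>(?p ` {..<s}))" by (rule fvec.span_sum) (use summand in auto)
  finally have "proj_point x \<subseteq> fvec.span (\<Union>(?p ` {..<s}))"
    unfolding proj_point_def by (intro fvec.span_minimal) auto
  moreover have "x \<in> coord_space (ksubsets k m)"
    using wedge_coord_space by (auto simp: x(1) coord_space_def wedge_def)
  ultimately have "proj_point x \<in> proj_span (ksubsets k m) (?p ` {..<s})"
    using x(2) by (auto simp: proj_span_def proj_space_def)
  then show ?thesis using p by blast
qed

lemma matrix_inverse:
  fixes A :: "nat \<Rightarrow> nat \<Rightarrow> 'a::field"
  assumes "det (mat n n (\<lambda>(i, j). A i j)) \<noteq> 0"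
  obtains B where "\<And>i j. i < n \<Longrightarrow> j < n \<Longrightarrow> (\<Sum>l<n. A i l * B l j) = (if i = j then 1 else 0)"
    "\<And>i j. i < n \<Longrightarrow> j < n \<Longrightarrow> (\<Sum>l<n. B i l * A l j) = (if i = j then 1 else 0)"
proof -
  let ?A = "mat n n (\<lambda>(i, j). A i j)"
  have "?A \<in> Units (ring_mat TYPE('a) n ())"
    by (rule det_non_zero_imp_unit) (use assms in auto)
  then obtain B where B: "B \<in> carrier_mat n n" "?A * B = 1\<^sub>m n" "B * ?A = 1\<^sub>m n"
    by (auto simp: Units_def ring_mat_def)
  show thesis
  proof (rule that[of "\<lambda>i j. B $$ (i, j)"])
    fix i j assume ij: "i < n" "j < n"
    have "(?A * B) $$ (i, j) = (\<Sum>l<n. A i l * B $$ (l, j))"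
      using B(1) ij by (simp add: scalar_prod_def atLeast0LessThan)
    then show "(\<Sum>l<n. A i l * B $$ (l, j)) = (if i = j then 1 else 0)" using ij B(2) by simp
    have "(B * ?A) $$ (i, j) = (\<Sum>l<n. B $$ (i, l) * A l j)"
      using B(1) ij by (simp add: scalar_prod_def atLeast0LessThan)
    then show "(\<Sum>l<n. B $$ (i, l) * A l j) = (if i = j then 1 else 0)" using ij B(3) by simp
  qed
qed

lemma wedge_row_combination:
  assumes "\<And>a j. a < k \<Longrightarrow> j < m \<Longrightarrow> w a j = (\<Sum>b<k. A a b * v b j)"
  shows "\<exists>c. wedge k m w = (\<lambda>S. c * wedge k m v S)"
proof -
  have "wedge k m w = wedge k m (\<lambda>a j. \<Sum>b<k. A a b * v b j)" by (rule wedge_cong) (rule assms)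
  moreover have "\<exists>c. wedge k m (\<lambda>a j. \<Sum>b<k. A a b * v b j) = (\<lambda>S. c * wedge k m v S)"
  proof (rule wedge_change_of_basis)
    fix a
    have "(\<lambda>j. \<Sum>b<k. A a b * v b j) = (\<Sum>b<k. (\<lambda>j. A a b * v b j))"
      by (simp add: fun_eq_iff sum_fun_apply)
    also have "\<dots> \<in> fvec.span (v ` {..<k})"
      by (intro fvec.span_sum fvec.span_scale fvec.span_base) auto
    finally show "(\<lambda>j. \<Sum>b<k. A a b * v b j) \<in> fvec.span (v ` {..<k})" .
  qed
  ultimately show ?thesis by simp
qed

lemma finite_ksubsets: "finite (ksubsets k m)"
  by (rule finite_subset[of _ "Pow {..<m}"]) (auto simp: ksubsets_def)

lemma polyfun1_if:
  "(b \<Longrightarrow> polyfun1 f) \<Longrightarrow> (\<not> b \<Longrightarrow> polyfun1 g) \<Longrightarrow> polyfun1 (\<lambda>t. if b then f t else g t)"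
  by (cases b) simp_all

lemma polyfun_if:
  "(b \<Longrightarrow> f \<in> polyfun V d) \<Longrightarrow> (\<not> b \<Longrightarrow> g \<in> polyfun V d) \<Longrightarrow> (\<lambda>s. if b then f s else g s) \<in> polyfun V d"
  by (cases b) simp_all

section \<open>Determinants of size three and ternary cubics\<close>

lemma det_mat_Suc:
  fixes A :: "nat \<Rightarrow> nat \<Rightarrow> 'a::comm_ring_1"
  shows "det (mat (Suc n) (Suc n) (\<lambda>(i, j). A i j)) =
    (\<Sum>j<Suc n. (-1) ^ j * A 0 j * det (mat n n (\<lambda>(i, l). A (Suc i) (if l < j then l else Suc l))))"
proof -
  let ?A = "mat (Suc n) (Suc n) (\<lambda>(i, j). A i j)"
  have "mat_delete ?A 0 j = mat n n (\<lambda>(i, l). A (Suc i) (if l < j then l else Suc l))"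
    if "j < Suc n" for j
    by (rule eq_matI) (auto simp: mat_delete_def)
  then show ?thesis
    by (subst laplace_expansion_row[of _ "Suc n" 0])
      (auto simp: cofactor_def intro!: sum.cong)
qed

text \<open>General commutative rings are allowed because entries may also be linear polynomials, as
  in the characteristic polynomial of a pencil and in first-order expansions.\<close>

definition det3 :: "(nat \<Rightarrow> nat \<Rightarrow> 'a::comm_ring_1) \<Rightarrow> 'a" where
  "det3 A = A 0 0 * (A 1 1 * A 2 2 - A 1 2 * A 2 1) - A 0 1 * (A 1 0 * A 2 2 - A 1 2 * A 2 0)
     + A 0 2 * (A 1 0 * A 2 1 - A 1 1 * A 2 0)"

lemma det_mat_3: "det (mat 3 3 (\<lambda>(i, j). A i j)) = det3 A"
  by (simp add: numeral_3_eq_3 det_mat_Suc det3_def numeral_2_eq_2 algebra_simps)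

lemma polyfun1_det3 [polyfun1_intros]:
  "(\<And>i j. polyfun1 (\<lambda>t. A t i j)) \<Longrightarrow> polyfun1 (\<lambda>t. det3 (A t))"
  unfolding det3_def by (intro polyfun1_intros)

lemma sum_lessThan_3: "(\<Sum>i<3. f i) = f 0 + f 1 + f (2::nat)"
  by (simp add: numeral_3_eq_3 numeral_2_eq_2)

text \<open>The vector \<open>x i a\<close> is the image of the \<open>a\<close>-th basis vector of
  A tensored with the \<open>i\<close>-th one of \<open>K^3\<close>; index \<open>i\<close> is thus
  the variable of the cubic and \<open>a\<close> the row of the wedge.\<close>

definition mixed_wedge :: "(nat \<Rightarrow> nat \<Rightarrow> nat \<Rightarrow> 'a::field) \<Rightarrow> nat \<Rightarrow> nat \<Rightarrow> nat \<Rightarrow> nat set \<Rightarrow> 'a" where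
  "mixed_wedge x i j k = wedge 3 9 (\<lambda>a p. if a = 0 then x i 0 p else if a = 1 then x j 1 p else x k 2 p)"

lemma det3_multilinear:
  fixes l :: "nat \<Rightarrow> 'a::comm_ring_1"
  shows
  "det3 (\<lambda>a p. \<Sum>i<3. l i * X i a p) =
    (\<Sum>i<3. \<Sum>j<3. \<Sum>k<3. l i * l j * l k *
      det3 (\<lambda>a p. if a = 0 then X i 0 p else if a = 1 then X j 1 p else X k 2 p))"
  by (simp add: det3_def sum_lessThan_3 algebra_simps)

lemma wedge_multilinear:
  "wedge 3 9 (\<lambda>a k. \<Sum>i<3. l i * x i a k) S =
    (\<Sum>i<3. \<Sum>j<3. \<Sum>k<3. l i * l j * l k * mixed_wedge x i j k S)"
proof (cases "S \<in> ksubsets 3 9")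
  case True
  then show ?thesis
    using det3_multilinear[of l "\<lambda>i a j. x i a (sorted_list_of_set S ! j)"]
    by (simp only: wedge_def mixed_wedge_def det_mat_3 if_True)
qed (simp add: wedge_def mixed_wedge_def)

text \<open>Such a sum depends only on \<open>x\<close> and on the ternary cubic form \<open>\<Sum>\<^sub>r c\<^sub>r l\<^sub>r\<^sup>3\<close>.\<close>

definition cubes :: "(nat \<Rightarrow> nat \<Rightarrow> nat \<Rightarrow> 'a::field) \<Rightarrow> (nat \<Rightarrow> 'a) \<Rightarrow> (nat \<Rightarrow> nat \<Rightarrow> 'a) \<Rightarrow> nat set \<Rightarrow> 'a" where
  "cubes x c l = (\<lambda>S. \<Sum>r<4. c r * wedge 3 9 (\<lambda>a k. \<Sum>i<3. l r i * x i a k) S)"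

text \<open>The monomial \<open>X\<^sub>i X\<^sub>j X\<^sub>k\<close> of a ternary cubic is encoded as \<open>wt i + wt j + wt k\<close>, that is, as
  (exponent of \<open>X\<^sub>1\<close>) \<open>+ 4 \<cdot>\<close> (exponent of \<open>X\<^sub>2\<close>).\<close>

definition wt :: "nat \<Rightarrow> nat" where
  "wt i = (if i = 0 then 0 else if i = 1 then 1 else 4)"

text \<open>The tensor of \<open>det_A\<close> with a cubic F. The values of \<open>C\<close> are
  the entries of the symmetric tensor of F: each monomial occurs once per ordering of its
  factors.\<close>

definition cubic :: "(nat \<Rightarrow> 'a::field) \<Rightarrow> (nat \<Rightarrow> nat \<Rightarrow> nat \<Rightarrow> 'a) \<Rightarrow> nat set \<Rightarrow> 'a" where
  "cubic C x = (\<lambda>S. \<Sum>i<3. \<Sum>j<3. \<Sum>k<3. C (wt i + wt j + wt k) * mixed_wedge x i j k S)"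

lemma cubes_eq_cubic: "\<exists>C. cubes x c l = cubic C x"
proof -
  define M where "M = (\<lambda>r n. l r 0 ^ (3 - n mod 4 - n div 4) * l r 1 ^ (n mod 4) * l r 2 ^ (n div 4))"
  have lt3: "i = 0 \<or> i = 1 \<or> i = 2" if "i < 3" for i :: nat using that by auto
  have M: "l r i * l r j * l r k = M r (wt i + wt j + wt k)" if "i < 3" "j < 3" "k < 3" for r i j k
    using lt3[OF that(1)] lt3[OF that(2)] lt3[OF that(3)]
    by (elim disjE) (simp_all add: M_def wt_def power2_eq_square power3_eq_cube)
  have "cubes x c l = cubic (\<lambda>n. \<Sum>r<4. c r * M r n) x"
  proof
    fix S
    have "cubes x c l S = (\<Sum>r<4. \<Sum>i<3. \<Sum>j<3. \<Sum>k<3. c r * M r (wt i + wt j + wt k) * mixed_wedge x i j k S)"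
      unfolding cubes_def wedge_multilinear sum_distrib_left
      by (intro sum.cong refl) (simp add: M[symmetric] mult.assoc)
    also have "\<dots> = (\<Sum>i<3. \<Sum>j<3. \<Sum>k<3. \<Sum>r<4. c r * M r (wt i + wt j + wt k) * mixed_wedge x i j k S)"
      by (simp only: sum.swap[of _ "{..<3}" "{..<4}"])
    finally show "cubes x c l S = cubic (\<lambda>n. \<Sum>r<4. c r * M r n) x S"
      by (simp add: cubic_def sum_distrib_right)
  qed
  then show ?thesis by (intro exI[of _ "\<lambda>n. \<Sum>r<4. c r * M r n"])
qed

section \<open>The normal form with 73 parameters\<close>

definition slice_vars :: "(nat \<times> nat \<times> nat) set" where
  "slice_vars = {(0, 0, 3)} \<union> {0} \<times> {..<3} \<times> {4..<9} \<union> {1, 2} \<times> {..<3} \<times> {1..<9}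
     \<union> {3} \<times> {1, 2, 3, 4, 5, 6, 8, 9, 12} \<times> {0}"

lemma finite_slice_vars: "finite slice_vars"
  by (simp add: slice_vars_def)

text \<open>Let x_k be the matrix with entries \<open>x i a k\<close>. The normal form fixes x_0 as
  the identity (9 entries), row 0 of x_1 and of x_2 as unit vectors (6), and two zeros in row 0 of
  x_3 (2), which leaves 64 entries. The triples \<open>(3, n, 0)\<close> are the 9 coefficients of
  the cubic other than that of \<open>X_0^3\<close>.\<close>

lemma card_slice_vars: "card slice_vars = 73"
  unfolding slice_vars_def
  by (subst card_Un_disjoint; (auto; fail)?)+

definition slice :: "(nat \<times> nat \<times> nat \<Rightarrow> 'a::field) \<Rightarrow> nat \<Rightarrow> nat \<Rightarrow> nat \<Rightarrow> 'a" where
  "slice s i a k = (if k = 0 then (if i = a then 1 else 0)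
     else if i = 0 \<and> k \<le> 2 then (if a = k then 1 else 0)
     else if (i, a, k) \<in> slice_vars then s (i, a, k) else 0)"

definition slice_coeff :: "(nat \<times> nat \<times> nat \<Rightarrow> 'a::field) \<Rightarrow> nat \<Rightarrow> 'a" where
  "slice_coeff s n = (if n = 0 then 1 else if (3, n, 0) \<in> slice_vars then s (3, n, 0) else 0)"

definition secant_param :: "(nat \<times> nat \<times> nat \<Rightarrow> 'a::field) \<Rightarrow> nat set \<Rightarrow> 'a" where
  "secant_param s = cubic (slice_coeff s) (slice s)"

lemma polyfun_secant_param: "(\<lambda>s. secant_param s S) \<in> polyfun slice_vars 4"
proof -
  have var: "(\<lambda>s :: _ \<Rightarrow> 'a::field. s p) \<in> polyfun slice_vars 1" if "p \<in> slice_vars" for p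
    using polyfun_var[OF finite_slice_vars that] .
  have "(\<lambda>s :: _ \<Rightarrow> 'a. slice s i a k) \<in> polyfun slice_vars 1" for i a k
    unfolding slice_def by (intro polyfun_if polyfun_const var)
  then have "(\<lambda>s :: _ \<Rightarrow> 'a. mixed_wedge (slice s) i j k S) \<in> polyfun slice_vars (3 * 1)" for i j k
    unfolding mixed_wedge_def by (intro polyfun_wedge) (intro polyfun_if, assumption+)
  moreover have "(\<lambda>s :: _ \<Rightarrow> 'a. slice_coeff s n) \<in> polyfun slice_vars 1" for n
    unfolding slice_coeff_def by (intro polyfun_if polyfun_const var)
  ultimately have "(\<lambda>s :: _ \<Rightarrow> 'a. slice_coeff s n * mixed_wedge (slice s) i j k S) \<in> polyfun slice_vars (1 + 3 * 1)" for n i j k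
    using polyfun_mult by blast
  then show ?thesis unfolding secant_param_def cubic_def by (intro polyfun_sum) simp
qed

section \<open>Reduction of sums of four wedges to the normal form\<close>

definition in_slice :: "(nat \<Rightarrow> nat \<Rightarrow> nat \<Rightarrow> 'a::field) \<Rightarrow> bool" where
  "in_slice x \<longleftrightarrow> (\<forall>a<3. (\<forall>i<3. x i a 0 = (if i = a then 1 else 0)) \<and>
     x 0 a 1 = (if a = 1 then 1 else 0) \<and> x 0 a 2 = (if a = 2 then 1 else 0) \<and> (a \<noteq> 0 \<longrightarrow> x 0 a 3 = 0))"

lemma mixed_wedge_cong:
  assumes "\<And>i a k. i < 3 \<Longrightarrow> a < 3 \<Longrightarrow> k < 9 \<Longrightarrow> x i a k = y i a k" "i < 3" "j < 3" "k < 3"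
  shows "mixed_wedge x i j k = mixed_wedge y i j k"
  unfolding mixed_wedge_def by (rule wedge_cong) (use assms in auto)

lemma polyfun1_cubic [polyfun1_intros]:
  assumes "\<And>n. polyfun1 (\<lambda>t. C t n)"
  shows "polyfun1 (\<lambda>t. cubic (C t) x S)"
  unfolding cubic_def by (intro polyfun1_intros assms)

lemma polyfun1_cubes [polyfun1_intros]:
  assumes "\<And>i a k. polyfun1 (\<lambda>t. x t i a k)"
  shows "polyfun1 (\<lambda>t. cubes (x t) c l S)"
  unfolding cubes_def by (intro polyfun1_intros assms)

text \<open>For \<open>C 0 = 1\<close> the tensor is a value of \<open>secant_param\<close>;
  \<open>C 0 \<noteq> 0\<close> follows by homogeneity of \<open>f\<close>, and
  \<open>C 0 = 0\<close> by varying this one coefficient.\<close>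

lemma vanish_on_slice_cubic:
  fixes f :: "(nat set \<Rightarrow>\<^sub>0 nat) \<Rightarrow>\<^sub>0 'a::field_char_0"
  assumes f: "f \<in> hom_polys I t" "\<And>s. mpoly_eval f (secant_param s) = 0" and x: "in_slice x"
  shows "mpoly_eval f (cubic C x) = 0"
proof -
  have one: "mpoly_eval f (cubic C x) = 0" if "C 0 = 1" for C
  proof -
    let ?s = "\<lambda>(i, a, k). if i = 3 then C a else x i a k"
    have "slice ?s i a k = x i a k" if "i < 3" "a < 3" "k < 9" for i a k
    proof -
      consider "k = 0" | "i = 0" "k = 1" | "i = 0" "k = 2" | "i = 0" "k = 3" | "i = 0" "k \<ge> 4"
        | "i \<in> {1, 2}" "k \<ge> 1"
        using \<open>i < 3\<close> by fastforce
      then show ?thesis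
        using x that by cases (auto simp: slice_def slice_vars_def in_slice_def)
    qed
    then have "mixed_wedge (slice ?s) i j k = mixed_wedge x i j k" if "i < 3" "j < 3" "k < 3" for i j k
      using that by (intro mixed_wedge_cong)
    moreover have "slice_coeff ?s (wt i + wt j + wt k) = C (wt i + wt j + wt k)" if "i < 3" "j < 3" "k < 3" for i j k
    proof -
      have "wt i + wt j + wt k \<in> {0, 1, 2, 3, 4, 5, 6, 8, 9, 12}" by (auto simp: wt_def)
      then show ?thesis using \<open>C 0 = 1\<close> by (auto simp: slice_coeff_def slice_vars_def)
    qed
    ultimately have "secant_param ?s = cubic C x"
      unfolding secant_param_def cubic_def fun_eq_iff by simp
    with f(2)[of ?s] show ?thesis by simp
  qed
  have nz: "mpoly_eval f (cubic C x) = 0" if "C 0 \<noteq> 0" for C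
  proof -
    have "cubic C x = (\<lambda>S. C 0 * cubic (\<lambda>n. C n / C 0) x S)"
      using that by (simp add: cubic_def sum_distrib_left)
    then show ?thesis using mpoly_eval_scale[OF f(1)] one[of "\<lambda>n. C n / C 0"] that by simp
  qed
  let ?C = "\<lambda>t n. if n = 0 then C n + t else C n"
  have "mpoly_eval f (cubic (?C 0) x) = 0"
  proof (rule polyfun1_extend_zero[where g = "\<lambda>t. C 0 + t" and b = "1 - C 0" and a = 0
        and h = "\<lambda>t. mpoly_eval f (cubic (?C t) x)"])
    show "polyfun1 (\<lambda>t. mpoly_eval f (cubic (?C t) x))"
      by (intro polyfun1_intros polyfun1_if)
  qed (use nz in \<open>auto intro: polyfun1_intros\<close>)
  moreover have "?C 0 = C" by (simp add: fun_eq_iff)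
  ultimately show ?thesis by simp
qed

lemma sum_assoc:
  fixes f :: "nat \<Rightarrow> 'a::comm_ring_1"
  shows "(\<Sum>b<n. (\<Sum>a<m. f a * A a b) * B b) = (\<Sum>a<m. f a * (\<Sum>b<n. A a b * B b))"
  unfolding sum_distrib_left sum_distrib_right by (subst sum.swap) (simp only: mult.assoc)

lemma sum_contract:
  fixes f :: "nat \<Rightarrow> 'a::comm_ring_1"
  assumes "\<And>a. a < m \<Longrightarrow> (\<Sum>b<n. A a b * B b) = (if a = d then 1 else 0)" "d < m"
  shows "(\<Sum>b<n. (\<Sum>a<m. f a * A a b) * B b) = f d"
proof -
  have "(\<Sum>a<m. f a * (\<Sum>b<n. A a b * B b)) = (\<Sum>a<m. if a = d then f a else 0)"
    by (rule sum.cong) (use assms(1) in auto)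
  then show ?thesis unfolding sum_assoc using assms(2) by simp
qed

text \<open>The coordinates with index \<open>k\<close> of the nine vectors of \<open>x\<close> form a \<open>3 \<times> 3\<close> matrix \<open>x\<^sub>k\<close>, and pairs of
  invertible matrices act by \<open>x\<^sub>k \<mapsto> Q x\<^sub>k R\<close>. With \<open>S\<close> the matrix with rows \<open>u x\<^sub>0\<close>, \<open>u x\<^sub>1\<close>, \<open>u x\<^sub>2\<close>, the choice
  \<open>R = S\<^sup>-\<^sup>1\<close>, \<open>Q = S x\<^sub>0\<^sup>-\<^sup>1\<close> moves \<open>x\<close> into the slice; that \<open>u\<close> is an eigenvector of the pencil
  \<open>x\<^sub>3 - \<lambda> x\<^sub>0\<close> uses up the freedom left in the choice of \<open>u\<close>.\<close>

lemma vanish_on_cubes_generic: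
  fixes f :: "(nat set \<Rightarrow>\<^sub>0 nat) \<Rightarrow>\<^sub>0 'a::field_char_0"
  assumes f: "f \<in> hom_polys I t" "\<And>s. mpoly_eval f (secant_param s) = 0"
    and eig: "\<And>a. a < 3 \<Longrightarrow> (\<Sum>i<3. u i * x i a 3) = ev * (\<Sum>i<3. u i * x i a 0)"
    and det0: "det3 (\<lambda>i a. x i a 0) \<noteq> 0"
    and detS: "det3 (\<lambda>b a. \<Sum>i<3. u i * x i a b) \<noteq> 0"
  shows "mpoly_eval f (cubes x c l) = 0"
proof -
  define S where "S = (\<lambda>b a. \<Sum>i<3. u i * x i a b)"
  obtain N where N: "\<And>i j. i < 3 \<Longrightarrow> j < 3 \<Longrightarrow> (\<Sum>a<3. x i a 0 * N a j) = (if i = j then 1 else 0)"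
      "\<And>i j. i < 3 \<Longrightarrow> j < 3 \<Longrightarrow> (\<Sum>a<3. N i a * x a j 0) = (if i = j then 1 else 0)"
    using matrix_inverse[of 3 "\<lambda>i a. x i a 0"] det0 unfolding det_mat_3 by blast
  obtain R where R: "\<And>i j. i < 3 \<Longrightarrow> j < 3 \<Longrightarrow> (\<Sum>a<3. S i a * R a j) = (if i = j then 1 else 0)"
      "\<And>i j. i < 3 \<Longrightarrow> j < 3 \<Longrightarrow> (\<Sum>a<3. R i a * S a j) = (if i = j then 1 else 0)"
    using matrix_inverse[of 3 S] detS unfolding det_mat_3 S_def by blast
  define Q where "Q = (\<lambda>i j. \<Sum>a<3. S i a * N a j)"
  \<comment> \<open>\<open>P\<close> is x_0 R, the inverse of \<open>Q\<close>: the linear forms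
    \<open>l\<close> have to move by the inverse of the matrix acting on the x_k.\<close>
  define P where "P = (\<lambda>i b. \<Sum>a<3. x i a 0 * R a b)"
  define x' where "x' = (\<lambda>i d k. \<Sum>a<3. (\<Sum>j<3. Q i j * x j a k) * R a d)"
  have Qx: "(\<Sum>j<3. Q i j * x j a 0) = S i a" if "a < 3" for i a
    unfolding Q_def by (rule sum_contract) (use N that in auto)
  \<comment> \<open>Row 0 of \<open>S\<close> is u x_0, and the inverse of x_0 gives back
    \<open>u\<close>. Hence row 0 of x'_k is u x_k R: the \<open>k\<close>-th unit vector for
    \<open>k < 3\<close>, and \<open>ev\<close> times the 0-th one for \<open>k = 3\<close>.\<close>
  have Q0: "Q 0 j = u j" if "j < 3" for j
    unfolding Q_def S_def by (rule sum_contract) (use N that in auto)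
  have x'0: "x' 0 d k = (\<Sum>a<3. S k a * R a d)" for d k
    unfolding x'_def S_def by (intro sum.cong arg_cong2[where f = "(*)"]) (simp_all add: Q0)
  have "in_slice x'"
    unfolding in_slice_def
  proof (intro allI impI conjI)
    fix a i :: nat assume "a < 3"
    show "x' i a 0 = (if i = a then 1 else 0)" if "i < 3"
    proof -
      have "x' i a 0 = (\<Sum>b<3. S i b * R b a)"
        unfolding x'_def by (intro sum.cong arg_cong2[where f = "(*)"]) (simp_all add: Qx)
      then show ?thesis using R(1) that \<open>a < 3\<close> by simp
    qed
    show "x' 0 a 1 = (if a = 1 then 1 else 0)" "x' 0 a 2 = (if a = 2 then 1 else 0)"
      using R(1)[of 1 a] R(1)[of 2 a] \<open>a < 3\<close> by (auto simp: x'0)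
    show "x' 0 a 3 = 0" if "a \<noteq> 0"
    proof -
      have "x' 0 a 3 = (\<Sum>b<3. ev * (S 0 b * R b a))"
        unfolding x'0 by (rule sum.cong) (simp_all add: S_def eig)
      also have "\<dots> = ev * (\<Sum>b<3. S 0 b * R b a)" by (simp only: sum_distrib_left)
      finally show ?thesis using R(1)[of 0 a] \<open>a < 3\<close> that by simp
    qed
  qed
  have PQ: "(\<Sum>b<3. P i b * Q b j) = (if i = j then 1 else 0)" if "i < 3" "j < 3" for i j
  proof -
    have PS: "(\<Sum>b<3. P i b * S b a) = x i a 0" if "a < 3" for a
      unfolding P_def by (rule sum_contract) (use R that in auto)
    have "(\<Sum>b<3. P i b * Q b j) = (\<Sum>a<3. (\<Sum>b<3. P i b * S b a) * N a j)"
      unfolding Q_def sum_assoc ..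
    also have "\<dots> = (\<Sum>a<3. x i a 0 * N a j)" by (rule sum.cong) (simp_all add: PS)
    finally show ?thesis using N(1) that by simp
  qed
  define l' where "l' = (\<lambda>r b. \<Sum>i<3. l r i * P i b)"
  have lQ: "(\<Sum>b<3. l' r b * Q b j) = l r j" if "j < 3" for r j
    unfolding l'_def by (rule sum_contract) (use PQ that in auto)
  \<comment> \<open>In matrix terms l_r x_k = l'_r x'_k S for every \<open>k\<close>, so each of the
    four wedges changes by a scalar, which \<open>c\<close> absorbs.\<close>
  have "\<forall>r. \<exists>e. wedge 3 9 (\<lambda>a k. \<Sum>i<3. l r i * x i a k) =
      (\<lambda>T. e * wedge 3 9 (\<lambda>d k. \<Sum>b<3. l' r b * x' b d k) T)"
  proof (rule allI, rule wedge_row_combination[where A = "\<lambda>a d. S d a"])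
    fix r a k :: nat assume "a < 3"
    let ?y = "\<lambda>a. \<Sum>i<3. l r i * x i a k"
    have y: "?y a = (\<Sum>b<3. l' r b * (\<Sum>j<3. Q b j * x j a k))" for a
      unfolding sum_assoc[symmetric] by (rule sum.cong) (simp_all add: lQ)
    have "(\<Sum>b<3. l' r b * x' b d k) = (\<Sum>a<3. ?y a * R a d)" for d
      unfolding x'_def y sum_assoc ..
    then have "(\<Sum>d<3. S d a * (\<Sum>b<3. l' r b * x' b d k)) = (\<Sum>d<3. (\<Sum>a<3. ?y a * R a d) * S d a)"
      by (simp only: mult.commute)
    also have "\<dots> = ?y a" by (rule sum_contract) (use R(2) \<open>a < 3\<close> in auto)
    finally show "?y a = (\<Sum>d<3. S d a * (\<Sum>b<3. l' r b * x' b d k))" ..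
  qed
  from choice[OF this] obtain e where e: "\<forall>r. wedge 3 9 (\<lambda>a k. \<Sum>i<3. l r i * x i a k) =
      (\<lambda>T. e r * wedge 3 9 (\<lambda>d k. \<Sum>b<3. l' r b * x' b d k) T)" by (rule exE)
  have "cubes x c l = cubes x' (\<lambda>r. c r * e r) l'"
    unfolding cubes_def e[rule_format] by (simp add: mult.assoc)
  moreover obtain C where "cubes x' (\<lambda>r. c r * e r) l' = cubic C x'" using cubes_eq_cubic by blast
  ultimately show ?thesis using vanish_on_slice_cubic[OF f \<open>in_slice x'\<close>] by simp
qed

lemma det3_transpose: "det3 (\<lambda>i j. A j i) = det3 A"
  by (simp add: det3_def algebra_simps)

lemma det3_zero_imp_left_kernel:
  fixes A :: "nat \<Rightarrow> nat \<Rightarrow> 'a::field"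
  assumes "det3 A = 0"
  obtains u i where "i < 3" "u i \<noteq> 0" "\<And>a. a < 3 \<Longrightarrow> (\<Sum>i<3. u i * A i a) = 0"
proof -
  let ?B = "mat 3 3 (\<lambda>(a, i). A i a)"
  have "det ?B = 0" unfolding det_mat_3 det3_transpose[of A] by (rule assms)
  moreover have "?B \<in> carrier_mat 3 3" by simp
  ultimately have "\<exists>v. v \<in> carrier_vec 3 \<and> v \<noteq> 0\<^sub>v 3 \<and> ?B *\<^sub>v v = 0\<^sub>v 3"
    by (simp only: det_0_iff_vec_prod_zero_field)
  then obtain v where v: "v \<in> carrier_vec 3" "v \<noteq> 0\<^sub>v 3" "?B *\<^sub>v v = 0\<^sub>v 3" by blast
  have "\<exists>i<3. v $ i \<noteq> 0"
  proof (rule ccontr)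
    assume "\<not> ?thesis"
    then have "v = 0\<^sub>v 3" using v(1) by (intro eq_vecI) auto
    then show False using v(2) by contradiction
  qed
  then obtain i where "i < 3" "v $ i \<noteq> 0" by blast
  moreover have "(\<Sum>i<3. v $ i * A i a) = 0" if "a < 3" for a
  proof -
    have "(?B *\<^sub>v v) $ a = 0" using v(3) that by simp
    then show ?thesis using v(1) that by (simp add: scalar_prod_def atLeast0LessThan mult.commute)
  qed
  ultimately show thesis using that[of i "\<lambda>i. v $ i"] by simp
qed

text \<open>The determinant of A - t B is a polynomial in \<open>t\<close> whose coefficient at
  \<open>t^3\<close> is \<open>- det3 B\<close>, so it is not constant and has a root.\<close>

lemma generalized_left_eigenvector:
  fixes A B :: "nat \<Rightarrow> nat \<Rightarrow> 'a::alg_closed_field"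
  assumes "det3 B \<noteq> 0"
  shows "\<exists>u i ev. i < 3 \<and> u i \<noteq> 0 \<and> (\<forall>a<3. (\<Sum>i<3. u i * A i a) = ev * (\<Sum>i<3. u i * B i a))"
proof -
  let ?p = "det3 (\<lambda>i j. [:A i j, - B i j:])"
  have "coeff ?p 3 = - det3 B" by (simp add: det3_def numeral_3_eq_3 algebra_simps)
  then have "coeff ?p 3 \<noteq> 0" using assms by simp
  then have "degree ?p > 0" using le_degree by fastforce
  then obtain ev where "poly ?p ev = 0" using alg_closed_imp_poly_has_root by blast
  moreover have "poly ?p ev = det3 (\<lambda>i j. poly [:A i j, - B i j:] ev)"
    by (simp only: det3_def poly_add poly_diff poly_mult)
  ultimately have "det3 (\<lambda>i j. A i j - ev * B i j) = 0" by simp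
  then obtain u i where u: "i < 3" "u i \<noteq> 0" "\<And>a. a < 3 \<Longrightarrow> (\<Sum>i<3. u i * (A i a - ev * B i a)) = 0"
    using det3_zero_imp_left_kernel by blast
  have "(\<Sum>i<3. u i * A i a) = ev * (\<Sum>i<3. u i * B i a)" if "a < 3" for a
    using u(3)[OF that] by (simp add: algebra_simps sum_subtractf sum_distrib_left)
  then show ?thesis using u(1,2) by blast
qed

lemma det3_left_kernel:
  fixes A :: "nat \<Rightarrow> nat \<Rightarrow> 'a::field"
  assumes "i < 3" "u i \<noteq> 0" "\<And>a. a < 3 \<Longrightarrow> (\<Sum>i<3. u i * A i a) = 0"
  shows "det3 A = 0"
proof (rule ccontr)
  assume "det3 A \<noteq> 0"
  then obtain B where B: "\<And>i j. i < 3 \<Longrightarrow> j < 3 \<Longrightarrow> (\<Sum>l<3. A i l * B l j) = (if i = j then 1 else 0)"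
      "\<And>i j. i < 3 \<Longrightarrow> j < 3 \<Longrightarrow> (\<Sum>l<3. B i l * A l j) = (if i = j then 1 else 0)"
    using matrix_inverse[of 3 A] unfolding det_mat_3 by blast
  have "(\<Sum>b<3. (\<Sum>a<3. u a * A a b) * B b i) = u i"
    by (rule sum_contract) (use B assms(1) in auto)
  then show False using assms by simp
qed

lemma complete_to_basis3:
  fixes r :: "nat \<Rightarrow> 'a::field"
  assumes "a < 3" "r a \<noteq> 0"
  obtains r1 r2 where "det3 (\<lambda>b a. if b = 0 then r a else if b = 1 then r1 a else r2 a) \<noteq> 0"
proof -
  define e where "e = (\<lambda>i j :: nat. if i = j then 1 else (0::'a))"
  consider "a = 0" | "a = 1" | "a = 2" using assms(1) by fastforce
  then show thesis
  proof cases
    case 1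
    show thesis by (rule that[of "e 1" "e 2"]) (use 1 assms(2) in \<open>simp add: det3_def e_def\<close>)
  next
    case 2
    show thesis by (rule that[of "e 0" "e 2"]) (use 2 assms(2) in \<open>simp add: det3_def e_def\<close>)
  next
    case 3
    show thesis by (rule that[of "e 0" "e 1"]) (use 3 assms(2) in \<open>simp add: det3_def e_def\<close>)
  qed
qed

text \<open>Two line arguments remove the open conditions: the inner one makes u x_0, u x_1, u x_2
  independent, the outer one makes x_0 invertible.\<close>

lemma vanish_on_cubes:
  fixes f :: "(nat set \<Rightarrow>\<^sub>0 nat) \<Rightarrow>\<^sub>0 'a::{alg_closed_field, field_char_0}"
  assumes f: "f \<in> hom_polys I t" "\<And>s. mpoly_eval f (secant_param s) = 0"
  shows "mpoly_eval f (cubes x c l) = 0"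
proof -
  have regular: "mpoly_eval f (cubes x c l) = 0" if det0: "det3 (\<lambda>i a. x i a 0) \<noteq> 0" for x
  proof -
    obtain u i0 ev where u0: "i0 < 3 \<and> u i0 \<noteq> 0 \<and>
        (\<forall>a<3. (\<Sum>i<3. u i * x i a 3) = ev * (\<Sum>i<3. u i * x i a 0))"
      using generalized_left_eigenvector[where A = "\<lambda>i a. x i a 3", OF det0] by (elim exE)
    then have u: "i0 < 3" "u i0 \<noteq> 0"
      "\<And>a. a < 3 \<Longrightarrow> (\<Sum>i<3. u i * x i a 3) = ev * (\<Sum>i<3. u i * x i a 0)" by simp_all
    define r where "r = (\<lambda>b a. \<Sum>i<3. u i * x i a b)"
    have "\<exists>a<3. r 0 a \<noteq> 0"
      using det3_left_kernel[of i0 u "\<lambda>i a. x i a 0"] u(1,2) det0 unfolding r_def by blast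
    then obtain r1 r2 where r12: "det3 (\<lambda>b a. if b = 0 then r 0 a else if b = 1 then r1 a else r2 a) \<noteq> 0"
      using complete_to_basis3 by blast
    \<comment> \<open>Only row \<open>i0\<close> of x_1 and x_2 moves, where \<open>u\<close> is
      nonzero. So x_0, x_3 and the eigenvector stay fixed, while at \<open>t = 1\<close> the vectors
      u x_1 and u x_2 become \<open>r1\<close> and \<open>r2\<close>.\<close>
    define y where "y = (\<lambda>i a k :: nat. if i = i0 \<and> k = 1 then (r1 a - r 1 a) / u i0
        else if i = i0 \<and> k = 2 then (r2 a - r 2 a) / u i0 else 0)"
    let ?x = "\<lambda>t i a k. x i a k + t * y i a k"
    have rows: "(\<Sum>i<3. u i * ?x t i a k) = r k a + t * (\<Sum>i<3. u i * y i a k)" for t a k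
      by (simp add: r_def algebra_simps sum.distrib sum_distrib_left)
    have uy: "(\<Sum>i<3. u i * y i a k) = (if k = 1 then r1 a - r 1 a else if k = 2 then r2 a - r 2 a else 0)" for a k
    proof -
      have "(\<Sum>i<3. u i * y i a k) = (\<Sum>i<3. if i = i0 then u i0 * y i0 a k else 0)"
        by (rule sum.cong) (auto simp: y_def)
      then show ?thesis using u(1,2) by (simp add: y_def)
    qed
    have "mpoly_eval f (cubes (?x 0) c l) = 0"
    proof (rule polyfun1_extend_zero[where h = "\<lambda>t. mpoly_eval f (cubes (?x t) c l)" and a = 0
          and g = "\<lambda>t. det3 (\<lambda>b a. \<Sum>i<3. u i * ?x t i a b)" and b = 1])
      show "polyfun1 (\<lambda>t. mpoly_eval f (cubes (?x t) c l))"
        "polyfun1 (\<lambda>t. det3 (\<lambda>b a. \<Sum>i<3. u i * ?x t i a b))"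
        by (intro polyfun1_intros)+
      show "det3 (\<lambda>b a. \<Sum>i<3. u i * ?x 1 i a b) \<noteq> 0"
        using r12 unfolding rows uy by (simp add: det3_def)
      show "mpoly_eval f (cubes (?x t) c l) = 0" if "det3 (\<lambda>b a. \<Sum>i<3. u i * ?x t i a b) \<noteq> 0" for t
      proof (rule vanish_on_cubes_generic[OF f _ _ that])
        show "(\<Sum>i<3. u i * ?x t i a 3) = ev * (\<Sum>i<3. u i * ?x t i a 0)" if "a < 3" for a
          using u(3)[OF that] by (simp add: rows uy) (simp add: r_def)
        show "det3 (\<lambda>i a. ?x t i a 0) \<noteq> 0" using det0 by (simp add: y_def)
      qed
    qed
    then show ?thesis by simp
  qed
  define y where "y = (\<lambda>i a k :: nat. if k = 0 then (if i = a then 1 else 0) - x i a k else 0)"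
  let ?x = "\<lambda>t i a k. x i a k + t * y i a k"
  have "mpoly_eval f (cubes (?x 0) c l) = 0"
  proof (rule polyfun1_extend_zero[where h = "\<lambda>t. mpoly_eval f (cubes (?x t) c l)" and a = 0
        and g = "\<lambda>t. det3 (\<lambda>i a. ?x t i a 0)" and b = 1])
    show "polyfun1 (\<lambda>t. mpoly_eval f (cubes (?x t) c l))" "polyfun1 (\<lambda>t. det3 (\<lambda>i a. ?x t i a 0))"
      by (intro polyfun1_intros)+
    show "det3 (\<lambda>i a. ?x 1 i a 0) \<noteq> 0" by (simp add: y_def det3_def)
  qed (rule regular)
  then show ?thesis by simp
qed

text \<open>If all \<open>B j\<close> are invertible, they give new bases of the first three spaces
  in which the fourth frame is the sum of the other three, the shape required by
  \<open>cubes\<close>. Singular \<open>B j\<close> are joined to the identity; along this line only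
  the fourth frame moves.\<close>

lemma vanish_on_dependent_sums:
  fixes f :: "(nat set \<Rightarrow>\<^sub>0 nat) \<Rightarrow>\<^sub>0 'a::{alg_closed_field, field_char_0}"
    and v :: "nat \<Rightarrow> nat \<Rightarrow> nat \<Rightarrow> 'a"
  assumes f: "f \<in> hom_polys I t" "\<And>s. mpoly_eval f (secant_param s) = 0"
    and v3: "\<And>a k. a < 3 \<Longrightarrow> k < 9 \<Longrightarrow> v 3 a k = (\<Sum>j<3. \<Sum>b<3. B j a b * v j b k)"
  shows "mpoly_eval f (\<lambda>S. \<Sum>r<4. c r * wedge 3 9 (v r) S) = 0"
proof -
  define w where "w = (\<lambda>B r. if r = 3 then (\<lambda>a k. \<Sum>j<3. \<Sum>b<3. B j a b * v j b k) else v r)"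
  have regular: "mpoly_eval f (\<lambda>S. \<Sum>r<4. c r * wedge 3 9 (w B r) S) = 0"
    if B: "\<And>j. j < 3 \<Longrightarrow> det3 (B j) \<noteq> 0" for B :: "nat \<Rightarrow> nat \<Rightarrow> nat \<Rightarrow> 'a"
  proof -
    define x where "x = (\<lambda>(j::nat) a k. \<Sum>b<3. B j a b * v j b k)"
    have "\<forall>r. \<exists>e. r < 3 \<longrightarrow> wedge 3 9 (v r) = (\<lambda>S. e * wedge 3 9 (x r) S)"
    proof
      fix r
      show "\<exists>e. r < 3 \<longrightarrow> wedge 3 9 (v r) = (\<lambda>S. e * wedge 3 9 (x r) S)"
      proof (cases "r < 3")
        case True
        obtain A where A': "\<And>i j. i < 3 \<Longrightarrow> j < 3 \<Longrightarrow> (\<Sum>l<3. B r i l * A l j) = (if i = j then 1 else 0)"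
          and A: "\<And>i j. i < 3 \<Longrightarrow> j < 3 \<Longrightarrow> (\<Sum>l<3. A i l * B r l j) = (if i = j then 1 else 0)"
          using matrix_inverse[of 3 "B r"] B[OF True] unfolding det_mat_3 by blast
        have "\<exists>e. wedge 3 9 (v r) = (\<lambda>S. e * wedge 3 9 (x r) S)"
        proof (rule wedge_row_combination[where A = A])
          fix a k :: nat assume a: "a < 3"
          have "(\<Sum>b<3. A a b * x r b k) = (\<Sum>b<3. (\<Sum>l<3. A a l * B r l b) * v r b k)"
            unfolding x_def sum_assoc ..
          also have "\<dots> = (\<Sum>b<3. if b = a then v r a k else 0)"
            by (rule sum.cong) (use A a in auto)
          finally show "v r a k = (\<Sum>b<3. A a b * x r b k)" using a by simp
        qed
        then show ?thesis by blast
      qed simp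
    qed
    from choice[OF this] obtain e where e: "\<forall>r. r < 3 \<longrightarrow> wedge 3 9 (v r) = (\<lambda>S. e r * wedge 3 9 (x r) S)"
      by (rule exE)
    \<comment> \<open>\<open>l r\<close> is a single variable for \<open>r < 3\<close>, and
      \<open>l 3\<close> is the sum of all three.\<close>
    define l where "l = (\<lambda>r i :: nat. if r = 3 \<or> r = i then 1 else (0::'a))"
    have lx: "(\<Sum>i<3. l r i * x i a k) = x r a k" if "r < 3" for r a k
    proof -
      have "(\<Sum>i<3. l r i * x i a k) = (\<Sum>i<3. if i = r then x r a k else 0)"
        by (rule sum.cong) (use that in \<open>auto simp: l_def\<close>)
      then show ?thesis using that by simp
    qed
    have l3: "(\<Sum>i<3. l 3 i * x i a k) = w B 3 a k" for a k
      by (simp add: l_def w_def x_def)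
    have "(\<lambda>S. \<Sum>r<4. c r * wedge 3 9 (w B r) S) = cubes x (\<lambda>r. if r = 3 then c r else c r * e r) l"
      unfolding cubes_def
    proof (intro ext sum.cong refl)
      fix S and r :: nat assume "r \<in> {..<4}"
      then consider "r = 3" | "r < 3" by fastforce
      then show "c r * wedge 3 9 (w B r) S =
          (if r = 3 then c r else c r * e r) * wedge 3 9 (\<lambda>a k. \<Sum>i<3. l r i * x i a k) S"
      proof cases
        case 1
        then show ?thesis by (simp add: l3)
      next
        case 2
        have "(\<lambda>a k. \<Sum>i<3. l r i * x i a k) = x r" by (simp only: lx[OF 2])
        with 2 e[rule_format, OF 2] show ?thesis by (simp add: w_def mult.assoc)
      qed
    qed
    then show ?thesis using vanish_on_cubes[OF f] by simp
  qed
  let ?B = "\<lambda>t j a b. B j a b + t * ((if a = b then 1 else 0) - B j a b)"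
  have "mpoly_eval f (\<lambda>S. \<Sum>r<4. c r * wedge 3 9 (w (?B 0) r) S) = 0"
  proof (rule polyfun1_extend_zero[where h = "\<lambda>t. mpoly_eval f (\<lambda>S. \<Sum>r<4. c r * wedge 3 9 (w (?B t) r) S)"
        and a = 0 and g = "\<lambda>t. det3 (?B t 0) * det3 (?B t 1) * det3 (?B t 2)" and b = 1])
    have "polyfun1 (\<lambda>t. w (?B t) r a k)" for r a k
      unfolding w_def by (cases "r = 3") (auto intro!: polyfun1_intros)
    then show "polyfun1 (\<lambda>t. mpoly_eval f (\<lambda>S. \<Sum>r<4. c r * wedge 3 9 (w (?B t) r) S))"
      by (intro polyfun1_intros)
    show "polyfun1 (\<lambda>t. det3 (?B t 0) * det3 (?B t 1) * det3 (?B t 2))"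
      by (intro polyfun1_intros)
    show "det3 (?B 1 0) * det3 (?B 1 1) * det3 (?B 1 2) \<noteq> 0" by (simp add: det3_def)
    show "mpoly_eval f (\<lambda>S. \<Sum>r<4. c r * wedge 3 9 (w (?B t) r) S) = 0"
      if g: "det3 (?B t 0) * det3 (?B t 1) * det3 (?B t 2) \<noteq> 0" for t
    proof (rule regular)
      fix j :: nat assume "j < 3"
      then consider "j = 0" | "j = 1" | "j = 2" by fastforce
      then show "det3 (?B t j) \<noteq> 0" using g by cases simp_all
    qed
  qed
  then have "mpoly_eval f (\<lambda>S. \<Sum>r<4. c r * wedge 3 9 (w B r) S) = 0" by simp
  moreover have "wedge 3 9 (w B r) = wedge 3 9 (v r)" for r
    by (rule wedge_cong) (simp add: w_def v3)
  ultimately show ?thesis by simp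
qed

lemma sum_lessThan_9: "(\<Sum>p<9. F (p div 3) (p mod 3)) = (\<Sum>j<3. \<Sum>b<3. F j (b::nat))"
  for F :: "nat \<Rightarrow> nat \<Rightarrow> 'a::comm_monoid_add"
proof -
  have "{..<9} = {0, 1, 2, 3, 4, 5, 6, 7, 8 :: nat}" by auto
  moreover have "{..<3} = {0, 1, 2 :: nat}" by auto
  ultimately show ?thesis by (simp add: add.assoc)
qed

text \<open>If the nine vectors of the first three frames form a basis, the fourth frame is a
  combination of them; other frames are joined by a line to ones whose first nine vectors are the
  standard basis.\<close>

lemma vanish_on_sums:
  fixes f :: "(nat set \<Rightarrow>\<^sub>0 nat) \<Rightarrow>\<^sub>0 'a::{alg_closed_field, field_char_0}"
    and v :: "nat \<Rightarrow> nat \<Rightarrow> nat \<Rightarrow> 'a"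
  assumes f: "f \<in> hom_polys I t" "\<And>s. mpoly_eval f (secant_param s) = 0"
  shows "mpoly_eval f (\<lambda>S. \<Sum>r<4. c r * wedge 3 9 (v r) S) = 0"
proof -
  have regular: "mpoly_eval f (\<lambda>S. \<Sum>r<4. c r * wedge 3 9 (v r) S) = 0"
    if det: "det (mat 9 9 (\<lambda>(p, k). v (p div 3) (p mod 3) k)) \<noteq> 0" for v :: "nat \<Rightarrow> nat \<Rightarrow> nat \<Rightarrow> 'a"
  proof -
    have "\<exists>N. \<forall>i<9. \<forall>j<9. (\<Sum>p<9. N i p * v (p div 3) (p mod 3) j) = (if i = j then 1 else 0)"
    proof (rule matrix_inverse[OF det])
      fix N
      assume "\<And>i j. i < 9 \<Longrightarrow> j < 9 \<Longrightarrow>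
        (\<Sum>p<9. N i p * v (p div 3) (p mod 3) j) = (if i = j then 1 else 0)"
      then show ?thesis by (intro exI[of _ N]) simp
    qed
    then obtain N where N: "\<forall>i<9. \<forall>j<9. (\<Sum>p<9. N i p * v (p div 3) (p mod 3) j) = (if i = j then 1 else 0)"
      by (rule exE)
    define B where "B = (\<lambda>j a b. \<Sum>i<9. v 3 a i * N i (3 * j + b))"
    have "v 3 a k = (\<Sum>j<3. \<Sum>b<3. B j a b * v j b k)" if "k < 9" for a k
    proof -
      have "v 3 a k = (\<Sum>p<9. (\<Sum>i<9. v 3 a i * N i p) * v (p div 3) (p mod 3) k)"
        by (rule sum_contract[symmetric]) (use N that in auto)
      also have "\<dots> = (\<Sum>p<9. B (p div 3) a (p mod 3) * v (p div 3) (p mod 3) k)"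
        by (simp add: B_def)
      finally show ?thesis by (simp only: sum_lessThan_9[of "\<lambda>j b. B j a b * v j b k"])
    qed
    then show ?thesis by (intro vanish_on_dependent_sums[OF f])
  qed
  define y where "y = (\<lambda>r a k. (if k = 3 * r + a then 1 else 0) - v r a k)"
  let ?v = "\<lambda>t r a k. v r a k + t * y r a k"
  have "mpoly_eval f (\<lambda>S. \<Sum>r<4. c r * wedge 3 9 (?v 0 r) S) = 0"
  proof (rule polyfun1_extend_zero[where h = "\<lambda>t. mpoly_eval f (\<lambda>S. \<Sum>r<4. c r * wedge 3 9 (?v t r) S)"
        and a = 0 and g = "\<lambda>t. det (mat 9 9 (\<lambda>(p, k). ?v t (p div 3) (p mod 3) k))" and b = 1])
    show "polyfun1 (\<lambda>t. mpoly_eval f (\<lambda>S. \<Sum>r<4. c r * wedge 3 9 (?v t r) S))"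
      "polyfun1 (\<lambda>t. det (mat 9 9 (\<lambda>(p, k). ?v t (p div 3) (p mod 3) k)))"
      by (intro polyfun1_intros)+
    have "mat 9 9 (\<lambda>(p, k). ?v 1 (p div 3) (p mod 3) k) = 1\<^sub>m 9"
      by (rule eq_matI) (auto simp: y_def)
    then show "det (mat 9 9 (\<lambda>(p, k). ?v 1 (p div 3) (p mod 3) k)) \<noteq> 0" by simp
  qed (rule regular)
  then show ?thesis by simp
qed

section \<open>Pluecker coordinates and first-order expansions\<close>

lemma wedge_det3:
  "S \<in> ksubsets 3 m \<Longrightarrow> wedge 3 m v S = det3 (\<lambda>i j. v i (sorted_list_of_set S ! j))"
  by (simp add: wedge_def det_mat_3)

lemma wedge_triple:
  assumes "a < b" "b < c" "c < m"
  shows "wedge 3 m v {a, b, c} = det3 (\<lambda>i j. v i ([a, b, c] ! j))"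
proof -
  have "sorted_list_of_set (set [a, b, c]) = [a, b, c]"
    by (rule sorted_list_of_set.idem_if_sorted_distinct) (use assms in auto)
  moreover have "{a, b, c} \<in> ksubsets 3 m" using assms by (simp add: ksubsets_def)
  ultimately show ?thesis by (simp add: wedge_det3)
qed

text \<open>The derivative of the wedge at \<open>v\<close> in direction \<open>w\<close>, by the
  product rule over the rows.\<close>

definition dwedge :: "(nat \<Rightarrow> nat \<Rightarrow> 'a::field) \<Rightarrow> (nat \<Rightarrow> nat \<Rightarrow> 'a) \<Rightarrow> nat set \<Rightarrow> 'a" where
  "dwedge v w S = (\<Sum>b<3. wedge 3 9 (v(b := w b)) S)"

lemma dwedge_add: "dwedge v (\<lambda>a k. w a k + w' a k) S = dwedge v w S + dwedge v w' S"
proof (cases "S \<in> ksubsets 3 9")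
  case True
  then show ?thesis by (simp add: dwedge_def wedge_det3 sum_lessThan_3 det3_def algebra_simps)
qed (simp add: dwedge_def wedge_def)

lemma dwedge_scale: "dwedge v (\<lambda>a k. c * w a k) S = c * dwedge v w S"
proof (cases "S \<in> ksubsets 3 9")
  case True
  then show ?thesis by (simp add: dwedge_def wedge_det3 sum_lessThan_3 det3_def algebra_simps)
qed (simp add: dwedge_def wedge_def)

lemma wedge_jet:
  "\<exists>q. (\<forall>t. wedge 3 9 (\<lambda>a k. v a k + t * w a k) S = poly q t) \<and>
    coeff q 0 = wedge 3 9 v S \<and> coeff q 1 = dwedge v w S"
proof (cases "S \<in> ksubsets 3 9")
  case True
  let ?l = "sorted_list_of_set S"
  let ?q = "det3 (\<lambda>i j. [:v i (?l ! j), w i (?l ! j):])"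
  have "poly ?q t = det3 (\<lambda>i j. poly [:v i (?l ! j), w i (?l ! j):] t)" for t
    by (simp only: det3_def poly_add poly_diff poly_mult)
  moreover have "coeff ?q 0 = det3 (\<lambda>i j. v i (?l ! j))"
    by (simp add: det3_def algebra_simps)
  moreover have "coeff ?q 1 = dwedge v w S"
    using True by (simp add: dwedge_def wedge_det3 sum_lessThan_3 det3_def algebra_simps)
  ultimately show ?thesis using True by (intro exI[of _ ?q]) (simp add: wedge_det3)
qed (auto simp: wedge_def dwedge_def intro: exI[of _ 0])

section \<open>The dimension of the Grassmannian\<close>

definition chart_vars :: "(nat \<times> nat) set" where
  "chart_vars = {..<3} \<times> {3..<9}"

lemma finite_chart_vars: "finite chart_vars" and card_chart_vars: "card chart_vars = 18"
  by (simp_all add: chart_vars_def)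

text \<open>The big cell of the Grassmannian: row spaces of matrices with the identity in the first
  three columns and 18 free entries.\<close>

definition chart :: "(nat \<times> nat \<Rightarrow> 'a::field) \<Rightarrow> nat \<Rightarrow> nat \<Rightarrow> 'a" where
  "chart s a k = (if a = k then 1 else 0) + truncate_to chart_vars s (a, k)"

lemma polyfun_truncate_var: "finite V \<Longrightarrow> (\<lambda>s. truncate_to V s p) \<in> polyfun V 1"
  unfolding truncate_to_def by (intro polyfun_if polyfun_const polyfun_var)

lemma polyfun_chart: "(\<lambda>s. wedge 3 9 (chart s) S) \<in> polyfun chart_vars (3 * 1)"
  unfolding chart_def
  by (intro polyfun_wedge polyfun_add polyfun_const polyfun_truncate_var finite_chart_vars)

text \<open>If the left 3 by 3 block of a frame is invertible, multiplying by its inverse gives a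
  chart point and changes the wedge by a scalar.\<close>

lemma vanish_on_wedges:
  fixes f :: "(nat set \<Rightarrow>\<^sub>0 nat) \<Rightarrow>\<^sub>0 'a::field_char_0"
  assumes f: "f \<in> hom_polys I t" "\<And>s. mpoly_eval f (wedge 3 9 (chart s)) = 0"
  shows "mpoly_eval f (wedge 3 9 v) = 0"
proof -
  have regular: "mpoly_eval f (wedge 3 9 v) = 0" if det: "det3 v \<noteq> 0" for v
  proof -
    obtain N where N: "\<And>i j. i < 3 \<Longrightarrow> j < 3 \<Longrightarrow> (\<Sum>l<3. v i l * N l j) = (if i = j then 1 else 0)"
        "\<And>i j. i < 3 \<Longrightarrow> j < 3 \<Longrightarrow> (\<Sum>l<3. N i l * v l j) = (if i = j then 1 else 0)"
      using matrix_inverse[of 3 v] det unfolding det_mat_3 by blast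
    define s where "s = (\<lambda>(b, k). \<Sum>l<3. N b l * v l k)"
    have chart: "chart s b k = (\<Sum>l<3. N b l * v l k)" if "b < 3" "k < 9" for b k
      using that N(2)[of b k] by (auto simp: chart_def truncate_to_def chart_vars_def s_def)
    have "\<exists>c. wedge 3 9 v = (\<lambda>S. c * wedge 3 9 (chart s) S)"
    proof (rule wedge_row_combination[where A = v])
      fix a k :: nat assume ak: "a < 3" "k < 9"
      have "(\<Sum>b<3. v a b * chart s b k) = (\<Sum>b<3. v a b * (\<Sum>l<3. N b l * v l k))"
        by (rule sum.cong) (simp_all add: chart ak)
      also have "\<dots> = (\<Sum>l<3. (\<Sum>b<3. v a b * N b l) * v l k)" by (simp only: sum_assoc)
      also have "\<dots> = (\<Sum>l<3. if l = a then v a k else 0)"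
        by (rule sum.cong) (use N(1) ak in auto)
      finally show "v a k = (\<Sum>b<3. v a b * chart s b k)" using ak by simp
    qed
    then show ?thesis using mpoly_eval_scale[OF f(1)] f(2) by auto
  qed
  let ?v = "\<lambda>t a k. v a k + t * ((if a = k then 1 else 0) - v a k)"
  have "mpoly_eval f (wedge 3 9 (?v 0)) = 0"
  proof (rule polyfun1_extend_zero[where h = "\<lambda>t. mpoly_eval f (wedge 3 9 (?v t))" and a = 0
        and g = "\<lambda>t. det3 (?v t)" and b = 1])
    show "polyfun1 (\<lambda>t. mpoly_eval f (wedge 3 9 (?v t)))" "polyfun1 (\<lambda>t. det3 (?v t))"
      by (intro polyfun1_intros)+
    show "det3 (?v 1) \<noteq> 0" by (simp add: det3_def)
  qed (rule regular)
  then show ?thesis by simp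
qed

text \<open>For the lower bound, at the standard frame the coordinate {0, 1, 2} reads off
  \<open>z\<close>, and replacing one of these indices by \<open>k\<close> isolates one
  \<open>w (a, k)\<close> up to sign.\<close>

lemma proj_dim_grassmannian:
  "proj_dim (ksubsets 3 9) (pluecker 3 9 ` grassmannian 3 9 :: (nat set \<Rightarrow> 'a::field_char_0) set set) = 18"
    (is "proj_dim ?I ?X = 18")
proof (rule antisym)
  have "form_dense ?I (\<lambda>s. wedge 3 9 (chart s)) (\<Union>?X)"
    unfolding form_dense_def
  proof (intro allI ballI impI)
    fix t and f :: "(nat set \<Rightarrow>\<^sub>0 nat) \<Rightarrow>\<^sub>0 'a" and x
    assume f: "f \<in> hom_polys ?I t" "\<forall>s. mpoly_eval f (wedge 3 9 (chart s)) = 0" and "x \<in> \<Union>?X"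
    then obtain L where "L \<in> ?X" "x \<in> L" by blast
    then obtain v where "x \<in> proj_point (wedge 3 9 v)"
      using pluecker_imageE[of L 3 9] by auto
    moreover have "mpoly_eval f (wedge 3 9 v) = 0" using vanish_on_wedges[OF f(1)] f(2) by blast
    ultimately show "mpoly_eval f x = 0" using vanishes_on_proj_point_iff[OF f(1)] by blast
  qed
  then have "proj_dim ?I ?X \<le> enat (card chart_vars)"
    by (rule proj_dim_le_param[OF finite_chart_vars polyfun_chart])
  then show "proj_dim ?I ?X \<le> 18" by (simp add: card_chart_vars numeral_eq_enat)
next
  let ?e = "\<lambda>a k. if a = k then 1 else (0::'a)"
  let ?d = "\<lambda>w S. dwedge ?e (\<lambda>a k. truncate_to chart_vars w (a, k)) S"
  have "enat (card chart_vars) \<le> proj_dim ?I ?X"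
  proof (rule proj_dim_ge_param[where \<phi> = "\<lambda>s. wedge 3 9 (chart s)" and \<psi> = "wedge 3 9 ?e" and d\<phi> = ?d])
    show "finite ?I" by (rule finite_ksubsets)
    show "finite chart_vars" by (rule finite_chart_vars)
    show "(\<lambda>s. wedge 3 9 (chart s) S) \<in> polyfun chart_vars (3 * 1)" for S by (rule polyfun_chart)
    show "wedge 3 9 (chart s) \<in> coord_space ?I" for s :: "_ \<Rightarrow> 'a" by (rule wedge_coord_space)
    show "proj_point (wedge 3 9 (chart s)) \<in> ?X" if "wedge 3 9 (chart s) \<noteq> 0" for s :: "_ \<Rightarrow> 'a"
      by (rule wedge_nonzero_pluecker[OF that])
    fix w w' :: "nat \<times> nat \<Rightarrow> 'a" and c S
    have "chart (\<lambda>p. t * w p) = (\<lambda>a k. ?e a k + t * truncate_to chart_vars w (a, k))" for t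
      by (simp add: chart_def truncate_to_def fun_eq_iff)
    then show "\<exists>q. (\<forall>t. wedge 3 9 (chart (\<lambda>p. t * w p)) S = poly q t) \<and>
        coeff q 0 = wedge 3 9 ?e S \<and> coeff q 1 = ?d w S"
      using wedge_jet[of ?e "\<lambda>a k. truncate_to chart_vars w (a, k)" S] by simp
    have "(\<lambda>a k. truncate_to chart_vars (\<lambda>p. w p + w' p) (a, k)) =
        (\<lambda>a k. truncate_to chart_vars w (a, k) + truncate_to chart_vars w' (a, k))"
      by (simp add: truncate_to_def fun_eq_iff)
    then show "?d (\<lambda>p. w p + w' p) S = ?d w S + ?d w' S" by (simp only: dwedge_add)
    have "(\<lambda>a k. truncate_to chart_vars (\<lambda>p. c * w p) (a, k)) =
        (\<lambda>a k. c * truncate_to chart_vars w (a, k))"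
      by (simp add: truncate_to_def fun_eq_iff)
    then show "?d (\<lambda>p. c * w p) S = c * ?d w S" by (simp only: dwedge_scale)
  next
    fix z and w :: "nat \<times> nat \<Rightarrow> 'a"
    assume w: "w \<in> coord_space chart_vars"
      and eq: "\<And>S. S \<in> ?I \<Longrightarrow> z * wedge 3 9 ?e S + ?d w S = 0"
    have E: "z * det3 (\<lambda>i j. ?e i ([a, b, c] ! j)) +
        (\<Sum>r<3. det3 (\<lambda>i j. (?e(r := \<lambda>k. w (r, k))) i ([a, b, c] ! j))) = 0"
      if "a < b" "b < c" "c < 9" for a b c
    proof -
      have "{a, b, c} \<in> ?I" using that by (simp add: ksubsets_def)
      from eq[OF this] show ?thesis
        by (simp only: truncate_to_id[OF w] dwedge_def wedge_triple[OF that])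
    qed
    have w0: "w p = 0" if "p \<notin> chart_vars" for p using w that unfolding coord_space_def by blast
    have "z = 0" using E[of 0 1 2] by (simp add: det3_def sum_lessThan_3 w0 chart_vars_def)
    moreover have "w (a, k) = 0" for a k
    proof (cases "(a, k) \<in> chart_vars")
      case True
      then have k: "3 \<le> k" "k < 9" "a = 0 \<or> a = 1 \<or> a = 2" by (auto simp: chart_vars_def)
      then show ?thesis
        using E[of 1 2 k] E[of 0 2 k] E[of 0 1 k]
        by (auto simp: det3_def sum_lessThan_3)
    qed (rule w0)
    ultimately show "z = 0 \<and> w = 0" by (auto simp: fun_eq_iff)
  qed
  then show "18 \<le> proj_dim ?I ?X" by (simp add: card_chart_vars numeral_eq_enat)
qed

section \<open>The dimension of the fourth secant variety\<close>

text \<open>The base point of the parametrisation is the sum of the volume elements of the coordinate spaces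
  \<open>\<langle>e\<^sub>0, e\<^sub>1, e\<^sub>2\<rangle>\<close>, \<open>\<langle>e\<^sub>3, e\<^sub>4, e\<^sub>5\<rangle>\<close>, \<open>\<langle>e\<^sub>6, e\<^sub>7, e\<^sub>8\<rangle>\<close> and of the diagonal
  \<open>\<langle>e\<^sub>0 + e\<^sub>3 + e\<^sub>6, e\<^sub>1 + e\<^sub>4 + e\<^sub>7, e\<^sub>2 + e\<^sub>5 + e\<^sub>8\<rangle>\<close>. The variable \<open>(j, a, k)\<close> moves the \<open>a\<close>-th basis vector of
  the \<open>j\<close>-th space in the direction \<open>e\<^sub>k\<close>, and \<open>(j, 3, 0)\<close> scales the \<open>j\<close>-th summand.\<close>

definition secant_vars :: "(nat \<times> nat \<times> nat) set" where
  "secant_vars = {0} \<times> {..<3} \<times> {3..<9} \<union> {1} \<times> {..<3} \<times> ({..<3} \<union> {6..<9}) \<union> {2} \<times> {..<3} \<times> {..<6}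
     \<union> {..<3} \<times> {3} \<times> {0} \<union> {3} \<times> {0} \<times> {4, 5, 7, 8} \<union> {3} \<times> {1, 2} \<times> {3..<9}"

lemma finite_secant_vars: "finite secant_vars"
  by (simp add: secant_vars_def)

text \<open>54 directions for the first three spaces, 3 scalings and 16 directions for the fourth
  space. The fourth scaling is traded for the base point itself; the missing
  \<open>(3, 0, 3)\<close> and \<open>(3, 0, 6)\<close> account for the defect 2.\<close>

lemma card_secant_vars: "card secant_vars = 73"
proof -
  have "card ({..<3} \<union> {6..<9 :: nat}) = 6" by (subst card_Un_disjoint) auto
  then show ?thesis
    unfolding secant_vars_def by (subst card_Un_disjoint; (auto; fail)?)+
qed

definition base_frame :: "nat \<Rightarrow> nat \<Rightarrow> nat \<Rightarrow> 'a::field" where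
  "base_frame j a k = (if j < 3 then if k = 3 * j + a then 1 else 0 else if k mod 3 = a then 1 else 0)"

definition secant_chart :: "(nat \<times> nat \<times> nat \<Rightarrow> 'a::field) \<Rightarrow> nat set \<Rightarrow> 'a" where
  "secant_chart s = (\<lambda>S. \<Sum>j<4. (1 + truncate_to secant_vars s (j, 3, 0)) *
     wedge 3 9 (\<lambda>a k. base_frame j a k + truncate_to secant_vars s (j, a, k)) S)"

definition secant_chart_deriv :: "(nat \<times> nat \<times> nat \<Rightarrow> 'a::field) \<Rightarrow> nat set \<Rightarrow> 'a" where
  "secant_chart_deriv w S = (\<Sum>j<4. truncate_to secant_vars w (j, 3, 0) * wedge 3 9 (base_frame j) S +
     dwedge (base_frame j) (\<lambda>a k. truncate_to secant_vars w (j, a, k)) S)"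

lemma polyfun_secant_chart: "(\<lambda>s. secant_chart s S) \<in> polyfun secant_vars (1 + 3 * 1)"
  unfolding secant_chart_def
  by (intro polyfun_sum polyfun_mult polyfun_wedge polyfun_add polyfun_const polyfun_truncate_var
      finite_secant_vars)

lemma secant_chart_jet:
  "\<exists>q. (\<forall>t. secant_chart (\<lambda>p. t * w p) S = poly q t) \<and>
    coeff q 0 = (\<Sum>j<4. wedge 3 9 (base_frame j) S) \<and> coeff q 1 = secant_chart_deriv w S"
proof -
  let ?w = "truncate_to secant_vars w"
  have tr: "truncate_to secant_vars (\<lambda>p. t * w p) p = t * ?w p" for t p
    by (simp add: truncate_to_def)
  have "\<forall>j. \<exists>q. (\<forall>t. wedge 3 9 (\<lambda>a k. base_frame j a k + t * ?w (j, a, k)) S = poly q t) \<and>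
      coeff q 0 = wedge 3 9 (base_frame j) S \<and> coeff q 1 = dwedge (base_frame j) (\<lambda>a k. ?w (j, a, k)) S"
    by (intro allI wedge_jet)
  from choice[OF this] obtain q where
    q: "\<forall>j. (\<forall>t. wedge 3 9 (\<lambda>a k. base_frame j a k + t * ?w (j, a, k)) S = poly (q j) t) \<and>
      coeff (q j) 0 = wedge 3 9 (base_frame j) S \<and> coeff (q j) 1 = dwedge (base_frame j) (\<lambda>a k. ?w (j, a, k)) S"
    by (rule exE)
  let ?q = "\<Sum>j<4. [:1, ?w (j, 3, 0):] * q j"
  have "secant_chart (\<lambda>p. t * w p) S = poly ?q t" for t
    using q by (simp add: secant_chart_def tr poly_sum algebra_simps)
  moreover have "coeff ?q 0 = (\<Sum>j<4. wedge 3 9 (base_frame j) S)"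
    using q by (simp add: coeff_sum)
  moreover have "coeff ?q 1 = secant_chart_deriv w S"
    using q by (simp add: coeff_sum secant_chart_deriv_def add.commute)
  ultimately show ?thesis by (intro exI[of _ ?q]) simp
qed

lemma secant_chart_deriv_add:
  "secant_chart_deriv (\<lambda>p. w p + w' p) S = secant_chart_deriv w S + secant_chart_deriv w' S"
proof -
  have "truncate_to secant_vars (\<lambda>p. w p + w' p) p = truncate_to secant_vars w p + truncate_to secant_vars w' p" for p
    by (simp add: truncate_to_def)
  then show ?thesis
    by (simp add: secant_chart_deriv_def dwedge_add sum.distrib algebra_simps)
qed

lemma secant_chart_deriv_scale: "secant_chart_deriv (\<lambda>p. c * w p) S = c * secant_chart_deriv w S"
proof -
  have "truncate_to secant_vars (\<lambda>p. c * w p) p = c * truncate_to secant_vars w p" for p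
    by (simp add: truncate_to_def)
  then show ?thesis
    by (simp add: secant_chart_deriv_def dwedge_scale sum_distrib_left algebra_simps)
qed

lemma sum_lessThan_4: "(\<Sum>i<4. f i) = f 0 + f 1 + f 2 + f (3::nat)"
  by (simp add: eval_nat_numeral)

text \<open>A variable of one of the first three spaces affects only triples with at least two
  indices in its block of {0, 1, 2}, {3, 4, 5}, {6, 7, 8}. Triples with one index in each block
  therefore see only \<open>z\<close> and the fourth space; once these vanish, each remaining
  variable is isolated by one coordinate.\<close>

lemma secant_chart_deriv_inj:
  fixes z :: "'a::field_char_0"
  assumes w: "w \<in> coord_space secant_vars"
    and eq: "\<And>S. S \<in> ksubsets 3 9 \<Longrightarrow> z * (\<Sum>j<4. wedge 3 9 (base_frame j) S) + secant_chart_deriv w S = 0"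
  shows "z = 0 \<and> w = 0"
proof -
  have E: "z * (\<Sum>j<4. det3 (\<lambda>i l. base_frame j i ([a, b, c] ! l))) +
      (\<Sum>j<4. w (j, 3, 0) * det3 (\<lambda>i l. base_frame j i ([a, b, c] ! l)) +
        (\<Sum>r<3. det3 (\<lambda>i l. ((base_frame j)(r := \<lambda>k. w (j, r, k))) i ([a, b, c] ! l)))) = 0"
    if "a < b" "b < c" "c < 9" for a b c
  proof -
    have "{a, b, c} \<in> ksubsets 3 9" using that by (simp add: ksubsets_def)
    from eq[OF this] show ?thesis
      by (simp only: truncate_to_id[OF w] secant_chart_deriv_def dwedge_def wedge_triple[OF that])
  qed
  have w0: "w p = 0" if "p \<notin> secant_vars" for p using w that unfolding coord_space_def by blast
  note ev = det3_def sum_lessThan_3 sum_lessThan_4 base_frame_def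
  have out: "w (3, 0, 3) = 0" "w (3, 0, 6) = 0" "w (3, a, 0) = 0" "w (3, a, Suc 0) = 0" "w (3, a, 2) = 0" for a
    by (rule w0; simp add: secant_vars_def)+
  \<comment> \<open>In \<open>off1\<close> to \<open>off12\<close> two of the columns have the same
    residue mod 3. The coordinate is then, up to sign, the difference of the entries in these
    columns of the row whose residue is missing; the one in a column below 3 is zero by
    \<open>out\<close>.\<close>
  have off1: "w (3, 2, 3) = 0" using E[of 0 3 7] by (simp add: ev out)
  have off2: "w (3, 1, 3) = 0" using E[of 0 3 8] by (simp add: ev out)
  have off3: "w (3, 2, 4) = 0" using E[of 1 4 6] by (simp add: ev out)
  have off4: "w (3, 0, 4) = 0" using E[of 1 4 8] by (simp add: ev out)
  have off5: "w (3, 1, 5) = 0" using E[of 2 5 6] by (simp add: ev out)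
  have off6: "w (3, 0, 5) = 0" using E[of 2 5 7] by (simp add: ev out)
  have off7: "w (3, 2, 6) = 0" using E[of 0 4 6] by (simp add: ev out)
  have off8: "w (3, 1, 6) = 0" using E[of 0 5 6] by (simp add: ev out)
  have off9: "w (3, 2, 7) = 0" using E[of 1 3 7] by (simp add: ev out)
  have off10: "w (3, 0, 7) = 0" using E[of 1 5 7] by (simp add: ev out)
  have off11: "w (3, 1, 8) = 0" using E[of 2 3 8] by (simp add: ev out)
  have off12: "w (3, 0, 8) = 0" using E[of 2 4 8] by (simp add: ev out)
  note off = off1 off2 off3 off4 off5 off6 off7 off8 off9 off10 off11 off12
  \<comment> \<open>All residues distinct: up to sign the coordinate is \<open>z\<close> plus the
    three entries \<open>w (3, a, k)\<close> with \<open>k mod 3 = a\<close>. As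
    \<open>(3, 0, 3)\<close> and \<open>(3, 0, 6)\<close> are absent, \<open>d1\<close>,
    \<open>d2\<close> and \<open>d3\<close> force \<open>z = 0\<close>.\<close>
  have d1: "z + w (3, 1, 4) = 0" using E[of 2 4 6]
    by (simp add: ev out; metis add.right_inverse)
  have d2: "z + w (3, 2, 8) = 0" using E[of 1 3 8]
    by (simp add: ev out; metis add.right_inverse)
  have d3: "z + w (3, 1, 4) + w (3, 2, 8) = 0" using E[of 0 4 8]
    by (simp add: ev out add.assoc)
  have d4: "z + w (3, 2, 5) = 0" using E[of 1 5 6] by (simp add: ev out; algebra)
  have d5: "z + w (3, 1, 7) = 0" using E[of 2 3 7] by (simp add: ev out; algebra)
  from d1 d3 have "w (3, 2, 8) = 0" by simp
  with d2 have z: "z = 0" by simp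
  have w3: "w (3, a, k) = 0" if "a \<noteq> 3" for a k
  proof (cases "(3, a, k) \<in> secant_vars")
    case True
    then have "a = 0 \<and> k \<in> {4, 5, 7, 8} \<or> (a = 1 \<or> a = 2) \<and> 3 \<le> k \<and> k < 9"
      by (auto simp: secant_vars_def)
    moreover have "k \<in> {3, 4, 5, 6, 7, 8}" if "3 \<le> k" "k < 9" using that by auto
    ultimately show ?thesis using off d1 d2 d4 d5 z by auto
  qed (rule w0)
  have out0: "w (3, 3, 0) = 0" "w (0, 0, 0) = 0" "w (0, Suc 0, Suc 0) = 0" "w (0, 2, 2) = 0"
      "w (Suc 0, 0, 3) = 0" "w (Suc 0, Suc 0, 4) = 0" "w (Suc 0, 2, 5) = 0"
      "w (2, 0, 6) = 0" "w (2, Suc 0, 7) = 0" "w (2, 2, 8) = 0"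
    by (rule w0; simp add: secant_vars_def)+
  have scale: "w (j, 3, 0) = 0" for j
  proof (cases "j < 3")
    case True
    then consider "j = 0" | "j = 1" | "j = 2" by fastforce
    then show ?thesis
      using E[of 0 1 2] E[of 3 4 5] E[of 6 7 8]
      by cases (simp_all add: ev z w3 out0)
  next
    case False
    then show ?thesis by (intro w0) (auto simp: secant_vars_def)
  qed
  have "w (j, a, k) = 0" for j a k
  proof (cases "(j, a, k) \<in> secant_vars \<and> j < 3 \<and> a \<noteq> 3")
    case True
    then have k: "k < 9" and "a < 3" by (auto simp: secant_vars_def)
    from \<open>a < 3\<close> have a: "a = 0 \<or> a = 1 \<or> a = 2" by auto
    from True consider "j = 0" "3 \<le> k" | "j = 1" "k < 3" | "j = 1" "6 \<le> k" | "j = 2" "k < 6"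
      by (auto simp: secant_vars_def)
    then show ?thesis
    proof cases
      case 1
      then show ?thesis using a E[of 1 2 k] E[of 0 2 k] E[of 0 1 k] k
        by (auto simp: ev z w3 scale)
    next
      case 2
      then show ?thesis using a E[of k 4 5] E[of k 3 5] E[of k 3 4]
        by (auto simp: ev z w3 scale)
    next
      case 3
      then show ?thesis using a E[of 4 5 k] E[of 3 5 k] E[of 3 4 k] k
        by (auto simp: ev z w3 scale)
    next
      case 4
      then show ?thesis using a E[of k 7 8] E[of k 6 8] E[of k 6 7]
        by (auto simp: ev z w3 scale)
    qed
  next
    case False
    show ?thesis
    proof (cases "(j, a, k) \<in> secant_vars")
      case True
      then have "a = 3 \<and> k = 0 \<or> a \<noteq> 3 \<and> j \<le> 3" by (auto simp: secant_vars_def)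
      with True False have "a = 3 \<and> k = 0 \<or> a \<noteq> 3 \<and> j = 3" by linarith
      then show ?thesis using scale w3 by blast
    qed (rule w0)
  qed
  with z show ?thesis by (auto simp: fun_eq_iff)
qed

text \<open>\<open>secant_param\<close> serves only to detect the forms vanishing on the secant
  variety, whereas every nonzero value of \<open>secant_chart\<close> is a sum of four wedges and so
  defines a point of it.\<close>

lemma proj_dim_secant:
  fixes X :: "(nat set \<Rightarrow> 'a::{alg_closed_field, field_char_0}) set set"
  defines "X \<equiv> pluecker 3 9 ` grassmannian 3 9"
  shows "proj_dim (ksubsets 3 9) (secant_variety (ksubsets 3 9) 4 X) = 73"
proof (rule antisym)
  let ?I = "ksubsets 3 9" and ?Y = "secant_variety (ksubsets 3 9) 4 X"
  define U where "U = (\<Union>p\<in>{p :: nat \<Rightarrow> _. \<forall>j<4. p j \<in> X}. proj_span ?I (p ` {..<4}))"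
  have Y: "?Y = zariski ?I closure_of U" by (simp add: secant_variety_def U_def)
  have UI: "U \<subseteq> proj_space ?I" by (auto simp: U_def proj_span_def)
  have UY: "U \<subseteq> ?Y"
    unfolding Y by (rule closure_of_subset) (simp add: topspace_zariski UI)
  have "form_dense ?I secant_param (\<Union>?Y)"
    unfolding form_dense_def
  proof (intro allI ballI impI)
    fix t and f :: "(nat set \<Rightarrow>\<^sub>0 nat) \<Rightarrow>\<^sub>0 'a" and x
    assume f: "f \<in> hom_polys ?I t" "\<forall>s. mpoly_eval f (secant_param s) = 0" and x: "x \<in> \<Union>?Y"
    have "mpoly_eval f y = 0" if "y \<in> \<Union>U" for y
    proof -
      obtain L where L: "L \<in> U" "y \<in> L" using \<open>y \<in> \<Union>U\<close> by blast
      obtain x c and v :: "nat \<Rightarrow> nat \<Rightarrow> nat \<Rightarrow> 'a"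
        where "L = proj_point x" and x: "x = (\<lambda>S. \<Sum>j<4. c j * wedge 3 9 (v j) S)"
        using secant_union_subset[OF L(1)[unfolded U_def X_def]] by auto
      moreover have "mpoly_eval f x = 0"
        unfolding x by (rule vanish_on_sums[OF f(1)]) (use f(2) in blast)
      ultimately show ?thesis using vanishes_on_proj_point_iff[OF f(1)] L(2) by blast
    qed
    from vanish_on_closure[OF f(1) UI this, where X = UNIV] x show "mpoly_eval f x = 0"
      by (auto simp: Y)
  qed
  then have "proj_dim ?I ?Y \<le> enat (card slice_vars)"
    by (rule proj_dim_le_param[OF finite_slice_vars polyfun_secant_param])
  then show "proj_dim ?I ?Y \<le> 73" by (simp add: card_slice_vars numeral_eq_enat)
  have "enat (card secant_vars) \<le> proj_dim ?I ?Y"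
  proof (rule proj_dim_ge_param[where \<phi> = secant_chart and d\<phi> = secant_chart_deriv
        and \<psi> = "\<lambda>S. \<Sum>j<4. wedge 3 9 (base_frame j) S"])
    show "finite ?I" by (rule finite_ksubsets)
    show "finite secant_vars" by (rule finite_secant_vars)
    show "(\<lambda>s. secant_chart s S) \<in> polyfun secant_vars (1 + 3 * 1)" for S by (rule polyfun_secant_chart)
    show "secant_chart s \<in> coord_space ?I" for s :: "_ \<Rightarrow> 'a"
      by (simp add: coord_space_def secant_chart_def wedge_def)
    show "proj_point (secant_chart s) \<in> ?Y" if "secant_chart s \<noteq> 0" for s :: "_ \<Rightarrow> 'a"
      using secant_union_mem[OF secant_chart_def that] UY unfolding U_def X_def by blast
  qed (rule secant_chart_jet secant_chart_deriv_add secant_chart_deriv_scale secant_chart_deriv_inj; assumption)+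
  then show "73 \<le> proj_dim ?I ?Y" by (simp add: card_secant_vars numeral_eq_enat)
qed

theorem mainTheorem5:
  fixes X :: "(nat set \<Rightarrow> 'a::{alg_closed_field, field_char_0}) set set"
  defines "X \<equiv> pluecker 3 9 ` grassmannian 3 9"
  shows "proj_dim (ksubsets 3 9) (secant_variety (ksubsets 3 9) 4 X) = 73 \<and>
    expected_secant_dim (ksubsets 3 9) 4 X = 75 \<and>
    secant_defective (ksubsets 3 9) 4 X"
proof -
  have dim: "proj_dim (ksubsets 3 9) (secant_variety (ksubsets 3 9) 4 X) = 73"
    unfolding X_def by (rule proj_dim_secant)
  have "(9::nat) choose 3 = 84" by (simp add: eval_nat_numeral)
  then have exp: "expected_secant_dim (ksubsets 3 9) 4 X = 75"
    unfolding expected_secant_dim_def X_def proj_dim_grassmannian card_ksubsets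
    by (simp add: numeral_eq_enat one_enat_def)
  show ?thesis using dim exp by (simp add: secant_defective_def)
qed

end
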